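(* Let $N\ge 2$ be an even integer, let $b\ge 3$ be an odd integer, and let $\phi_0,\phi_1,\ldots,\phi_N$ be the Foulkes characters of the hyperoctahedral group $B_N=G(2,1,N)$. Let $M_B=(M_B(i,j))_{0\le i,j\le N}$ be the transition matrix of the Markov chain of carries arising when $N$ random numbers are added in base $b$ using balanced digits, with states shifted by $N/2$. Then for all $0\le i,j\le N$, $$M_B(i,j)=[\phi_i,\,b^{\ell-N}\phi_j],$$ where $b^{\ell-N}\phi_j$ denotes the function $x\mapsto b^{\ell(x)-N}\phi_j(x)$ on $B_N$.
   Context: Carries chain: digits are the balanced digits $\{-\frac{b-1}{2},\ldots,-1,0,1,\ldots,\frac{b-1}{2}\}$, and the digits of the $N$ numbers are independent and uniform on this set. If the last carry is $\kappa$ and the digits in the current column are $U_1,\ldots,U_N$, the next carry is the unique integer $\kappa'$ such that $\kappa+U_1+\cdots+U_N-b\kappa'$ is a balanced digit. $M_B(i,j)$ is the probability that the next carry is $j-\frac N2$ given that the last carry is $i-\frac N2$. $B_N=G(2,1,N)$ is the group of $N\times N$ signed permutation matrices. Each $x\in B_N$ is $x=DA_\pi$ with $D$ diagonal with entries $\pm1$ and $A_\pi=(\delta_{i\pi(j)})$, $\pi\in S_N$. The type of $x$ is the pair of partitions $(\lambda^0,\lambda^1)$, where the parts of $\lambda^j$ are the lengths of the cycles $(i_1\,i_2\,\ldots\,i_k)$ of $\pi$ with $x_{i_1i_2}x_{i_2i_3}\cdots x_{i_ki_1}=(-1)^j$; $K_{(\lambda^0,\lambda^1)}$ is the conjugacy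 class of elements of that type. $\ell(x)$ is the number of parts of $\lambda^0$ (equivalently $\ell(x)=\dim\ker(x-1)$), and $C_i=\{x\in B_N\mid\ell(x)=i\}$, $0\le i\le N$. $\mathrm{CF}_\ell(B_N)$ is the complex vector space of functions on $B_N$ depending only on $\ell$; $\vartheta(C_i)$ is the common value of such a $\vartheta$ on $C_i$. The Foulkes characters of $B_N$ are given by $\phi_i(x)=\sum_{j=0}^{N}(-1)^{i-j}\binom{N+1}{i-j}(2j+1)^{\ell(x)}$, $0\le i\le N$, with $\binom{a}{c}=0$ for $c<0$. The inner product on $\mathrm{CF}_\ell(B_N)$ is $[\vartheta,\psi]=\frac{1}{|B_N|}\sum_{i,j=0}^{N}\vartheta(C_i)\overline{\psi(C_j)}\mu(C_i,C_j)$, where (for $N\ge2$) $\mu=\frac12\mu_1+\frac14\mu_3+\frac14\mu_4$, $\mu_t=\mu_{\mathfrak a_t}$, with $\mathfrak a_1=(K_{((N),\emptyset)},K_{((N),\emptyset)})$, $\mathfrak a_3=(K_{((N),\emptyset)},K_{((N-1),(1))})$, $\mathfrak a_4=(K_{((N),\emptyset)},K_{((N),\emptyset)},K_{((N-1,1),\emptyset)},K_{((N-1,1),\emptyset)})$, and, for a sequence $\mathfrak a=(K_1,\ldots,K_m)$ of conjugacy classes, $\mu_{\mathfrak a}(C_i,C_j)=\mathbf{E}\,|k_1k_2\cdots k_mC_i\cap C_j|$ with $k_1,\ldots,k_m$ independent and $k_u$ uniformly random in $K_u$. *)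

theory Defs
  imports
    "HOL-Probability.Probability"
    "HOL-Combinatorics.Orbits"
    "HOL-Library.Multiset"
    "Jordan_Normal_Form.Matrix"
begin

section \<open>The carries chain with balanced digits\<close>

definition balanced_digits :: "int \<Rightarrow> int set" where
  "balanced_digits b = {- ((b - 1) div 2) .. (b - 1) div 2}"

definition next_carry :: "int \<Rightarrow> int \<Rightarrow> int \<Rightarrow> int" where
  "next_carry b \<kappa> s = (THE \<kappa>'. \<kappa> + s - b * \<kappa>' \<in> balanced_digits b)"

text \<open>The digits \<open>U 0, \<dots>, U (N - 1)\<close> of one column are independent and uniform.\<close>

definition column_pmf :: "int \<Rightarrow> nat \<Rightarrow> (nat \<Rightarrow> int) pmf" where
  "column_pmf b N = Pi_pmf {..<N} 0 (\<lambda>_. pmf_of_set (balanced_digits b))"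

definition carry_kernel :: "int \<Rightarrow> nat \<Rightarrow> int \<Rightarrow> int pmf" where
  "carry_kernel b N \<kappa> = map_pmf (\<lambda>U. next_carry b \<kappa> (\<Sum>t<N. U t)) (column_pmf b N)"

text \<open>Meant for even \<open>N\<close> only, so that the shift \<open>N div 2\<close> is exactly $N/2$.\<close>

definition carries_matrix :: "int \<Rightarrow> nat \<Rightarrow> nat \<Rightarrow> nat \<Rightarrow> real" where
  "carries_matrix b N i j =
     pmf (carry_kernel b N (int i - int (N div 2))) (int j - int (N div 2))"


section \<open>The hyperoctahedral group\<close>

text \<open>Rows and columns are indexed by \<open>{0..<N}\<close>.\<close>

definition perm_mat :: "nat \<Rightarrow> (nat \<Rightarrow> nat) \<Rightarrow> int mat" where
  "perm_mat N \<pi> = Matrix.mat N N (\<lambda>(i, j). if i = \<pi> j then 1 else 0)"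

definition signed_perm_decomp :: "nat \<Rightarrow> int mat \<Rightarrow> (nat \<Rightarrow> nat) \<Rightarrow> bool" where
  "signed_perm_decomp N x \<pi> \<longleftrightarrow> \<pi> permutes {..<N} \<and>
     (\<exists>d. (\<forall>i<N. d i = 1 \<or> d i = -1) \<and> x = mat_diag N d * perm_mat N \<pi>)"

definition hyperoctahedral :: "nat \<Rightarrow> int mat set" where
  "hyperoctahedral N = {x. \<exists>\<pi>. signed_perm_decomp N x \<pi>}"

definition underlying_perm :: "nat \<Rightarrow> int mat \<Rightarrow> (nat \<Rightarrow> nat)" where
  "underlying_perm N x = (THE \<pi>. signed_perm_decomp N x \<pi>)"

definition cycles_of :: "nat \<Rightarrow> int mat \<Rightarrow> nat set set" where
  "cycles_of N x = orbit (underlying_perm N x) ` {..<N}"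

text \<open>
  The product $x_{i_1i_2} x_{i_2i_3} \cdots x_{i_ki_1}$ of the nonzero entries of \<open>x\<close> along a
  cycle.  The entry $x_{i_ti_{t+1}}$ is nonzero iff $i_t = \pi(i_{t+1})$, so this is the
  product of the entries $x_{\pi(i),i}$ over the points \<open>i\<close> of the cycle.
\<close>

definition cycle_sign :: "nat \<Rightarrow> int mat \<Rightarrow> nat set \<Rightarrow> int" where
  "cycle_sign N x c = (\<Prod>i\<in>c. x $$ (underlying_perm N x i, i))"

text \<open>Partitions are represented as multisets of parts.\<close>

definition type_part :: "nat \<Rightarrow> int mat \<Rightarrow> nat \<Rightarrow> nat multiset" where
  "type_part N x j = image_mset card (mset_set {c \<in> cycles_of N x. cycle_sign N x c = (-1) ^ j})"

definition signed_type :: "nat \<Rightarrow> int mat \<Rightarrow> nat multiset \<times> nat multiset" where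
  "signed_type N x = (type_part N x 0, type_part N x 1)"

definition class_of_type :: "nat \<Rightarrow> nat multiset \<times> nat multiset \<Rightarrow> int mat set" where
  "class_of_type N \<tau> = {x \<in> hyperoctahedral N. signed_type N x = \<tau>}"

definition ell :: "nat \<Rightarrow> int mat \<Rightarrow> nat" where
  "ell N x = size (fst (signed_type N x))"

definition ell_class :: "nat \<Rightarrow> nat \<Rightarrow> int mat set" where
  "ell_class N i = {x \<in> hyperoctahedral N. ell N x = i}"


section \<open>Foulkes characters and the inner product\<close>

definition CF_ell :: "nat \<Rightarrow> (int mat \<Rightarrow> complex) set" where
  "CF_ell N = {\<theta>. \<forall>x\<in>hyperoctahedral N. \<forall>y\<in>hyperoctahedral N. ell N x = ell N y \<longrightarrow> \<theta> x = \<theta> y}"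

text \<open>The common value of \<open>\<theta> \<in> CF_ell N\<close> on \<open>ell_class N i\<close>.\<close>

definition class_value :: "nat \<Rightarrow> (int mat \<Rightarrow> complex) \<Rightarrow> nat \<Rightarrow> complex" where
  "class_value N \<theta> i = the_elem (\<theta> ` ell_class N i)"

definition foulkes_char :: "nat \<Rightarrow> nat \<Rightarrow> int mat \<Rightarrow> complex" where
  "foulkes_char N i x =
     (\<Sum>j=0..N. (-1) powi (int i - int j)
        * (if j \<le> i then of_nat ((N + 1) choose (i - j)) else 0)
        * (2 * of_nat j + 1) ^ ell N x)"

text \<open>
  \<open>class_walk N Ks S T\<close> is the expected cardinality of $k_1 \cdots k_m S \cap T$ for independent
  $k_1, \dots, k_m$ with $k_u$ uniform in the \<open>u\<close>-th entry of \<open>Ks\<close>.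
\<close>

definition class_walk :: "nat \<Rightarrow> int mat set list \<Rightarrow> int mat set \<Rightarrow> int mat set \<Rightarrow> real" where
  "class_walk N Ks S T =
     measure_pmf.expectation
       (Pi_pmf {..<length Ks} (1\<^sub>m N) (\<lambda>u. pmf_of_set (Ks ! u)))
       (\<lambda>k. real (card ((\<lambda>x. foldr (\<lambda>u A. k u * A) [0..<length Ks] (1\<^sub>m N) * x) ` S \<inter> T)))"

definition mu :: "nat \<Rightarrow> int mat set \<Rightarrow> int mat set \<Rightarrow> real" where
  "mu N S T =
     (let K1 = class_of_type N ({#N#}, {#});
          K2 = class_of_type N ({#N - 1#}, {#1#});
          K3 = class_of_type N ({#N - 1, 1#}, {#})
      in 1/2 * class_walk N [K1, K1] S T
         + 1/4 * class_walk N [K1, K2] S T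
         + 1/4 * class_walk N [K1, K1, K3, K3] S T)"

definition CF_inner :: "nat \<Rightarrow> (int mat \<Rightarrow> complex) \<Rightarrow> (int mat \<Rightarrow> complex) \<Rightarrow> complex" where
  "CF_inner N \<theta> \<psi> =
     1 / of_nat (card (hyperoctahedral N))
     * (\<Sum>i=0..N. \<Sum>j=0..N. class_value N \<theta> i * cnj (class_value N \<psi> j)
          * complex_of_real (mu N (ell_class N i) (ell_class N j)))"

lemma foulkes_char_in_CF_ell: "foulkes_char N i \<in> CF_ell N"
  by (simp add: CF_ell_def foulkes_char_def)

lemma twisted_foulkes_char_in_CF_ell:
  "(\<lambda>x. of_int b powi (int (ell N x) - int N) * foulkes_char N j x) \<in> CF_ell N"
  by (simp add: CF_ell_def foulkes_char_def)

end

theory Submission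
  imports Defs "HOL-Computational_Algebra.Computational_Algebra"
begin

text \<open>By bilinearity it suffices to pair the functions $p_r(x) = (2r+1)^{\ell(x)}$, and $b^\ell p_s = p_t$ with
  $2t+1 = b(2s+1)$. Writing elements of $B_N$ as signed permutations and summing over the signs turns
  $(2r+1)^\ell$ into sums of powers $r^{c}$ and $(r+1)^{c}$, where $c$ counts the cycles of the underlying
  permutation, so everything happens in $S_N$. Inserting one point at a time gives, for every $\pi$,
  $\sum_m m^{c(\kappa\pi)} t^m$, summed over all $N$-cycles $\kappa$, as
  $(N-1)!\, t \prod_C (1 - t^{|C|}) / (1-t)^{N+2}$, the product running over the cycles of $\pi$. The
  coefficients of $\prod_C (1 - t^{|C|}) / (1-t)$ are up to sign the hook characters, which are orthonormal;
  this evaluates the $\mathfrak{a}_1$ term. The products of an $N$-cycle and an $(N-1)$-cycle are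
  equidistributed on the odd permutations, so the $\mathfrak{a}_3$ and $\mathfrak{a}_4$ terms only involve the
  trivial and the sign character; they supply the two missing boundary terms in
  $[p_r, p_t] = \sum_{k=0}^N {r+N-k \choose N} {t+N-k \choose N}$. The Foulkes coefficients invert the
  matrix ${r+N-k \choose N}$, leaving one alternating sum of binomials, the inclusion-exclusion count of the
  digit vectors that produce the given carry.\<close>

text \<open>No representation theory is used: hook characters enter only as coefficients of explicit
  polynomials, and their orthogonality is a mean of cycle weights. Inserting a point works because a
  transposition merges or splits cycles, and the changes of the factors \<open>1 - t^c\<close>
  cancel against a logarithmic derivative. The weights in \<open>mu\<close> repair a boundary
  defect. Summing over signs turns the pairing of p_r and p_t into an S_N pairing at
  \<open>(r + 1, t + 1)\<close> plus or minus one at \<open>(r, t)\<close>. Let b_k be the k-th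
  summand of the final formula. Up to normalisation the a_1 walk gives b_0 + ... + b_{N-1} and b_1 +
  ... + b_N, so weight 1/2 misses half of b_0 and half of b_N. The permutations of the a_3 walk are
  uniform on the odd ones with total sign -1, those of the a_4 walk are uniform on the even ones
  with total sign 1. With weight 1/4 each, their other terms cancel and the two halves remain. On
  the side of the carries, the condition that the resulting digit is balanced is encoded by a slack
  digit. This makes N + 1 digits and so matches the binomials in the Foulkes characters.\<close>

hide_const (open) Finite_Cartesian_Product.transpose

section \<open>Cycles of permutations\<close>

text \<open>The carrier is explicit because points of \<open>S\<close> fixed by the permutation
  count as singleton cycles, so the number of cycles changes when a fixed point is added to
  \<open>S\<close>.\<close>

definition cycles :: "'a set \<Rightarrow> ('a \<Rightarrow> 'a) \<Rightarrow> 'a set set" where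
  "cycles S \<pi> = orbit \<pi> ` S"

text \<open>The codomain is general: the weights take values in power series
  (\<open>cycle_fps\<close>), in polynomials (\<open>cycle_poly\<close>) and in the reals.\<close>

definition cycle_weight :: "'a set \<Rightarrow> (nat \<Rightarrow> 'b::comm_monoid_mult) \<Rightarrow> ('a \<Rightarrow> 'a) \<Rightarrow> 'b" where
  "cycle_weight S w \<pi> = (\<Prod>C\<in>cycles S \<pi>. w (card C))"

lemma finite_cycles [simp]: "finite S \<Longrightarrow> finite (cycles S \<pi>)"
  by (simp add: cycles_def)

context
  fixes S :: "'a set" and \<pi> :: "'a \<Rightarrow> 'a"
  assumes fin: "finite S" and perm: "\<pi> permutes S"
begin

lemma self_in_orbit_permutes: "x \<in> orbit \<pi> x"
  by (rule permutation_self_in_orbit) (use fin perm permutation_permutes in blast)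

lemma orbit_eq_permutes: "y \<in> orbit \<pi> x \<Longrightarrow> orbit \<pi> y = orbit \<pi> x"
  by (metis cyclic_on_orbit fin orbit_cyclic_eq3 perm permutation_permutes)

lemma orbit_eq_iff_permutes: "orbit \<pi> x = orbit \<pi> y \<longleftrightarrow> y \<in> orbit \<pi> x"
  using orbit_eq_permutes self_in_orbit_permutes by metis

lemma orbit_disjoint_permutes: "orbit \<pi> x \<noteq> orbit \<pi> y \<Longrightarrow> orbit \<pi> x \<inter> orbit \<pi> y = {}"
  by (metis disjoint_iff orbit_eq_permutes)

lemma orbit_subset_permutes: "x \<in> S \<Longrightarrow> orbit \<pi> x \<subseteq> S"
  using perm permutes_orbit_subset by metis

lemma Union_cycles: "\<Union>(cycles S \<pi>) = S"
  unfolding cycles_def using orbit_subset_permutes self_in_orbit_permutes by blast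

lemma cycles_disjoint: "\<lbrakk>C \<in> cycles S \<pi>; D \<in> cycles S \<pi>; C \<noteq> D\<rbrakk> \<Longrightarrow> C \<inter> D = {}"
  unfolding cycles_def using orbit_disjoint_permutes by fast

lemma finite_orbit_permutes: "finite (orbit \<pi> x)"
  by (cases "x \<in> S")
    (use fin orbit_subset_permutes finite_subset perm in \<open>blast\<close>,
     metis finite.emptyI finite_insert orbit_eq_singleton_iff perm permutes_not_in)

text \<open>Labels the points of an orbit by the exponents \<open>0, ..., c - 1\<close>, so that
  cutting a cycle becomes cutting an interval.\<close>

lemma orbit_period:
  obtains c where "0 < c" "(\<pi> ^^ c) p = p" "\<And>i. \<lbrakk>0 < i; i < c\<rbrakk> \<Longrightarrow> (\<pi> ^^ i) p \<noteq> p"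
    "orbit \<pi> p = (\<lambda>i. (\<pi> ^^ i) p) ` {..<c}" "inj_on (\<lambda>i. (\<pi> ^^ i) p) {..<c}"
    "card (orbit \<pi> p) = c"
proof -
  obtain n where n: "0 < n" "(\<pi> ^^ n) p = p"
    using self_in_orbit_permutes[of p] unfolding orbit_altdef by auto
  define c where "c = (LEAST n. 0 < n \<and> (\<pi> ^^ n) p = p)"
  have c: "0 < c \<and> (\<pi> ^^ c) p = p"
    unfolding c_def by (rule LeastI) (use n in blast)
  have least: "(\<pi> ^^ i) p \<noteq> p" if "0 < i" "i < c" for i
    using not_less_Least[of i "\<lambda>n. 0 < n \<and> (\<pi> ^^ n) p = p"] that unfolding c_def by blast
  have mod: "(\<pi> ^^ n) p = (\<pi> ^^ (n mod c)) p" for n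
    using c by (metis funpow_mod_eq)
  have orb: "orbit \<pi> p = (\<lambda>i. (\<pi> ^^ i) p) ` {..<c}"
  proof
    show "orbit \<pi> p \<subseteq> (\<lambda>i. (\<pi> ^^ i) p) ` {..<c}"
      unfolding orbit_altdef using mod c by (force simp: image_iff)
    show "(\<lambda>i. (\<pi> ^^ i) p) ` {..<c} \<subseteq> orbit \<pi> p"
      using funpow_in_orbit self_in_orbit_permutes by fast
  qed
  have inj: "inj_on (\<lambda>i. (\<pi> ^^ i) p) {..<c}"
    by (rule inj_onI)
      (metis c inj_on_funpow_least least atLeastLessThan_iff bot_nat_0.extremum inj_onD lessThan_iff)
  show ?thesis
    using that[of c] c least orb inj card_image[OF inj] by auto
qed

end

section \<open>Effect of one transposition on the cycles of a permutation\<close>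

lemma orbit_eq_segment:
  assumes "0 < d" "(g ^^ d) p = p"
  shows "orbit g p = (\<lambda>i. (g ^^ i) p) ` {..<d}"
proof
  show "orbit g p \<subseteq> (\<lambda>i. (g ^^ i) p) ` {..<d}"
    unfolding orbit_altdef
  proof clarify
    fix n
    have "(g ^^ n) p = (g ^^ (n mod d)) p" using assms(2) by (metis funpow_mod_eq)
    with assms(1) show "(g ^^ n) p \<in> (\<lambda>i. (g ^^ i) p) ` {..<d}" by (force simp: image_iff)
  qed
  show "(\<lambda>i. (g ^^ i) p) ` {..<d} \<subseteq> orbit g p"
  proof clarify
    fix i
    have "(g ^^ i) p = (g ^^ (i + d)) p" using assms(2) by (simp add: funpow_add)
    with assms(1) show "(g ^^ i) p \<in> orbit g p" unfolding orbit_altdef by force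
  qed
qed

text \<open>The transposition acts after \<open>\<pi>\<close>, and \<open>\<pi>\<close> maps the
  orbit of \<open>y\<close> into itself, hence never to \<open>a\<close> or \<open>p\<close>; the
  two maps agree on it.\<close>

lemma orbit_transpose_comp_other:
  assumes "finite S" "\<pi> permutes S" "y \<notin> orbit \<pi> a" "y \<notin> orbit \<pi> p"
  shows "orbit (transpose a p \<circ> \<pi>) y = orbit \<pi> y"
proof -
  have "a \<notin> orbit \<pi> y" "p \<notin> orbit \<pi> y"
    using assms orbit_eq_permutes self_in_orbit_permutes by fast+
  then have "\<pi> z = (transpose a p \<circ> \<pi>) z" if "z \<in> orbit \<pi> y" for z
    using orbit.step[OF that] by (metis comp_apply transpose_apply_other)
  moreover have "\<pi> \<in> orbit \<pi> y \<rightarrow> orbit \<pi> y" by (auto intro: orbit.step)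
  ultimately show ?thesis
    using orbit_cong0[OF self_in_orbit_permutes[OF assms(1,2)]] by metis
qed

text \<open>A walk from \<open>p\<close> follows the cycle of \<open>p\<close> until
  \<open>\<pi>\<close> would return to \<open>p\<close>; the transposition sends it to
  \<open>a\<close> instead, and after the cycle of \<open>a\<close> it comes back to
  \<open>p\<close> in the same way.\<close>

lemma orbit_transpose_comp_merge:
  assumes "finite S" "\<pi> permutes S" "orbit \<pi> a \<noteq> orbit \<pi> p"
  shows "orbit (transpose a p \<circ> \<pi>) p = orbit \<pi> a \<union> orbit \<pi> p"
proof -
  let ?g = "transpose a p \<circ> \<pi>"
  note self = self_in_orbit_permutes[OF assms(1,2)]
  have disj: "orbit \<pi> a \<inter> orbit \<pi> p = {}"
    using orbit_disjoint_permutes assms by metis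
  have stepg: "transpose a p (\<pi> z) \<in> orbit ?g p" if "z \<in> orbit ?g p" for z
    using orbit.step[OF that] by simp
  \<comment> \<open>One statement for both halves: \<open>x\<close> is the start of one cycle and
    \<open>y\<close> of the other, so it is used with \<open>(p, a)\<close> and with
    \<open>(a, p)\<close>.\<close>
  have reach: "orbit \<pi> x \<subseteq> orbit ?g p \<and> y \<in> orbit ?g p"
    if "x \<in> orbit ?g p" and xy: "x = a \<and> y = p \<or> x = p \<and> y = a" for x y
  proof -
    obtain c where c: "0 < c" "(\<pi> ^^ c) x = x" "\<And>i. \<lbrakk>0 < i; i < c\<rbrakk> \<Longrightarrow> (\<pi> ^^ i) x \<noteq> x"
      "orbit \<pi> x = (\<lambda>i. (\<pi> ^^ i) x) ` {..<c}"
      using orbit_period[OF assms(1,2), of x] by metis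
    have in_g: "(\<pi> ^^ i) x \<in> orbit ?g p" if "i < c" for i
      using that
    proof (induction i)
      case 0
      then show ?case using \<open>x \<in> orbit ?g p\<close> by (simp add: comp_def)
    next
      case (Suc i)
      have "(\<pi> ^^ Suc i) x \<noteq> x" using c Suc.prems by blast
      moreover have "(\<pi> ^^ Suc i) x \<noteq> y"
        using xy disj self c(4) Suc.prems by blast
      ultimately have "?g ((\<pi> ^^ i) x) = (\<pi> ^^ Suc i) x"
        using xy by (auto simp: Transposition.transpose_def)
      then show ?case using Suc stepg[of "(\<pi> ^^ i) x"] by (simp add: comp_def)
    qed
    have "?g ((\<pi> ^^ (c - 1)) x) = y"
    proof -
      have "\<pi> ((\<pi> ^^ (c - 1)) x) = x"
        using c(1,2) by (metis Suc_diff_1 comp_apply funpow.simps(2))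
      then show ?thesis using xy by (auto simp: Transposition.transpose_def)
    qed
    with in_g[of "c - 1"] c(1,4) in_g show ?thesis
      using stepg[of "(\<pi> ^^ (c - 1)) x"] by auto
  qed
  \<comment> \<open>\<open>a\<close> and \<open>p\<close> may lie outside \<open>S\<close>, hence
    the larger carrier.\<close>
  have perm_g: "finite (insert a (insert p S))" "?g permutes insert a (insert p S)"
    using assms by (auto intro!: permutes_compose permutes_swap_id intro: permutes_subset)
  have p: "p \<in> orbit ?g p" by (rule self_in_orbit_permutes[OF perm_g])
  have "orbit \<pi> a \<union> orbit \<pi> p \<subseteq> orbit ?g p"
    using reach[of p a] reach[of a p] p by blast
  moreover have "x \<in> orbit \<pi> a \<union> orbit \<pi> p" if "x \<in> orbit ?g p" for x
    using that
  proof induction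
    case base
    show ?case
      using self[of a] self[of p] orbit.step[of p \<pi> p] by (auto simp: Transposition.transpose_def)
  next
    case (step x)
    then show ?case
      using self[of a] self[of p] orbit.step[of x \<pi>] by (auto simp: Transposition.transpose_def)
  qed
  ultimately show ?thesis by blast
qed

text \<open>With \<open>a = (\<pi> ^^ d) p\<close>, the walk from \<open>p\<close> is sent back to
  \<open>p\<close> when it would reach \<open>a\<close>, and the walk from \<open>a\<close> is sent
  back to \<open>a\<close> when it would reach \<open>p\<close>. The exponents below
  \<open>c\<close> are thereby cut at \<open>d\<close>.\<close>

lemma orbit_transpose_comp_split:
  assumes "finite S" "\<pi> permutes S" "0 < d" "d < card (orbit \<pi> p)"
  defines "g \<equiv> transpose ((\<pi> ^^ d) p) p \<circ> \<pi>" and "c \<equiv> card (orbit \<pi> p)"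
  shows "orbit g p = (\<lambda>i. (\<pi> ^^ i) p) ` {..<d}"
    and "orbit g ((\<pi> ^^ d) p) = (\<lambda>i. (\<pi> ^^ i) p) ` {d..<c}"
proof -
  let ?a = "(\<pi> ^^ d) p"
  have c: "0 < c" "(\<pi> ^^ c) p = p" and inj: "inj_on (\<lambda>i. (\<pi> ^^ i) p) {..<c}"
    using orbit_period[OF assms(1,2), of p] unfolding c_def by metis+
  have dc: "d < c" using assms(4) by (simp add: c_def)
  have ne_p: "(\<pi> ^^ i) p \<noteq> p" if "0 < i" "i < c" for i
    using inj_onD[OF inj, of i 0] that by auto
  have ne_a: "(\<pi> ^^ i) p \<noteq> ?a" if "i < c" "i \<noteq> d" for i
    using inj_onD[OF inj, of i d] that dc by auto
  have g1: "(g ^^ i) p = (\<pi> ^^ i) p" if "i < d" for i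
    using that
  proof (induction i)
    case (Suc i)
    then show ?case
      using ne_p[of "Suc i"] ne_a[of "Suc i"] dc by (simp add: g_def Transposition.transpose_def)
  qed simp
  have "(g ^^ d) p = p"
    using g1[of "d - 1"] assms(3) by (cases d) (simp_all add: g_def Transposition.transpose_def)
  from orbit_eq_segment[OF assms(3) this] show "orbit g p = (\<lambda>i. (\<pi> ^^ i) p) ` {..<d}"
    using g1 by simp
  have g2: "(g ^^ i) ?a = (\<pi> ^^ (d + i)) p" if "i < c - d" for i
    using that
  proof (induction i)
    case (Suc i)
    then show ?case
      using ne_p[of "Suc (d + i)"] ne_a[of "Suc (d + i)"] by (simp add: g_def Transposition.transpose_def)
  qed simp
  have "\<pi> ((\<pi> ^^ (c - 1)) p) = p"
    using c by (metis Suc_diff_1 comp_apply funpow.simps(2))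
  then have "(g ^^ (c - d)) ?a = ?a"
  proof -
    obtain n where n: "c - d = Suc n" "d + n = c - 1" using dc by (cases "c - d") auto
    assume "\<pi> ((\<pi> ^^ (c - 1)) p) = p"
    then show ?thesis using g2[of n] n by (simp add: g_def)
  qed
  with orbit_eq_segment[of "c - d" g ?a] dc
  have "orbit g ?a = (\<lambda>i. (\<pi> ^^ (d + i)) p) ` {..<c - d}"
    using g2 by simp
  also have "\<dots> = (\<lambda>i. (\<pi> ^^ i) p) ` ((+) d ` {..<c - d})"
    by (simp add: image_image)
  also have "(+) d ` {..<c - d} = {d..<c}"
    using dc image_add_atLeastLessThan[of d 0 "c - d"] by (simp add: lessThan_atLeast0 add.commute)
  finally show "orbit g ?a = (\<lambda>i. (\<pi> ^^ i) p) ` {d..<c}" .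
qed

text \<open>The second claim, that the merged set is new, is what allows a product over the cycles
  to be split at the inserted one.\<close>

lemma cycles_transpose_comp_merge:
  assumes "finite S" "\<pi> permutes S" "a \<in> S" "p \<in> S" "orbit \<pi> a \<noteq> orbit \<pi> p"
  shows "cycles S (transpose a p \<circ> \<pi>) =
      insert (orbit \<pi> a \<union> orbit \<pi> p) (cycles S \<pi> - {orbit \<pi> a, orbit \<pi> p})"
    and "orbit \<pi> a \<union> orbit \<pi> p \<notin> cycles S \<pi>"
proof -
  let ?g = "transpose a p \<circ> \<pi>" and ?O = "orbit \<pi> a \<union> orbit \<pi> p"
  have perm_g: "?g permutes S" using assms by (auto intro!: permutes_compose permutes_swap_id)
  have "orbit ?g y = (if y \<in> ?O then ?O else orbit \<pi> y)" for y
    using orbit_transpose_comp_merge[OF assms(1,2,5)] orbit_transpose_comp_other[OF assms(1,2), of y a p]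
      orbit_eq_permutes[OF assms(1) perm_g, of y p] by auto
  moreover have "y \<in> ?O \<longleftrightarrow> orbit \<pi> y \<in> {orbit \<pi> a, orbit \<pi> p}" for y
    unfolding insert_iff empty_iff using orbit_eq_iff_permutes[OF assms(1,2), of _ y] by (metis Un_iff)
  ultimately show "cycles S ?g = insert ?O (cycles S \<pi> - {orbit \<pi> a, orbit \<pi> p})"
    unfolding cycles_def using assms(3) by (auto simp: image_iff)
  show "?O \<notin> cycles S \<pi>"
  proof
    assume "?O \<in> cycles S \<pi>"
    then obtain y where "?O = orbit \<pi> y" by (auto simp: cycles_def)
    then have "orbit \<pi> a = ?O \<and> orbit \<pi> p = ?O"
      by (metis UnI1 UnI2 assms(1,2) orbit_eq_permutes self_in_orbit_permutes)
    with assms(5) show False by metis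
  qed
qed

lemma cycles_transpose_comp_split:
  assumes "finite S" "\<pi> permutes S" "p \<in> S" "0 < d" "d < card (orbit \<pi> p)"
  obtains A B where "card A = d" "card B = card (orbit \<pi> p) - d" "A \<noteq> B"
    "A \<notin> cycles S \<pi>" "B \<notin> cycles S \<pi>"
    "cycles S (transpose ((\<pi> ^^ d) p) p \<circ> \<pi>) = insert A (insert B (cycles S \<pi> - {orbit \<pi> p}))"
proof -
  define a where "a = (\<pi> ^^ d) p"
  define g where "g = transpose a p \<circ> \<pi>"
  define c where "c = card (orbit \<pi> p)"
  define A where "A = (\<lambda>i. (\<pi> ^^ i) p) ` {..<d}"
  define B where "B = (\<lambda>i. (\<pi> ^^ i) p) ` {d..<c}"
  have inj: "inj_on (\<lambda>i. (\<pi> ^^ i) p) {..<c}" and orb: "orbit \<pi> p = (\<lambda>i. (\<pi> ^^ i) p) ` {..<c}"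
    using orbit_period[OF assms(1,2), of p] unfolding c_def by metis+
  have dc: "d < c" using assms by (simp add: c_def)
  have pA: "p \<in> A" unfolding A_def using assms(4) by (auto intro!: image_eqI[of _ _ 0])
  have aB: "a \<in> B" unfolding B_def a_def using dc by auto
  have AB: "A \<inter> B = {}" "A \<union> B = orbit \<pi> p"
  proof -
    show "A \<inter> B = {}"
      unfolding A_def B_def using dc by (auto dest!: inj_onD[OF inj])
    show "A \<union> B = orbit \<pi> p"
      unfolding A_def B_def orb using dc by (subst image_Un[symmetric]) (auto simp: ivl_disj_un)
  qed
  have cards: "card A = d" "card B = c - d"
    unfolding A_def B_def using dc
    by (subst card_image; auto intro: inj_on_subset[OF inj])+
  have aS: "a \<in> S" unfolding a_def using assms(2,3) by (simp add: permutes_in_funpow_image)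
  have perm_g: "g permutes S"
    unfolding g_def using assms aS by (auto intro!: permutes_compose permutes_swap_id)
  have gA: "orbit g p = A" "orbit g a = B"
    using orbit_transpose_comp_split[OF assms(1,2,4,5)] unfolding g_def a_def A_def B_def c_def by auto
  have orb_a: "orbit \<pi> a = orbit \<pi> p"
    using orbit_eq_permutes[OF assms(1,2)] AB aB by blast
  have "orbit g y = (if y \<in> A then A else if y \<in> B then B else orbit \<pi> y)" for y
    using gA orbit_eq_permutes[OF assms(1) perm_g, of y] AB
      orbit_transpose_comp_other[OF assms(1,2), of y a p] orb_a unfolding g_def by auto
  moreover have "y \<in> A \<union> B \<longleftrightarrow> orbit \<pi> y = orbit \<pi> p" for y
    using orbit_eq_iff_permutes[OF assms(1,2), of p y] AB by auto
  ultimately have "cycles S g = insert A (insert B (cycles S \<pi> - {orbit \<pi> p}))"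
  proof -
    assume o: "orbit g y = (if y \<in> A then A else if y \<in> B then B else orbit \<pi> y)"
      and i: "y \<in> A \<union> B \<longleftrightarrow> orbit \<pi> y = orbit \<pi> p" for y
    have "orbit g y \<in> insert A (insert B (cycles S \<pi> - {orbit \<pi> p}))" if "y \<in> S" for y
      using o[of y] i[of y] that by (auto simp: cycles_def)
    moreover have "orbit \<pi> y \<in> cycles S g" if "y \<in> S" "orbit \<pi> y \<noteq> orbit \<pi> p" for y
    proof -
      have "orbit g y = orbit \<pi> y" using o[of y] i[of y] that by auto
      then show ?thesis using that unfolding cycles_def by blast
    qed
    moreover have "A \<in> cycles S g" "B \<in> cycles S g"
      using gA assms(3) aS unfolding cycles_def by blast+
    ultimately show ?thesis unfolding cycles_def by blast
  qed
  moreover have "A \<notin> cycles S \<pi>" "B \<notin> cycles S \<pi>"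
    using cycles_disjoint[OF assms(1,2), of A "orbit \<pi> p"] cycles_disjoint[OF assms(1,2), of B "orbit \<pi> p"]
      pA aB AB assms(3) by (auto simp: cycles_def)
  moreover have "A \<noteq> B" using pA AB by auto
  ultimately show ?thesis
    using that cards unfolding g_def a_def c_def by blast
qed

lemma cycles_insert_fixed:
  assumes "\<pi> permutes S" "x \<notin> S"
  shows "cycles (insert x S) \<pi> = insert {x} (cycles S \<pi>)"
  unfolding cycles_def using assms orbit_eq_singleton_iff[of \<pi> x] by (simp add: permutes_not_in)

text \<open>The point \<open>x\<close> is fixed by \<open>\<pi>\<close>, so the transposition merges
  the singleton \<open>{x}\<close> into the cycle of \<open>p\<close>.\<close>

lemma cycles_transpose_comp_insert:
  assumes "finite S" "\<pi> permutes S" "x \<notin> S" "p \<in> S"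
  shows "cycles (insert x S) (transpose x p \<circ> \<pi>) =
      insert (insert x (orbit \<pi> p)) (cycles S \<pi> - {orbit \<pi> p})"
    and "insert x (orbit \<pi> p) \<notin> cycles S \<pi>" "x \<notin> orbit \<pi> p"
proof -
  have 1: "\<pi> permutes insert x S" using assms(2) by (rule permutes_subset) auto
  have 2: "orbit \<pi> x = {x}" using assms orbit_eq_singleton_iff[of \<pi> x] by (simp add: permutes_not_in)
  have sub: "orbit \<pi> p \<subseteq> S" by (rule orbit_subset_permutes[OF assms(1,2,4)])
  then show x: "x \<notin> orbit \<pi> p" using assms(3) by auto
  then have 3: "orbit \<pi> x \<noteq> orbit \<pi> p" using 2 by auto
  have "{x} \<notin> cycles S \<pi>" using Union_cycles[OF assms(1,2)] assms(3) by blast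
  then show "cycles (insert x S) (transpose x p \<circ> \<pi>) =
      insert (insert x (orbit \<pi> p)) (cycles S \<pi> - {orbit \<pi> p})"
    using cycles_transpose_comp_merge(1)[OF _ 1 _ _ 3] assms cycles_insert_fixed[OF assms(2,3)] 2 by auto
  show "insert x (orbit \<pi> p) \<notin> cycles S \<pi>"
    using Union_cycles[OF assms(1,2)] assms(3) by blast
qed

text \<open>\<open>\<pi> \<circ> \<kappa>\<close> and \<open>\<kappa> \<circ> \<pi>\<close> are
  conjugate by \<open>\<pi>\<close>, which carries orbits to orbits.\<close>

lemma orbit_comp_commute:
  assumes "finite S" "\<pi> permutes S" "\<kappa> permutes S"
  shows "orbit (\<pi> \<circ> \<kappa>) (\<pi> x) = \<pi> ` orbit (\<kappa> \<circ> \<pi>) x"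
proof -
  have "((\<pi> \<circ> \<kappa>) ^^ n) (\<pi> x) = \<pi> (((\<kappa> \<circ> \<pi>) ^^ n) x)" for n
    by (induction n) auto
  then show ?thesis unfolding orbit_altdef by auto
qed

lemma cycles_comp_commute:
  assumes "finite S" "\<pi> permutes S" "\<kappa> permutes S"
  shows "cycles S (\<pi> \<circ> \<kappa>) = (`) \<pi> ` cycles S (\<kappa> \<circ> \<pi>)"
proof -
  have "cycles S (\<pi> \<circ> \<kappa>) = orbit (\<pi> \<circ> \<kappa>) ` (\<pi> ` S)"
    using permutes_image[OF assms(2)] by (simp add: cycles_def)
  then show ?thesis
    unfolding cycles_def image_image using orbit_comp_commute[OF assms] by simp
qed

lemma card_cycles_comp_commute:
  assumes "finite S" "\<pi> permutes S" "\<kappa> permutes S"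
  shows "card (cycles S (\<pi> \<circ> \<kappa>)) = card (cycles S (\<kappa> \<circ> \<pi>))"
  unfolding cycles_comp_commute[OF assms]
  using permutes_inj[OF assms(2)] by (auto intro!: card_image simp: inj_on_def inj_image_eq_iff)

lemma card_cycles_insert_fixed:
  assumes "finite S" "\<pi> permutes S" "x \<notin> S"
  shows "card (cycles (insert x S) \<pi>) = Suc (card (cycles S \<pi>))"
  using Union_cycles[OF assms(1,2)] assms by (subst cycles_insert_fixed) (auto simp: card_insert_if)

lemma card_cycles_transpose_comp_insert:
  assumes "finite S" "\<pi> permutes S" "x \<notin> S" "p \<in> S"
  shows "card (cycles (insert x S) (transpose x p \<circ> \<pi>)) = card (cycles S \<pi>)"
proof -
  have "orbit \<pi> p \<in> cycles S \<pi>" using assms by (simp add: cycles_def)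
  then show ?thesis
    using cycles_transpose_comp_insert[OF assms] assms(1)
    by (simp add: card_insert_if card_Suc_Diff1 del: card_Diff_insert)
qed

section \<open>Multiplication by full cycles\<close>

definition full_cycles :: "'a set \<Rightarrow> ('a \<Rightarrow> 'a) set" where
  "full_cycles S = {\<kappa>. \<kappa> permutes S \<and> card (cycles S \<kappa>) = 1}"

text \<open>Two functions \<open>f\<close> matter: \<open>z^c\<close>, for the generating function
  in \<open>z\<close>, and the indicator of \<open>c = 1\<close>, which counts factorisations into
  full cycles.\<close>

definition full_cycle_sum :: "'a set \<Rightarrow> (nat \<Rightarrow> real) \<Rightarrow> ('a \<Rightarrow> 'a) \<Rightarrow> real" where
  "full_cycle_sum S f \<pi> = (\<Sum>\<kappa>\<in>full_cycles S. f (card (cycles S (\<kappa> \<circ> \<pi>))))"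

lemma finite_full_cycles [simp]: "finite S \<Longrightarrow> finite (full_cycles S)"
  unfolding full_cycles_def by (rule finite_subset[OF _ finite_permutations]) auto

lemma full_cycles_permutes: "\<kappa> \<in> full_cycles S \<Longrightarrow> \<kappa> permutes S"
  by (simp add: full_cycles_def)

lemma card_cycles_pos: "\<lbrakk>finite S; S \<noteq> {}\<rbrakk> \<Longrightarrow> 0 < card (cycles S \<pi>)"
  by (simp add: cycles_def card_gt_0_iff)

text \<open>Every permutation of \<open>insert x S\<close> is uniquely
  \<open>transpose x a \<circ> \<kappa>\<close> with \<open>\<kappa>\<close> permuting
  \<open>S\<close>. For \<open>a = x\<close> the point \<open>x\<close> is a cycle of its own beside
  the cycles of the nonempty \<open>S\<close>; otherwise \<open>x\<close> joins an existing cycle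
  and the number of cycles is that of \<open>\<kappa>\<close>.\<close>

lemma sum_full_cycles_insert:
  assumes "finite S" "x \<notin> S" "S \<noteq> {}"
  shows "sum f (full_cycles (insert x S)) = (\<Sum>a\<in>S. \<Sum>\<kappa>\<in>full_cycles S. f (transpose x a \<circ> \<kappa>))"
proof -
  define h where "h p = (if card (cycles (insert x S) p) = 1 then f p else 0)" for p
  have "sum f (full_cycles (insert x S)) = sum h {p. p permutes insert x S}"
    unfolding full_cycles_def h_def using assms
    by (subst sum.inter_filter[symmetric]) (auto simp: finite_permutations)
  also have "\<dots> = (\<Sum>a\<in>insert x S. \<Sum>q | q permutes S. h (transpose x a \<circ> q))"
    using assms by (intro sum_over_permutations_insert)
  also have "\<dots> = (\<Sum>a\<in>S. \<Sum>q | q permutes S. h (transpose x a \<circ> q))"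
  proof -
    have "h (transpose x x \<circ> q) = 0" if "q permutes S" for q
      using card_cycles_insert_fixed[OF assms(1) that assms(2)] card_cycles_pos[OF assms(1,3), of q]
      by (simp add: h_def)
    then show ?thesis using assms by simp
  qed
  also have "\<dots> = (\<Sum>a\<in>S. \<Sum>q\<in>full_cycles S. f (transpose x a \<circ> q))"
  proof (rule sum.cong[OF refl])
    fix a assume a: "a \<in> S"
    have "h (transpose x a \<circ> q) = (if card (cycles S q) = 1 then f (transpose x a \<circ> q) else 0)"
      if "q permutes S" for q
      using card_cycles_transpose_comp_insert[OF assms(1) that assms(2) a] by (simp add: h_def)
    then have "(\<Sum>q | q permutes S. h (transpose x a \<circ> q)) =
        (\<Sum>q | q permutes S. if card (cycles S q) = 1 then f (transpose x a \<circ> q) else 0)"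
      by (intro sum.cong) auto
    also have "\<dots> = (\<Sum>q\<in>full_cycles S. f (transpose x a \<circ> q))"
      unfolding full_cycles_def using assms(1)
      by (subst sum.inter_filter[symmetric]) (auto simp: finite_permutations)
    finally show "(\<Sum>q | q permutes S. h (transpose x a \<circ> q)) =
        (\<Sum>q\<in>full_cycles S. f (transpose x a \<circ> q))" .
  qed
  finally show ?thesis .
qed

lemma full_cycles_singleton: "full_cycles {x} = {id}"
  by (auto simp: full_cycles_def cycles_def)

lemma conj_full_cycles:
  assumes "finite S" "\<sigma> permutes S" "\<kappa> \<in> full_cycles S"
  shows "\<sigma> \<circ> \<kappa> \<circ> inv_into UNIV \<sigma> \<in> full_cycles S"
proof -
  have \<kappa>: "\<kappa> permutes S" "card (cycles S \<kappa>) = 1" using assms(3) by (auto simp: full_cycles_def)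
  have "card (cycles S ((\<sigma> \<circ> \<kappa>) \<circ> inv_into UNIV \<sigma>)) = card (cycles S (inv_into UNIV \<sigma> \<circ> (\<sigma> \<circ> \<kappa>)))"
    using assms \<kappa> by (intro card_cycles_comp_commute) (auto intro: permutes_compose permutes_inv)
  also have "inv_into UNIV \<sigma> \<circ> (\<sigma> \<circ> \<kappa>) = \<kappa>"
    using permutes_inv_o[OF assms(2)] by (metis comp_assoc id_comp)
  finally have "card (cycles S (\<sigma> \<circ> \<kappa> \<circ> inv_into UNIV \<sigma>)) = 1" unfolding \<kappa>(2) .
  moreover have "\<sigma> \<circ> \<kappa> \<circ> inv_into UNIV \<sigma> permutes S"
    using assms \<kappa> by (intro permutes_compose permutes_inv)
  ultimately show ?thesis unfolding full_cycles_def by blast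
qed

lemma sum_full_cycles_conj:
  assumes "finite S" "\<sigma> permutes S"
  shows "(\<Sum>\<kappa>\<in>full_cycles S. f (\<sigma> \<circ> \<kappa> \<circ> inv_into UNIV \<sigma>)) = sum f (full_cycles S)"
proof (rule sum.reindex_bij_witness[of _ "\<lambda>\<kappa>. inv_into UNIV \<sigma> \<circ> \<kappa> \<circ> \<sigma>" "\<lambda>\<kappa>. \<sigma> \<circ> \<kappa> \<circ> inv_into UNIV \<sigma>"])
  note inv = permutes_inv_o[OF assms(2)]
  fix \<kappa> assume \<kappa>: "\<kappa> \<in> full_cycles S"
  show "inv_into UNIV \<sigma> \<circ> (\<sigma> \<circ> \<kappa> \<circ> inv_into UNIV \<sigma>) \<circ> \<sigma> = \<kappa>" "\<sigma> \<circ> (inv_into UNIV \<sigma> \<circ> \<kappa> \<circ> \<sigma>) \<circ> inv_into UNIV \<sigma> = \<kappa>"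
    using inv by (simp_all add: fun_eq_iff)
  show "\<sigma> \<circ> \<kappa> \<circ> inv_into UNIV \<sigma> \<in> full_cycles S" using conj_full_cycles assms \<kappa> by blast
  show "inv_into UNIV \<sigma> \<circ> \<kappa> \<circ> \<sigma> \<in> full_cycles S"
    using conj_full_cycles[OF assms(1) permutes_inv[OF assms(2)] \<kappa>] permutes_inv_inv[OF assms(2)] by simp
qed auto

text \<open>Conjugation by \<open>\<sigma>\<close> permutes the full cycles, so the sum is a class
  function. The recursion below uses this to bring two transpositions next to each other.\<close>

lemma full_cycle_sum_comp_commute:
  assumes "finite S" "\<sigma> permutes S" "\<pi> permutes S"
  shows "full_cycle_sum S f (\<sigma> \<circ> \<pi>) = full_cycle_sum S f (\<pi> \<circ> \<sigma>)"
proof -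
  have "full_cycle_sum S f (\<pi> \<circ> \<sigma>) =
      (\<Sum>\<kappa>\<in>full_cycles S. f (card (cycles S ((inv_into UNIV \<sigma> \<circ> \<kappa> \<circ> inv_into UNIV (inv_into UNIV \<sigma>)) \<circ> (\<pi> \<circ> \<sigma>)))))"
    unfolding full_cycle_sum_def
    by (rule sum_full_cycles_conj[symmetric]) (use assms permutes_inv in auto)
  also have "\<dots> = (\<Sum>\<kappa>\<in>full_cycles S. f (card (cycles S (\<kappa> \<circ> (\<sigma> \<circ> \<pi>)))))"
  proof (rule sum.cong[OF refl])
    fix \<kappa> assume \<kappa>: "\<kappa> \<in> full_cycles S"
    then have "\<kappa> permutes S" by (rule full_cycles_permutes)
    have "card (cycles S (inv_into UNIV \<sigma> \<circ> (\<kappa> \<circ> \<sigma> \<circ> \<pi> \<circ> \<sigma>))) = card (cycles S ((\<kappa> \<circ> \<sigma> \<circ> \<pi> \<circ> \<sigma>) \<circ> inv_into UNIV \<sigma>))"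
      using assms \<open>\<kappa> permutes S\<close> by (intro card_cycles_comp_commute permutes_compose permutes_inv)
    also have "(\<kappa> \<circ> \<sigma> \<circ> \<pi> \<circ> \<sigma>) \<circ> inv_into UNIV \<sigma> = \<kappa> \<circ> (\<sigma> \<circ> \<pi>)"
      using permutes_inv_o[OF assms(2)] by (simp add: fun_eq_iff)
    finally show "f (card (cycles S ((inv_into UNIV \<sigma> \<circ> \<kappa> \<circ> inv_into UNIV (inv_into UNIV \<sigma>)) \<circ> (\<pi> \<circ> \<sigma>)))) =
        f (card (cycles S (\<kappa> \<circ> (\<sigma> \<circ> \<pi>))))"
      unfolding permutes_inv_inv[OF assms(2)] comp_assoc by (rule arg_cong)
  qed
  finally show ?thesis by (simp add: full_cycle_sum_def)
qed

lemma full_cycle_sum_insert_fixed: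
  assumes "finite S" "x \<notin> S" "S \<noteq> {}" "\<pi> permutes S"
  shows "full_cycle_sum (insert x S) f \<pi> = card S * full_cycle_sum S f \<pi>"
proof -
  have "card (cycles (insert x S) (transpose x a \<circ> \<kappa> \<circ> \<pi>)) = card (cycles S (\<kappa> \<circ> \<pi>))"
    if "a \<in> S" "\<kappa> \<in> full_cycles S" for a \<kappa>
    using card_cycles_transpose_comp_insert[OF assms(1) _ assms(2) that(1), of "\<kappa> \<circ> \<pi>"]
      permutes_compose[OF assms(4) full_cycles_permutes[OF that(2)]] by (simp add: comp_assoc)
  then show ?thesis
    unfolding full_cycle_sum_def sum_full_cycles_insert[OF assms(1-3)] by simp
qed

lemma transpose_comp_transpose:
  assumes "x \<noteq> a" "x \<noteq> p" "a \<noteq> p"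
  shows "transpose x p \<circ> transpose x a = transpose x a \<circ> transpose a p"
  using assms by (auto simp: fun_eq_iff Transposition.transpose_def)

text \<open>A full cycle of the larger set is \<open>transpose x a \<circ> \<kappa>\<close>, and
  cyclic invariance puts \<open>transpose x p \<circ> transpose x a\<close> in front of
  \<open>\<kappa> \<circ> \<pi>\<close>. For \<open>a = p\<close> the two cancel and
  \<open>x\<close> is an additional cycle, whence \<open>Suc c\<close>. For
  \<open>a \<noteq> p\<close> they equal \<open>transpose x a \<circ> transpose a p\<close>, where
  the left factor only inserts \<open>x\<close> into a cycle.\<close>

lemma full_cycle_sum_insert:
  assumes "finite S" "x \<notin> S" "\<pi> permutes S" "p \<in> S"
  shows "full_cycle_sum (insert x S) f (transpose x p \<circ> \<pi>) =
    full_cycle_sum S (\<lambda>c. f (Suc c)) \<pi> + (\<Sum>a\<in>S - {p}. full_cycle_sum S f (transpose a p \<circ> \<pi>))"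
proof -
  let ?T = "insert x S"
  have px: "p \<noteq> x" using assms by auto
  have T: "transpose x p permutes ?T" "\<pi> permutes ?T"
    using assms by (auto intro: permutes_swap_id permutes_subset)
  have "full_cycle_sum ?T f (transpose x p \<circ> \<pi>) = full_cycle_sum ?T f (\<pi> \<circ> transpose x p)"
    using assms(1) T by (intro full_cycle_sum_comp_commute) auto
  also have "\<dots> = (\<Sum>a\<in>S. \<Sum>\<kappa>\<in>full_cycles S.
      f (card (cycles ?T (transpose x a \<circ> \<kappa> \<circ> (\<pi> \<circ> transpose x p)))))"
    unfolding full_cycle_sum_def using assms by (intro sum_full_cycles_insert) auto
  also have "\<dots> = (\<Sum>a\<in>S. if a = p then full_cycle_sum S (\<lambda>c. f (Suc c)) \<pi> else full_cycle_sum S f (transpose a p \<circ> \<pi>))"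
  proof (rule sum.cong[OF refl])
    fix a assume a: "a \<in> S"
    have \<kappa>T: "card (cycles ?T (transpose x a \<circ> \<kappa> \<circ> (\<pi> \<circ> transpose x p))) =
        card (cycles ?T ((transpose x p \<circ> transpose x a) \<circ> (\<kappa> \<circ> \<pi>)))" if "\<kappa> \<in> full_cycles S" for \<kappa>
    proof -
      have "\<kappa> permutes ?T" using full_cycles_permutes[OF that] by (rule permutes_subset) auto
      then show ?thesis
        using card_cycles_comp_commute[of ?T "transpose x a \<circ> \<kappa> \<circ> \<pi>" "transpose x p"] assms(1) T a
        by (simp add: comp_assoc permutes_compose permutes_swap_id)
    qed
    show "(\<Sum>\<kappa>\<in>full_cycles S. f (card (cycles ?T (transpose x a \<circ> \<kappa> \<circ> (\<pi> \<circ> transpose x p))))) =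
        (if a = p then full_cycle_sum S (\<lambda>c. f (Suc c)) \<pi> else full_cycle_sum S f (transpose a p \<circ> \<pi>))"
    proof (cases "a = p")
      case True
      have "card (cycles ?T (transpose x a \<circ> \<kappa> \<circ> (\<pi> \<circ> transpose x p))) = Suc (card (cycles S (\<kappa> \<circ> \<pi>)))"
        if "\<kappa> \<in> full_cycles S" for \<kappa>
        unfolding \<kappa>T[OF that] using True card_cycles_insert_fixed[OF assms(1) _ assms(2), of "\<kappa> \<circ> \<pi>"]
          permutes_compose[OF assms(3) full_cycles_permutes[OF that]] by simp
      then show ?thesis using True by (simp add: full_cycle_sum_def)
    next
      case False
      have xa: "x \<noteq> a" using a assms by auto
      have tr: "transpose a p permutes S" using a assms by (intro permutes_swap_id)
      have "card (cycles ?T (transpose x a \<circ> \<kappa> \<circ> (\<pi> \<circ> transpose x p))) =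
          card (cycles S (\<kappa> \<circ> (\<pi> \<circ> transpose a p)))"
        if "\<kappa> \<in> full_cycles S" for \<kappa>
      proof -
        have perm: "\<kappa> \<circ> \<pi> permutes S" "transpose a p \<circ> (\<kappa> \<circ> \<pi>) permutes S"
          using permutes_compose assms(3) full_cycles_permutes[OF that] tr by blast+
        have "card (cycles ?T (transpose x a \<circ> \<kappa> \<circ> (\<pi> \<circ> transpose x p))) =
            card (cycles ?T (transpose x a \<circ> (transpose a p \<circ> (\<kappa> \<circ> \<pi>))))"
          unfolding \<kappa>T[OF that] transpose_comp_transpose[OF xa px[symmetric] False] by (simp add: comp_assoc)
        also have "\<dots> = card (cycles S (transpose a p \<circ> (\<kappa> \<circ> \<pi>)))"
          using card_cycles_transpose_comp_insert[OF assms(1) perm(2) assms(2) a] .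
        also have "\<dots> = card (cycles S ((\<kappa> \<circ> \<pi>) \<circ> transpose a p))"
          by (rule card_cycles_comp_commute[OF assms(1) tr perm(1)])
        finally show ?thesis by (simp add: comp_assoc)
      qed
      then have "(\<Sum>\<kappa>\<in>full_cycles S. f (card (cycles ?T (transpose x a \<circ> \<kappa> \<circ> (\<pi> \<circ> transpose x p))))) =
          full_cycle_sum S f (\<pi> \<circ> transpose a p)"
        by (simp add: full_cycle_sum_def)
      then show ?thesis
        using False full_cycle_sum_comp_commute[OF assms(1) tr assms(3)] by simp
    qed
  qed
  also have "\<dots> = full_cycle_sum S (\<lambda>c. f (Suc c)) \<pi> + (\<Sum>a\<in>S - {p}. full_cycle_sum S f (transpose a p \<circ> \<pi>))"
    using assms by (subst sum.remove[of _ p]) auto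
  finally show ?thesis .
qed

text \<open>For powers the additional cycle is a factor \<open>z\<close>. On the series whose
  coefficients are the sums at \<open>z = m\<close> this factor becomes the operator
  \<open>X d/dX\<close>.\<close>

lemma full_cycle_power_sum_insert:
  assumes "finite S" "x \<notin> S" "\<pi> permutes S" "p \<in> S"
  shows "full_cycle_sum (insert x S) ((^) z) (transpose x p \<circ> \<pi>) =
    z * full_cycle_sum S ((^) z) \<pi> + (\<Sum>a\<in>S - {p}. full_cycle_sum S ((^) z) (transpose a p \<circ> \<pi>))"
  unfolding full_cycle_sum_insert[OF assms] by (simp add: full_cycle_sum_def sum_distrib_left)

lemma sum_card_orbit:
  fixes g :: "nat \<Rightarrow> 'b::semiring_1"
  assumes "finite S" "\<pi> permutes S"
  shows "(\<Sum>a\<in>S. g (card (orbit \<pi> a))) = (\<Sum>C\<in>cycles S \<pi>. of_nat (card C) * g (card C))"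
proof -
  have "(\<Sum>a\<in>S. g (card (orbit \<pi> a))) =
      (\<Sum>C\<in>cycles S \<pi>. \<Sum>a | a \<in> S \<and> orbit \<pi> a = C. g (card (orbit \<pi> a)))"
    unfolding cycles_def by (rule sum.image_gen[OF assms(1)])
  also have "\<dots> = (\<Sum>C\<in>cycles S \<pi>. of_nat (card C) * g (card C))"
  proof (rule sum.cong[OF refl])
    fix C assume C: "C \<in> cycles S \<pi>"
    then have "{a \<in> S. orbit \<pi> a = C} = C"
      using orbit_eq_permutes[OF assms] self_in_orbit_permutes[OF assms] Union_cycles[OF assms]
      unfolding cycles_def by blast
    then have "(\<Sum>a | a \<in> S \<and> orbit \<pi> a = C. g (card (orbit \<pi> a))) = (\<Sum>a\<in>{a \<in> S. orbit \<pi> a = C}. g (card C))"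
      by (intro sum.cong) auto
    with \<open>{a \<in> S. orbit \<pi> a = C} = C\<close>
    show "(\<Sum>a | a \<in> S \<and> orbit \<pi> a = C. g (card (orbit \<pi> a))) = of_nat (card C) * g (card C)" by simp
  qed
  finally show ?thesis .
qed

section \<open>Power series of cycle weights and the generating function over full cycles\<close>

definition cycle_fps :: "nat \<Rightarrow> real fps" where
  "cycle_fps c = 1 - fps_X ^ c"

lemma cycle_fps_inverse: "0 < c \<Longrightarrow> inverse (cycle_fps c) * cycle_fps c = 1"
  by (intro inverse_mult_eq_1) (simp add: cycle_fps_def fps_X_power_nth)

lemma cycle_weight_remove:
  assumes "finite S" "C \<in> cycles S \<pi>"
  shows "cycle_weight S w \<pi> = w (card C) * (\<Prod>D\<in>cycles S \<pi> - {C}. w (card D))"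
  unfolding cycle_weight_def using assms by (intro prod.remove) auto

text \<open>Stated without division because \<open>w\<close> takes values in a commutative monoid;
  reciprocals enter only when \<open>w\<close> is \<open>cycle_fps\<close>.\<close>

lemma cycle_weight_merge:
  assumes "finite S" "\<pi> permutes S" "a \<in> S" "p \<in> S" "orbit \<pi> a \<noteq> orbit \<pi> p"
  shows "cycle_weight S w (transpose a p \<circ> \<pi>) * (w (card (orbit \<pi> a)) * w (card (orbit \<pi> p))) =
    cycle_weight S w \<pi> * w (card (orbit \<pi> a) + card (orbit \<pi> p))"
proof -
  let ?A = "orbit \<pi> a" and ?P = "orbit \<pi> p"
  let ?R = "\<Prod>D\<in>cycles S \<pi> - {?A, ?P}. w (card D)"
  note m = cycles_transpose_comp_merge[OF assms]
  have in_c: "?A \<in> cycles S \<pi>" "?P \<in> cycles S \<pi>" using assms by (auto simp: cycles_def)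
  have "card (?A \<union> ?P) = card ?A + card ?P"
    using orbit_disjoint_permutes[OF assms(1,2,5)] finite_orbit_permutes[OF assms(1,2)]
    by (intro card_Un_disjoint) auto
  then have "cycle_weight S w (transpose a p \<circ> \<pi>) = w (card ?A + card ?P) * ?R"
    unfolding cycle_weight_def m(1) using m(2) assms(1) by (subst prod.insert) auto
  moreover have "cycle_weight S w \<pi> = w (card ?A) * (w (card ?P) * ?R)"
  proof -
    have "(\<Prod>D\<in>cycles S \<pi> - {?A}. w (card D)) = w (card ?P) * (\<Prod>D\<in>cycles S \<pi> - {?A} - {?P}. w (card D))"
      using assms in_c by (intro prod.remove) auto
    also have "cycles S \<pi> - {?A} - {?P} = cycles S \<pi> - {?A, ?P}" by auto
    finally show ?thesis unfolding cycle_weight_remove[OF assms(1) in_c(1)] by simp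
  qed
  ultimately show ?thesis by (simp add: ac_simps)
qed

lemma cycle_weight_split:
  assumes "finite S" "\<pi> permutes S" "p \<in> S" "0 < d" "d < card (orbit \<pi> p)"
  shows "cycle_weight S w (transpose ((\<pi> ^^ d) p) p \<circ> \<pi>) * w (card (orbit \<pi> p)) =
    cycle_weight S w \<pi> * (w d * w (card (orbit \<pi> p) - d))"
proof -
  obtain A B where AB: "card A = d" "card B = card (orbit \<pi> p) - d" "A \<noteq> B"
    "A \<notin> cycles S \<pi>" "B \<notin> cycles S \<pi>"
    "cycles S (transpose ((\<pi> ^^ d) p) p \<circ> \<pi>) = insert A (insert B (cycles S \<pi> - {orbit \<pi> p}))"
    using cycles_transpose_comp_split[OF assms] by metis
  have in_c: "orbit \<pi> p \<in> cycles S \<pi>" using assms by (auto simp: cycles_def)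
  have "cycle_weight S w (transpose ((\<pi> ^^ d) p) p \<circ> \<pi>) =
      w d * (w (card (orbit \<pi> p) - d) * (\<Prod>D\<in>cycles S \<pi> - {orbit \<pi> p}. w (card D)))"
    unfolding cycle_weight_def AB(6) using AB(1-5) assms(1) by simp
  then show ?thesis
    unfolding cycle_weight_remove[OF assms(1) in_c] by (simp add: ac_simps)
qed

lemma cycle_weight_insert_fixed:
  assumes "finite S" "\<pi> permutes S" "x \<notin> S"
  shows "cycle_weight (insert x S) w \<pi> = w 1 * cycle_weight S w \<pi>"
proof -
  have "{x} \<notin> cycles S \<pi>" using Union_cycles[OF assms(1,2)] assms(3) by blast
  then show ?thesis
    unfolding cycle_weight_def cycles_insert_fixed[OF assms(2,3)] using assms(1) by simp
qed

lemma cycle_weight_insert: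
  assumes "finite S" "\<pi> permutes S" "x \<notin> S" "p \<in> S"
  shows "cycle_weight (insert x S) w (transpose x p \<circ> \<pi>) =
    w (Suc (card (orbit \<pi> p))) * (\<Prod>D\<in>cycles S \<pi> - {orbit \<pi> p}. w (card D))"
proof -
  note i = cycles_transpose_comp_insert[OF assms]
  have "card (insert x (orbit \<pi> p)) = Suc (card (orbit \<pi> p))"
    using i(3) finite_orbit_permutes[OF assms(1,2)] by simp
  then show ?thesis
    unfolding cycle_weight_def i(1) using i(2) assms(1) by simp
qed

lemma card_orbit_pos:
  assumes "finite S" "\<pi> permutes S"
  shows "0 < card (orbit \<pi> a)"
  using finite_orbit_permutes[OF assms] self_in_orbit_permutes[OF assms] by (auto simp: card_gt_0_iff)

lemma card_cycle_pos: "\<lbrakk>finite S; \<pi> permutes S; C \<in> cycles S \<pi>\<rbrakk> \<Longrightarrow> 0 < card C"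
  unfolding cycles_def using card_orbit_pos by (elim imageE) simp

lemma fps_XD_cycle_fps:
  assumes "0 < c"
  shows "fps_X * fps_deriv (cycle_fps c) = cycle_fps c * (of_nat c * (1 - inverse (cycle_fps c)))"
proof -
  have "cycle_fps c * (of_nat c * (1 - inverse (cycle_fps c))) =
      of_nat c * (cycle_fps c - inverse (cycle_fps c) * cycle_fps c)"
    by (simp add: algebra_simps)
  also have "\<dots> = - (of_nat c * fps_X ^ c)"
    unfolding cycle_fps_inverse[OF assms] by (simp add: cycle_fps_def)
  also have "\<dots> = fps_X * fps_deriv (cycle_fps c)"
  proof -
    have "fps_deriv (fps_X ^ c) = (of_nat c * fps_X ^ (c - 1) :: real fps)"
      unfolding fps_deriv_power by (simp add: fps_of_nat)
    then show ?thesis using assms by (cases c) (simp_all add: cycle_fps_def algebra_simps)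
  qed
  finally show ?thesis by simp
qed

text \<open>The logarithmic derivative of the product. Each cycle contributes its length times a
  term depending on the length, which is a sum over its points and can be compared with a sum over
  transpositions.\<close>

lemma fps_XD_prod_cycle_fps:
  assumes "finite A" "\<And>C. C \<in> A \<Longrightarrow> 0 < card C"
  shows "fps_X * fps_deriv (\<Prod>C\<in>A. cycle_fps (card C)) =
    (\<Prod>C\<in>A. cycle_fps (card C)) * (\<Sum>C\<in>A. of_nat (card C) * (1 - inverse (cycle_fps (card C))))"
  using assms
proof (induction A rule: finite_induct)
  case (insert C A)
  let ?P = "\<Prod>C\<in>A. cycle_fps (card C)" and ?w = "cycle_fps (card C)"
  have "fps_X * fps_deriv (?w * ?P) = (fps_X * fps_deriv ?w) * ?P + ?w * (fps_X * fps_deriv ?P)"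
    by (simp add: algebra_simps)
  also have "\<dots> = (?w * ?P) * (of_nat (card C) * (1 - inverse ?w)
      + (\<Sum>C\<in>A. of_nat (card C) * (1 - inverse (cycle_fps (card C)))))"
  proof -
    have "0 < card C" using insert.prems by blast
    then show ?thesis
      unfolding fps_XD_cycle_fps[OF \<open>0 < card C\<close>] using insert.IH insert.prems
      by (simp add: distrib_left mult.assoc mult.left_commute)
  qed
  finally show ?case using insert by simp
qed simp

text \<open>The sum over the ways to cut a cycle of length \<open>c\<close> into two. The factor
  \<open>1 - X\<close> turns the geometric sum into two monomials.\<close>

lemma sum_cycle_fps_convolution:
  assumes "0 < c"
  shows "(\<Sum>d=1..<c. cycle_fps d * cycle_fps (c - d)) * (1 - fps_X) =
    of_nat (c - 1) * (1 + fps_X ^ c) * (1 - fps_X) - 2 * (fps_X - fps_X ^ c)"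
proof -
  have geo: "(\<Sum>d=1..<c. fps_X ^ d) * (1 - fps_X) = (fps_X - fps_X ^ c :: real fps)"
    using assms
  proof (induction c rule: nat_induct_non_zero)
    case (Suc n)
    have "(\<Sum>d=1..<Suc n. fps_X ^ d) * (1 - fps_X) =
        (\<Sum>d=1..<n. fps_X ^ d) * (1 - fps_X) + fps_X ^ n * (1 - fps_X :: real fps)"
      using Suc.hyps by (simp add: distrib_right)
    then show ?case unfolding Suc.IH by (simp add: algebra_simps)
  qed simp
  have refl: "(\<Sum>d=1..<c. fps_X ^ (c - d)) = (\<Sum>d=1..<c. fps_X ^ d :: real fps)"
    by (rule sum.reindex_bij_witness[of _ "\<lambda>d. c - d" "\<lambda>d. c - d"]) auto
  have "(\<Sum>d=1..<c. cycle_fps d * cycle_fps (c - d)) =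
      (\<Sum>d=1..<c. (1 + fps_X ^ c) - fps_X ^ d - fps_X ^ (c - d))"
    by (intro sum.cong) (auto simp: cycle_fps_def algebra_simps simp flip: power_add)
  also have "\<dots> = of_nat (c - 1) * (1 + fps_X ^ c) - 2 * (\<Sum>d=1..<c. fps_X ^ d)"
    unfolding sum_subtractf refl by (simp add: algebra_simps)
  finally show ?thesis
    using geo by (simp add: left_diff_distrib mult.assoc)
qed

text \<open>Merging with the cycle of a point \<open>a\<close> outside the orbit of \<open>p\<close>
  contributes the reciprocals of the weights of both cycles minus 1, while the logarithmic
  derivative contributes minus the reciprocal at every point. The reciprocals of the other cycles
  cancel, so these cycles survive only in the factor \<open>W\<close>.\<close>

lemma sum_cycle_weight_transpose:
  fixes S :: "'a set"
  assumes "finite S" "\<pi> permutes S" "p \<in> S"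
  defines "c \<equiv> card (orbit \<pi> p)" and "W \<equiv> cycle_weight S cycle_fps \<pi>"
  shows "(fps_X * fps_deriv W + (\<Sum>a\<in>S - {p}. cycle_weight S cycle_fps (transpose a p \<circ> \<pi>))) * (1 - fps_X) =
    W * inverse (cycle_fps c) * ((of_nat (card S) - 1 - fps_X ^ c) * (1 - fps_X) - 2 * (fps_X - fps_X ^ c))"
proof -
  define iv where "iv n = inverse (cycle_fps n)" for n
  have iv: "iv n * cycle_fps n = 1" if "0 < n" for n
    unfolding iv_def by (rule cycle_fps_inverse[OF that])
  let ?C = "orbit \<pi> p" and ?ca = "\<lambda>a. card (orbit \<pi> a)"
  let ?T = "\<lambda>a. cycle_weight S cycle_fps (transpose a p \<circ> \<pi>)"
  note pos = card_orbit_pos[OF assms(1,2)]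
  have c0: "0 < c" unfolding c_def by (rule pos)
  have CS: "?C \<subseteq> S" using orbit_subset_permutes[OF assms(1-3)] .
  have pC: "p \<in> ?C" using self_in_orbit_permutes[OF assms(1,2)] .
  \<comment> \<open>From \<open>1 - uv = (1 - u) + (1 - v) - (1 - u)(1 - v)\<close> with
    \<open>u\<close> and \<open>v\<close> the powers of X for the two cycles; dividing by
    \<open>(1 - u)(1 - v)\<close> gives a sum of reciprocals.\<close>
  have merge: "?T a = W * (iv (?ca a) + iv c - 1)" if "a \<in> S - ?C" for a
  proof -
    have ne: "orbit \<pi> a \<noteq> orbit \<pi> p"
      using that self_in_orbit_permutes[OF assms(1,2), of a] by auto
    have eq: "?T a * (cycle_fps (?ca a) * cycle_fps c) = W * cycle_fps (?ca a + c)"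
      unfolding W_def c_def using that by (intro cycle_weight_merge assms ne) auto
    have "cycle_fps (?ca a + c) = cycle_fps (?ca a) + cycle_fps c - cycle_fps (?ca a) * cycle_fps c"
      by (simp add: cycle_fps_def algebra_simps power_add)
    then have "?T a * (iv (?ca a) * cycle_fps (?ca a)) * (iv c * cycle_fps c) =
        W * ((iv (?ca a) * cycle_fps (?ca a)) * iv c + (iv c * cycle_fps c) * iv (?ca a)
          - (iv (?ca a) * cycle_fps (?ca a)) * (iv c * cycle_fps c))"
    proof -
      have "?T a * (iv (?ca a) * cycle_fps (?ca a)) * (iv c * cycle_fps c) =
          iv (?ca a) * iv c * (?T a * (cycle_fps (?ca a) * cycle_fps c))"
        by (simp only: ac_simps)
      then show ?thesis
        unfolding eq \<open>cycle_fps (?ca a + c) = _\<close> by (simp add: algebra_simps)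
    qed
    then show ?thesis unfolding iv[OF pos] iv[OF c0] by (simp add: algebra_simps)
  qed
  \<comment> \<open>The points of the orbit other than \<open>p\<close> are
    \<open>(\<pi> ^^ d) p\<close> with \<open>1 \<le> d < c\<close>, one for each place to
    cut.\<close>
  have split: "(\<Sum>a\<in>?C - {p}. ?T a) = W * iv c * (\<Sum>d=1..<c. cycle_fps d * cycle_fps (c - d))"
  proof -
    have inj: "inj_on (\<lambda>i. (\<pi> ^^ i) p) {..<c}" and orb: "?C = (\<lambda>i. (\<pi> ^^ i) p) ` {..<c}"
      using orbit_period[OF assms(1,2), of p] unfolding c_def by metis+
    have "{..<c} = insert 0 {1..<c}" using c0 by auto
    then have "?C = insert p ((\<lambda>i. (\<pi> ^^ i) p) ` {1..<c})"
      unfolding orb by (simp only: image_insert funpow_0)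
    moreover have "p \<notin> (\<lambda>i. (\<pi> ^^ i) p) ` {1..<c}"
    proof
      assume "p \<in> (\<lambda>i. (\<pi> ^^ i) p) ` {1..<c}"
      then obtain i where "p = (\<pi> ^^ i) p" "1 \<le> i" "i < c" by auto
      with inj_onD[OF inj, of i 0] show False by auto
    qed
    ultimately have Cp: "?C - {p} = (\<lambda>i. (\<pi> ^^ i) p) ` {1..<c}" by blast
    have "inj_on (\<lambda>i. (\<pi> ^^ i) p) {1..<c}" by (rule inj_on_subset[OF inj]) auto
    then have "(\<Sum>a\<in>?C - {p}. ?T a) = (\<Sum>d=1..<c. ?T ((\<pi> ^^ d) p))"
      unfolding Cp by (subst sum.reindex) (simp_all only: comp_def)
    also have "\<dots> = (\<Sum>d=1..<c. W * iv c * (cycle_fps d * cycle_fps (c - d)))"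
    proof (rule sum.cong[OF refl])
      fix d assume d: "d \<in> {1..<c}"
      have "?T ((\<pi> ^^ d) p) * cycle_fps c = W * (cycle_fps d * cycle_fps (c - d))"
        using d unfolding W_def c_def by (intro cycle_weight_split assms) auto
      moreover have "?T ((\<pi> ^^ d) p) * (iv c * cycle_fps c) = iv c * (?T ((\<pi> ^^ d) p) * cycle_fps c)"
        by (simp only: ac_simps)
      ultimately have "?T ((\<pi> ^^ d) p) * (iv c * cycle_fps c) = W * iv c * (cycle_fps d * cycle_fps (c - d))"
        by (simp only: ac_simps)
      then show "?T ((\<pi> ^^ d) p) = W * iv c * (cycle_fps d * cycle_fps (c - d))"
        unfolding iv[OF c0] by simp
    qed
    finally show ?thesis by (simp add: sum_distrib_left)
  qed
  have deriv: "fps_X * fps_deriv W = W * (of_nat (card S) - (\<Sum>a\<in>S. iv (?ca a)))"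
  proof -
    have "fps_X * fps_deriv W = W * (\<Sum>C\<in>cycles S \<pi>. of_nat (card C) * (1 - iv (card C)))"
      unfolding W_def cycle_weight_def iv_def
      using assms card_cycle_pos[OF assms(1,2)] by (intro fps_XD_prod_cycle_fps) auto
    also have "(\<Sum>C\<in>cycles S \<pi>. of_nat (card C) * (1 - iv (card C))) = (\<Sum>a\<in>S. 1 - iv (?ca a))"
      by (rule sum_card_orbit[OF assms(1,2), symmetric])
    finally show ?thesis by (simp add: sum_subtractf)
  qed
  have same: "iv (?ca a) = iv c" if "a \<in> ?C" for a
    unfolding c_def using orbit_eq_permutes[OF assms(1,2) that] by simp
  have "(\<Sum>a\<in>S. iv (?ca a)) = (\<Sum>a\<in>S - ?C. iv (?ca a)) + (\<Sum>a\<in>?C. iv (?ca a))"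
    using assms(1) CS by (rule sum.subset_diff[rotated])
  also have "(\<Sum>a\<in>?C. iv (?ca a)) = of_nat c * iv c"
    unfolding c_def[symmetric] using same by (simp add: c_def)
  finally have sumS: "(\<Sum>a\<in>S. iv (?ca a)) = (\<Sum>a\<in>S - ?C. iv (?ca a)) + of_nat c * iv c" .
  have "c \<le> card S" unfolding c_def using assms(1) CS by (rule card_mono)
  then have cardD: "of_nat (card (S - ?C)) = (of_nat (card S) - of_nat c :: real fps)"
    using card_Diff_subset[OF finite_orbit_permutes[OF assms(1,2)] CS] by (simp add: c_def of_nat_diff)
  have "S - {p} = (S - ?C) \<union> (?C - {p})" using CS pC by auto
  then have "(\<Sum>a\<in>S - {p}. ?T a) = (\<Sum>a\<in>S - ?C. ?T a) + (\<Sum>a\<in>?C - {p}. ?T a)"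
    using assms(1) CS by (simp add: sum.union_disjoint finite_subset[OF CS] Int_def)
  also have "(\<Sum>a\<in>S - ?C. ?T a) = W * ((\<Sum>a\<in>S - ?C. iv (?ca a)) + (of_nat (card S) - of_nat c) * (iv c - 1))"
  proof -
    have "(\<Sum>a\<in>S - ?C. ?T a) = (\<Sum>a\<in>S - ?C. W * (iv (?ca a) + iv c - 1))"
      using merge by (intro sum.cong) auto
    also have "\<dots> = W * ((\<Sum>a\<in>S - ?C. iv (?ca a)) + of_nat (card (S - ?C)) * (iv c - 1))"
      unfolding sum_distrib_left[symmetric] sum.distrib sum_subtractf by (simp add: algebra_simps)
    finally show ?thesis unfolding cardD .
  qed
  finally have sumT: "(\<Sum>a\<in>S - {p}. ?T a) = W * ((\<Sum>a\<in>S - ?C. iv (?ca a))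
      + (of_nat (card S) - of_nat c) * (iv c - 1)) + (\<Sum>a\<in>?C - {p}. ?T a)" .
  have total: "fps_X * fps_deriv W + (\<Sum>a\<in>S - {p}. ?T a) =
      W * (of_nat c + (of_nat (card S) - 2 * of_nat c) * iv c) + W * iv c * (\<Sum>d=1..<c. cycle_fps d * cycle_fps (c - d))"
    unfolding deriv sumT split sumS by (simp add: algebra_simps)
  \<comment> \<open>Brings the summand without a reciprocal over the common factor
    \<open>W * iv c\<close>.\<close>
  have c_iv: "W * of_nat c = W * iv c * (of_nat c * (1 - fps_X ^ c))"
    using iv[OF c0] by (simp add: cycle_fps_def mult.assoc mult.left_commute[of _ "of_nat c"])
  have c1: "of_nat (c - 1) = (of_nat c - 1 :: real fps)" using c0 by (simp add: of_nat_diff)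
  have "(fps_X * fps_deriv W + (\<Sum>a\<in>S - {p}. ?T a)) * (1 - fps_X) =
      W * iv c * ((of_nat c * (1 - fps_X ^ c) + of_nat (card S) - 2 * of_nat c) * (1 - fps_X)
        + (\<Sum>d=1..<c. cycle_fps d * cycle_fps (c - d)) * (1 - fps_X))"
    unfolding total distrib_left[of W] c_iv by (simp add: algebra_simps)
  also have "\<dots> = W * iv c * ((of_nat (card S) - 1 - fps_X ^ c) * (1 - fps_X) - 2 * (fps_X - fps_X ^ c))"
    unfolding sum_cycle_fps_convolution[OF c0] c1 by (simp add: algebra_simps)
  finally show ?thesis unfolding iv_def .
qed

lemma fps_deriv_one_minus_X_power:
  "fps_deriv ((1 - fps_X) ^ Suc k :: real fps) = - (of_nat (Suc k) * (1 - fps_X) ^ k)"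
  unfolding fps_deriv_power fps_of_nat by (simp del: of_nat_Suc power_Suc)

text \<open>Induction on the carrier. A fixed point multiplies the sum by \<open>card S\<close>,
  while the weight gains a factor \<open>1 - X\<close> and the exponent grows by 1. Otherwise
  \<open>x\<close> is taken out of its cycle, and the recursion combines the induction hypotheses
  for \<open>\<rho>\<close> and for all \<open>transpose a p \<circ> \<rho>\<close> into a
  differential identity.\<close>

lemma full_cycle_sum_fps:
  assumes "finite S" "S \<noteq> {}" "\<pi> permutes S"
  shows "Abs_fps (\<lambda>m. full_cycle_sum S ((^) (real m)) \<pi>) * (1 - fps_X) ^ (card S + 2) =
    fact (card S - 1) * fps_X * cycle_weight S cycle_fps \<pi>"
  using assms
proof (induction S arbitrary: \<pi> rule: finite_ne_induct)
  case (singleton x)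
  have "full_cycle_sum {x} ((^) z) \<pi> = z" for z
    using singleton by (simp add: full_cycle_sum_def full_cycles_singleton cycles_def)
  moreover have "cycle_weight {x} cycle_fps \<pi> = 1 - fps_X"
    using singleton orbit_eq_singleton_iff[of \<pi> x]
    by (simp add: cycle_weight_def cycles_def cycle_fps_def)
  \<comment> \<open>For one point the series is the sum of \<open>m X^m\<close>, namely
    \<open>X / (1 - X)^2\<close>. The third factor in \<open>(1 - X)^(card S + 2)\<close> is the
    weight of the single cycle.\<close>
  moreover have "Abs_fps real * (1 - fps_X) ^ 2 = fps_X"
  proof -
    have "(Abs_fps real * (1 - fps_X)) $ n = (if n = 0 then 0 else 1)" for n
      by (cases n) (simp_all add: right_diff_distrib)
    then have "(Abs_fps real * (1 - fps_X) * (1 - fps_X)) $ n = fps_X $ n" for n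
      unfolding right_diff_distrib[of _ 1 fps_X] by (cases n) (simp_all add: fps_X_nth)
    then show ?thesis by (simp add: fps_eq_iff power2_eq_square mult.assoc[symmetric])
  qed
  ultimately show ?case by (simp add: eval_nat_numeral mult.assoc[symmetric])
next
  case (insert x S)
  let ?F = "\<lambda>S \<pi>. Abs_fps (\<lambda>m. full_cycle_sum S ((^) (real m)) \<pi>)"
  let ?y = "1 - fps_X :: real fps" and ?n = "card S"
  have n0: "0 < ?n" using insert by (simp add: card_gt_0_iff)
  have fact_n: "fact ?n = (of_nat ?n * fact (?n - 1) :: real fps)"
    using n0 by (simp add: fact_reduce)
  have card': "card (insert x S) = Suc ?n" using insert by simp
  show ?case
  proof (cases "\<pi> x = x")
    case True
    then have p: "\<pi> permutes S"
      using insert.prems by (auto simp: permutes_def) 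
    have "?F (insert x S) \<pi> = of_nat ?n * ?F S \<pi>"
      using full_cycle_sum_insert_fixed[OF insert(1,3,2) p]
      by (intro fps_ext) (simp add: fps_of_nat[symmetric] del: fps_of_nat)
    then have "?F (insert x S) \<pi> * ?y ^ (card (insert x S) + 2) = of_nat ?n * (?F S \<pi> * ?y ^ (?n + 2)) * ?y"
      unfolding card' by (simp only: add_Suc power_Suc2 mult.assoc)
    also have "\<dots> = fact ?n * fps_X * (?y * cycle_weight S cycle_fps \<pi>)"
      unfolding insert.IH[OF p] fact_n by (simp only: ac_simps)
    also have "?y * cycle_weight S cycle_fps \<pi> = cycle_weight (insert x S) cycle_fps \<pi>"
      using cycle_weight_insert_fixed[OF insert(1) p insert(3), of cycle_fps] by (simp add: cycle_fps_def)
    finally show ?thesis unfolding card' by simp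
  next
    case False
    define p where "p = \<pi> x"
    define \<rho> where "\<rho> = transpose x p \<circ> \<pi>"
    have \<rho>: "\<rho> permutes S"
      unfolding \<rho>_def p_def using permutes_insert_lemma[OF insert.prems] .
    have pS: "p \<in> S" using False insert.prems permutes_in_image[OF insert.prems, of x] by (auto simp: p_def)
    have \<pi>: "\<pi> = transpose x p \<circ> \<rho>" unfolding \<rho>_def by (simp add: fun_eq_iff)
    define c where "c = card (orbit \<rho> p)"
    let ?W = "cycle_weight S cycle_fps"
    have c0: "0 < c" unfolding c_def by (rule card_orbit_pos[OF insert(1) \<rho>])
    have trp: "transpose a p \<circ> \<rho> permutes S" if "a \<in> S" for a
      using that pS \<rho> by (intro permutes_compose permutes_swap_id)
    have step: "?F (insert x S) \<pi> = fps_X * fps_deriv (?F S \<rho>) + (\<Sum>a\<in>S - {p}. ?F S (transpose a p \<circ> \<rho>))"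
      unfolding \<pi> by (rule fps_ext) (auto simp: full_cycle_power_sum_insert[OF insert(1,3) \<rho> pS] fps_sum_nth)
    have IH: "?F S \<sigma> * ?y ^ (?n + 2) = fact (?n - 1) * fps_X * ?W \<sigma>" if "\<sigma> permutes S" for \<sigma>
      using insert.IH[OF that] .
    have "fps_deriv (?F S \<rho> * ?y ^ (?n + 2)) = fact (?n - 1) * (?W \<rho> + fps_X * fps_deriv (?W \<rho>))"
    proof -
      have "fps_deriv (fact (?n - 1) :: real fps) = 0" by (metis fps_deriv_of_nat of_nat_fact)
      then show ?thesis unfolding IH[OF \<rho>] by (simp add: algebra_simps)
    qed
    moreover have "fps_deriv (?F S \<rho> * ?y ^ (?n + 2)) =
        fps_deriv (?F S \<rho>) * ?y ^ (?n + 2) - of_nat (?n + 2) * ?y ^ (?n + 1) * ?F S \<rho>"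
    proof -
      have "fps_deriv (?y ^ (?n + 2)) = - (of_nat (?n + 2) * ?y ^ (?n + 1))"
        using fps_deriv_one_minus_X_power[of "?n + 1"] unfolding add_2_eq_Suc' Suc_eq_plus1[symmetric] .
      then show ?thesis unfolding fps_deriv_mult by (simp only: ac_simps mult_minus_right diff_conv_add_uminus)
    qed
    \<comment> \<open>Differentiating the induction hypothesis in two ways expresses the derivative
      of the series through the series itself and its weight.\<close>
    ultimately have D: "fps_deriv (?F S \<rho>) * ?y ^ (?n + 2) =
        of_nat (?n + 2) * ?y ^ (?n + 1) * ?F S \<rho> + fact (?n - 1) * (?W \<rho> + fps_X * fps_deriv (?W \<rho>))"
      by (simp only: diff_eq_eq add.commute)
    have sums: "(\<Sum>a\<in>S - {p}. ?F S (transpose a p \<circ> \<rho>)) * ?y ^ (?n + 2) =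
        fact (?n - 1) * fps_X * (\<Sum>a\<in>S - {p}. ?W (transpose a p \<circ> \<rho>))"
      using IH trp by (simp add: sum_distrib_left sum_distrib_right)
    let ?Z = "fps_X * fps_deriv (?W \<rho>) + (\<Sum>a\<in>S - {p}. ?W (transpose a p \<circ> \<rho>))"
    have "?F (insert x S) \<pi> * ?y ^ (?n + 3) = ?y * (fps_X * (fps_deriv (?F S \<rho>) * ?y ^ (?n + 2))
        + (\<Sum>a\<in>S - {p}. ?F S (transpose a p \<circ> \<rho>)) * ?y ^ (?n + 2))"
      unfolding step by (simp add: algebra_simps eval_nat_numeral)
    also have "\<dots> = fps_X * of_nat (?n + 2) * (?F S \<rho> * ?y ^ (?n + 2))
        + fact (?n - 1) * fps_X * (?W \<rho> * ?y + ?Z * ?y)"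
      unfolding D sums by (simp add: algebra_simps eval_nat_numeral)
    also have "\<dots> = fact (?n - 1) * fps_X * (of_nat (?n + 2) * fps_X * ?W \<rho> + ?W \<rho> * ?y + ?Z * ?y)"
      unfolding IH[OF \<rho>] by (simp add: algebra_simps)
    \<comment> \<open>Everything collapses to \<open>?n\<close> times \<open>1 - X^(c+1)\<close>
      over \<open>1 - X^c\<close>. The quotient is the change of weight when \<open>x\<close>
      lengthens the cycle of \<open>p\<close> by one, and \<open>?n\<close> completes the
      factorial.\<close>
    also have "of_nat (?n + 2) * fps_X * ?W \<rho> + ?W \<rho> * ?y + ?Z * ?y =
        ?W \<rho> * inverse (cycle_fps c) * (of_nat ?n * (1 - fps_X ^ (c + 1)))"
    proof -
      have "?W \<rho> * (inverse (cycle_fps c) * cycle_fps c) = ?W \<rho>"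
        unfolding cycle_fps_inverse[OF c0] by simp
      then have one: "?W \<rho> = ?W \<rho> * inverse (cycle_fps c) * (1 - fps_X ^ c)"
        by (simp add: cycle_fps_def mult.assoc)
      let ?q = "(of_nat ?n + 2) * fps_X + 1 - fps_X :: real fps"
      have "of_nat (?n + 2) * fps_X * ?W \<rho> + ?W \<rho> * ?y = ?W \<rho> * ?q"
        by (simp add: algebra_simps)
      also have "\<dots> = ?W \<rho> * inverse (cycle_fps c) * (1 - fps_X ^ c) * ?q"
        by (rule arg_cong[OF one])
      finally show ?thesis
        unfolding sum_cycle_weight_transpose[OF insert(1) \<rho> pS, folded c_def] power_add power_one_right
        by (simp add: algebra_simps)
    qed
    also have "?W \<rho> * inverse (cycle_fps c) * (of_nat ?n * (1 - fps_X ^ (c + 1))) =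
        of_nat ?n * cycle_weight (insert x S) cycle_fps \<pi>"
    proof -
      have "orbit \<rho> p \<in> cycles S \<rho>" using pS by (simp add: cycles_def)
      then have "?W \<rho> = cycle_fps c * (\<Prod>D\<in>cycles S \<rho> - {orbit \<rho> p}. cycle_fps (card D))"
        unfolding c_def by (rule cycle_weight_remove[OF insert(1)])
      then have "?W \<rho> * inverse (cycle_fps c) =
          (inverse (cycle_fps c) * cycle_fps c) * (\<Prod>D\<in>cycles S \<rho> - {orbit \<rho> p}. cycle_fps (card D))"
        by (simp add: ac_simps)
      also have "\<dots> = (\<Prod>D\<in>cycles S \<rho> - {orbit \<rho> p}. cycle_fps (card D))"
        unfolding cycle_fps_inverse[OF c0] by simp
      finally show ?thesis
        using cycle_weight_insert[OF insert(1) \<rho> insert(3) pS, of cycle_fps]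
        unfolding \<pi>[symmetric] c_def[symmetric] by (simp add: cycle_fps_def)
    qed
    finally have "?F (insert x S) \<pi> * ?y ^ (?n + 3) =
        fact ?n * fps_X * cycle_weight (insert x S) cycle_fps \<pi>"
      unfolding fact_n by (simp only: ac_simps)
    moreover have "Suc ?n + 2 = ?n + 3" by simp
    ultimately show ?thesis unfolding card' by (simp only: diff_Suc_1)
  qed
qed

section \<open>Means of multiplicative cycle weights over all permutations\<close>

text \<open>The exponential formula in recursive form: \<open>h n\<close> is the mean weight of a
  permutation of \<open>n\<close> points, the coefficient of \<open>X^n\<close> in the exponential
  of the sum of \<open>w c X^c / c\<close>. The second claim gives the cycle through
  \<open>x\<close> a weight \<open>u\<close> of its own. The two are proved together: removing a
  fixed \<open>x\<close> leads to the first claim, and removing \<open>x\<close> from the cycle of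
  \<open>b\<close> leads to the second, with \<open>u\<close> shifted by one.\<close>

lemma sum_cycle_weight_rec:
  fixes w u h :: "nat \<Rightarrow> real"
  assumes h0: "h 0 = 1" and hrec: "\<And>n. 0 < n \<Longrightarrow> of_nat n * h n = (\<Sum>c=1..n. w c * h (n - c))"
  shows "finite S \<Longrightarrow> (\<Sum>\<pi> | \<pi> permutes S. cycle_weight S w \<pi>) = fact (card S) * h (card S)"
    and "\<lbrakk>finite S; x \<in> S\<rbrakk> \<Longrightarrow> (\<Sum>\<pi> | \<pi> permutes S. u (card (orbit \<pi> x)) *
        (\<Prod>D\<in>cycles S \<pi> - {orbit \<pi> x}. w (card D))) =
      fact (card S - 1) * (\<Sum>c=1..card S. u c * h (card S - c))"
proof (induction "card S" arbitrary: S x u)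
  case 0
  {
    case 1
    with 0 h0 show ?case by (simp add: cycle_weight_def cycles_def)
  next
    case 2
    with 0 show ?case by auto
  }
next
  case (Suc n)
  have pointed: "(\<Sum>\<pi> | \<pi> permutes S. u (card (orbit \<pi> x)) *
        (\<Prod>D\<in>cycles S \<pi> - {orbit \<pi> x}. w (card D))) =
      fact (card S - 1) * (\<Sum>c=1..card S. u c * h (card S - c))"
    if fin: "finite S" and x: "x \<in> S" for x and u :: "nat \<Rightarrow> real"
  proof -
    define T where "T = S - {x}"
    have S: "S = insert x T" and xT: "x \<notin> T" and finT: "finite T"
      using x fin by (auto simp: T_def)
    have "card T = card S - 1" unfolding T_def by (rule card_Diff_singleton[OF x])
    with Suc.hyps(3) have cT: "card T = n" by simp
    let ?F = "\<lambda>\<pi>. u (card (orbit \<pi> x)) * (\<Prod>D\<in>cycles S \<pi> - {orbit \<pi> x}. w (card D))"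
    have "sum ?F {\<pi>. \<pi> permutes S} = (\<Sum>b\<in>insert x T. \<Sum>q | q permutes T. ?F (transpose x b \<circ> q))"
      unfolding S using finT xT by (rule sum_over_permutations_insert)
    also have "\<dots> = (\<Sum>q | q permutes T. ?F (transpose x x \<circ> q)) +
        (\<Sum>b\<in>T. \<Sum>q | q permutes T. ?F (transpose x b \<circ> q))"
      using finT xT by simp
    also have "(\<Sum>q | q permutes T. ?F (transpose x x \<circ> q)) = u 1 * (\<Sum>q | q permutes T. cycle_weight T w q)"
      unfolding sum_distrib_left
    proof (rule sum.cong[OF refl])
      fix q assume "q \<in> {q. q permutes T}"
      then have q: "q permutes T" by simp
      have ox: "orbit q x = {x}" using orbit_eq_singleton_iff[of q x] permutes_not_in[OF q xT] by simp
      have "{x} \<notin> cycles T q" using Union_cycles[OF finT q] xT by blast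
      then have "cycles S q - {orbit q x} = cycles T q"
        unfolding S cycles_insert_fixed[OF q xT] ox by blast
      then show "?F (transpose x x \<circ> q) = u 1 * cycle_weight T w q"
        by (simp add: ox cycle_weight_def)
    qed
    also have "(\<Sum>q | q permutes T. cycle_weight T w q) = fact n * h n"
      using Suc.hyps(1)[OF cT[symmetric]] finT cT by simp
    \<comment> \<open>The inner sum does not depend on \<open>b\<close>: it is the second claim for
      \<open>T\<close>, pointed at \<open>b\<close>, with the shifted weight.\<close>
    also have "(\<Sum>b\<in>T. \<Sum>q | q permutes T. ?F (transpose x b \<circ> q)) =
        (\<Sum>b\<in>T. fact (n - 1) * (\<Sum>c=1..n. u (Suc c) * h (n - c)))"
    proof (rule sum.cong[OF refl])
      fix b assume b: "b \<in> T"
      have "(\<Sum>q | q permutes T. ?F (transpose x b \<circ> q)) =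
          (\<Sum>q | q permutes T. u (Suc (card (orbit q b))) * (\<Prod>D\<in>cycles T q - {orbit q b}. w (card D)))"
      proof (rule sum.cong[OF refl])
        fix q assume "q \<in> {q. q permutes T}"
        then have q: "q permutes T" by simp
        note ins = cycles_transpose_comp_insert[OF finT q xT b]
        have perm: "transpose x b \<circ> q permutes S"
          unfolding S using q b by (intro permutes_compose permutes_swap_id) (auto intro: permutes_subset)
        have "orbit (transpose x b \<circ> q) x \<in> cycles S (transpose x b \<circ> q)" using x by (simp add: cycles_def)
        then have "orbit (transpose x b \<circ> q) x \<in> insert (insert x (orbit q b)) (cycles T q - {orbit q b})"
          using ins(1) by (simp add: S)
        moreover have "x \<in> orbit (transpose x b \<circ> q) x" by (rule self_in_orbit_permutes[OF fin perm])
        ultimately have ox: "orbit (transpose x b \<circ> q) x = insert x (orbit q b)"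
          using Union_cycles[OF finT q] xT by blast
        have "cycles S (transpose x b \<circ> q) - {insert x (orbit q b)} = cycles T q - {orbit q b}"
          using ins(1,2) by (auto simp: S)
        moreover have "card (insert x (orbit q b)) = Suc (card (orbit q b))"
          using ins(3) finite_orbit_permutes[OF finT q] by simp
        ultimately show "?F (transpose x b \<circ> q) =
            u (Suc (card (orbit q b))) * (\<Prod>D\<in>cycles T q - {orbit q b}. w (card D))"
          unfolding ox by simp
      qed
      also have "\<dots> = fact (n - 1) * (\<Sum>c=1..n. u (Suc c) * h (n - c))"
        using Suc.hyps(2)[OF cT[symmetric] finT b, of "\<lambda>c. u (Suc c)"] cT by simp
      finally show "(\<Sum>q | q permutes T. ?F (transpose x b \<circ> q)) =
          fact (n - 1) * (\<Sum>c=1..n. u (Suc c) * h (n - c))" .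
    qed
    also have "\<dots> = fact n * (\<Sum>c=1..n. u (Suc c) * h (n - c))"
      using cT by (cases n) (simp_all add: algebra_simps)
    also have "(\<Sum>c=1..n. u (Suc c) * h (n - c)) = (\<Sum>c=2..Suc n. u c * h (Suc n - c))"
      by (rule sum.reindex_bij_witness[of _ "\<lambda>c. c - 1" Suc]) auto
    also have "u 1 * (fact n * h n) + fact n * (\<Sum>c=2..Suc n. u c * h (Suc n - c)) =
        fact n * (\<Sum>c=1..Suc n. u c * h (Suc n - c))"
    proof -
      have "(\<Sum>c=1..Suc n. u c * h (Suc n - c)) = u 1 * h n + (\<Sum>c=2..Suc n. u c * h (Suc n - c))"
        by (subst sum.atLeast_Suc_atMost) (simp_all add: numeral_2_eq_2)
      then show ?thesis by (simp only: distrib_left ac_simps)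
    qed
    finally show ?thesis using Suc.hyps(3)[symmetric] by simp
  qed
  {
    case 1
    then obtain x where x: "x \<in> S" using Suc.hyps(3) by (metis card.empty equals0I nat.distinct(1))
    have "(\<Sum>\<pi> | \<pi> permutes S. cycle_weight S w \<pi>) = (\<Sum>\<pi> | \<pi> permutes S. w (card (orbit \<pi> x)) *
        (\<Prod>D\<in>cycles S \<pi> - {orbit \<pi> x}. w (card D)))"
      using x 1 by (intro sum.cong refl cycle_weight_remove) (auto simp: cycles_def)
    also have "\<dots> = fact n * (of_nat (Suc n) * h (Suc n))"
      unfolding pointed[OF 1 x] hrec[OF zero_less_Suc] Suc.hyps(3)[symmetric] by simp
    finally show ?case unfolding Suc.hyps(3)[symmetric] by (simp add: algebra_simps)
  next
    case 2
    then show ?case by (rule pointed)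
  }
qed

definition geometric_fps :: "real \<Rightarrow> real fps" where
  "geometric_fps t = Abs_fps (\<lambda>n. t ^ n)"

lemma geometric_fps_mult: "geometric_fps t * (1 - fps_const t * fps_X) = 1"
proof (rule fps_ext)
  show "(geometric_fps t * (1 - fps_const t * fps_X)) $ n = 1 $ n" for n
    unfolding right_diff_distrib mult.assoc[symmetric]
    by (cases n) (simp_all add: geometric_fps_def mult.commute[of _ "fps_const t"])
qed

lemma fps_deriv_geometric_fps: "fps_deriv (geometric_fps t) = fps_const t * (geometric_fps t * geometric_fps t)"
proof -
  let ?g = "geometric_fps t" and ?u = "1 - fps_const t * fps_X"
  have "fps_deriv (?g * ?u) = 0" unfolding geometric_fps_mult by simp
  then have "fps_deriv ?g * ?u = fps_const t * ?g" by (simp add: algebra_simps)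
  then have "(fps_deriv ?g * ?u) * ?g = fps_const t * ?g * ?g" by simp
  moreover have "(fps_deriv ?g * ?u) * ?g = fps_deriv ?g * (?g * ?u)" by (simp only: ac_simps)
  ultimately show ?thesis by (metis geometric_fps_mult mult.right_neutral mult.assoc)
qed

text \<open>The coefficient of \<open>X^n\<close> in
  \<open>(1 - rX)(1 - sX) / ((1 - X)(1 - rsX))\<close>, which is the exponential of the sum of
  \<open>(1 - r^c)(1 - s^c) X^c / c\<close>. It is the mean of the product of the values of
  \<open>cycle_poly\<close> at \<open>r\<close> and at \<open>s\<close>.\<close>

definition cycle_pair_mean :: "real \<Rightarrow> real \<Rightarrow> nat \<Rightarrow> real" where
  "cycle_pair_mean r s n = (if n = 0 then 1 else (1 - r) * (1 - s) * (\<Sum>k<n. (r * s) ^ k))"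

text \<open>Comparison of coefficients in \<open>H' = H G\<close>, where \<open>H\<close> is the
  rational series and its logarithmic derivative \<open>G\<close> has the coefficients
  \<open>(1 - r^(n+1))(1 - s^(n+1))\<close>.\<close>

lemma cycle_pair_mean_rec:
  assumes "0 < n"
  shows "of_nat n * cycle_pair_mean r s n = (\<Sum>c=1..n. (1 - r ^ c) * (1 - s ^ c) * cycle_pair_mean r s (n - c))"
proof -
  let ?g = geometric_fps and ?c = fps_const
  define H where "H = (1 - ?c r * fps_X) * (1 - ?c s * fps_X) * ?g 1 * ?g (r * s)"
  define G where "G = ?g 1 - ?c r * ?g r - ?c s * ?g s + ?c (r * s) * ?g (r * s)"
  have u1: "?g 1 * (1 - fps_X) = 1" using geometric_fps_mult[of 1] by simp
  \<comment> \<open>From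
    \<open>(1 - rX)(1 - sX) = (1 - X)(1 - rsX) + (1 - r)(1 - s)X\<close>.\<close>
  have H: "H = 1 + ?c ((1 - r) * (1 - s)) * fps_X * (?g 1 * ?g (r * s))"
  proof -
    have eq: "(1 - ?c r * fps_X) * (1 - ?c s * fps_X) =
        (1 - fps_X) * (1 - ?c (r * s) * fps_X) + ?c ((1 - r) * (1 - s)) * fps_X"
      by (simp add: algebra_simps flip: fps_const_mult fps_const_sub fps_const_add)
    have "H = (?g 1 * (1 - fps_X)) * (?g (r * s) * (1 - ?c (r * s) * fps_X))
        + ?c ((1 - r) * (1 - s)) * fps_X * (?g 1 * ?g (r * s))"
      unfolding H_def eq by (simp only: distrib_right distrib_left ac_simps)
    then show ?thesis unfolding u1 geometric_fps_mult by simp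
  qed
  have Hn: "H $ n = cycle_pair_mean r s n" for n
  proof (cases n)
    case (Suc m)
    have "(?g 1 * ?g (r * s)) $ m = (\<Sum>k\<le>m. (r * s) ^ (m - k))"
      by (simp add: fps_mult_nth geometric_fps_def atLeast0AtMost)
    also have "\<dots> = (\<Sum>k\<le>m. (r * s) ^ k)"
      by (rule sum.reindex_bij_witness[of _ "\<lambda>k. m - k" "\<lambda>k. m - k"]) auto
    finally show ?thesis
      unfolding H cycle_pair_mean_def using Suc by (simp add: mult.assoc lessThan_Suc_atMost)
  qed (simp add: H cycle_pair_mean_def)
  have Gn: "G $ n = (1 - r ^ Suc n) * (1 - s ^ Suc n)" for n
    by (simp add: G_def geometric_fps_def algebra_simps power_mult_distrib)
  have "fps_deriv H = H * G"
  proof -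
    define a where "a = ?g 1" define b where "b = ?g (r * s)"
    define ir where "ir = ?g r" define iS where "iS = ?g s"
    define ur where "ur = 1 - ?c r * fps_X" define us where "us = 1 - ?c s * fps_X"
    have r: "ir * ur = 1" "iS * us = 1"
      unfolding ir_def iS_def ur_def us_def by (rule geometric_fps_mult)+
    have d: "fps_deriv a = a * a" "fps_deriv b = ?c (r * s) * (b * b)" "fps_deriv ur = - ?c r" "fps_deriv us = - ?c s"
      unfolding a_def b_def ur_def us_def by (simp_all add: fps_deriv_geometric_fps)
    have "H * G = ur * us * a * b * (a + ?c (r * s) * b) - ?c r * us * a * b * (ir * ur) - ?c s * ur * a * b * (iS * us)"
      unfolding H_def G_def ur_def[symmetric] us_def[symmetric] a_def[symmetric] b_def[symmetric]
        ir_def[symmetric] iS_def[symmetric] by (simp add: algebra_simps)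
    also have "\<dots> = fps_deriv (ur * us * a * b)"
      unfolding r fps_deriv_mult d by (simp del: fps_const_neg add: algebra_simps)
    finally show ?thesis unfolding H_def ur_def us_def a_def b_def by simp
  qed
  then have "fps_deriv H $ (n - 1) = (H * G) $ (n - 1)" by simp
  moreover have "fps_deriv H $ (n - 1) = of_nat n * H $ n" using assms by simp
  moreover have "(H * G) $ (n - 1) = (\<Sum>i=0..n - 1. H $ i * G $ (n - 1 - i))" by (rule fps_mult_nth)
  moreover have "\<dots> = (\<Sum>c=1..n. H $ (n - c) * G $ (c - 1))"
    using assms by (intro sum.reindex_bij_witness[of _ "\<lambda>c. n - c" "\<lambda>i. n - i"]) auto
  moreover have "\<dots> = (\<Sum>c=1..n. (1 - r ^ c) * (1 - s ^ c) * cycle_pair_mean r s (n - c))"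
    by (intro sum.cong) (auto simp: Hn Gn simp del: power_Suc)
  ultimately show ?thesis using Hn by simp
qed

section \<open>Hook characters\<close>

definition cycle_poly :: "'a set \<Rightarrow> ('a \<Rightarrow> 'a) \<Rightarrow> real poly" where
  "cycle_poly S = cycle_weight S (\<lambda>c. 1 - monom 1 c)"

text \<open>Up to the sign $(-1)^k$, the \<open>k\<close>-th coefficient is the value at \<open>\<pi>\<close> of the
  irreducible character of the hook $(n-k,1^k)$.\<close>

definition hook_poly :: "'a set \<Rightarrow> ('a \<Rightarrow> 'a) \<Rightarrow> real poly" where
  "hook_poly S \<pi> = cycle_poly S \<pi> div [:1, -1:]"

lemma poly_cycle_poly: "poly (cycle_poly S \<pi>) r = cycle_weight S (\<lambda>c. 1 - r ^ c) \<pi>"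
  by (simp add: cycle_poly_def cycle_weight_def poly_prod poly_monom)

text \<open>Every factor \<open>1 - X^c\<close> vanishes at 1 and there is at least one cycle, so
  the division in \<open>hook_poly\<close> is exact.\<close>

lemma cycle_poly_eq:
  assumes "finite S" "S \<noteq> {}" "\<pi> permutes S"
  shows "cycle_poly S \<pi> = [:1, -1:] * hook_poly S \<pi>"
proof -
  have "poly (cycle_poly S \<pi>) 1 = 0"
    using card_cycles_pos[OF assms(1,2), of \<pi>] by (simp add: poly_cycle_poly cycle_weight_def)
  then have "[:- 1, 1:] dvd cycle_poly S \<pi>" by (simp add: poly_eq_0_iff_dvd)
  then have "- [:- 1, 1:] dvd cycle_poly S \<pi>" by (simp only: minus_dvd_iff)
  then show ?thesis unfolding hook_poly_def by (metis dvd_mult_div_cancel minus_pCons minus_zero minus_minus)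
qed

text \<open>The mean of the product of the cycle polynomials at \<open>r\<close> and
  \<open>s\<close> is \<open>(1 - r)(1 - s)\<close> times the sum of \<open>(rs)^k\<close> over
  \<open>k < n\<close>. Once \<open>(1 - r)(1 - s)\<close> is divided out, only diagonal
  coefficients are left.\<close>

lemma sum_hook_poly_orthogonal:
  fixes S :: "'a set"
  assumes "finite S" "S \<noteq> {}"
  shows "(\<Sum>\<pi> | \<pi> permutes S. coeff (hook_poly S \<pi>) k * coeff (hook_poly S \<pi>) l) =
    (if k = l \<and> k < card S then fact (card S) else 0)"
proof -
  let ?n = "card S" and ?P = "{\<pi>. \<pi> permutes S}" and ?e = "[:1, -1:] :: real poly"
  have n0: "?n \<noteq> 0" using assms by simp
  have e: "?e \<noteq> 0" by simp
  have eq: "cycle_poly S \<pi> = ?e * hook_poly S \<pi>" if "\<pi> \<in> ?P" for \<pi>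
    using cycle_poly_eq[OF assms] that by simp
  have pair: "(\<Sum>\<pi>\<in>?P. poly (cycle_poly S \<pi>) s * poly (cycle_poly S \<pi>) r) =
      fact ?n * ((1 - r) * (1 - s) * (\<Sum>k<?n. (r * s) ^ k))" for r s
  proof -
    have "(\<Sum>\<pi>\<in>?P. poly (cycle_poly S \<pi>) s * poly (cycle_poly S \<pi>) r) =
        (\<Sum>\<pi>\<in>?P. cycle_weight S (\<lambda>c. (1 - r ^ c) * (1 - s ^ c)) \<pi>)"
      by (simp add: poly_cycle_poly cycle_weight_def prod.distrib mult.commute)
    also have "\<dots> = fact ?n * cycle_pair_mean r s ?n"
      by (rule sum_cycle_weight_rec(1)[OF _ _ assms(1)])
        (simp_all add: cycle_pair_mean_rec, simp add: cycle_pair_mean_def)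
    finally show ?thesis using n0 by (simp add: cycle_pair_mean_def)
  qed
  \<comment> \<open>Coefficients are extracted in one variable at a time, here in \<open>r\<close>
    with \<open>s\<close> a fixed number. The factor \<open>1 - r\<close> is cancelled as a
    polynomial, so the value 1 needs no separate treatment.\<close>
  have coeff_k: "(\<Sum>\<pi>\<in>?P. coeff (hook_poly S \<pi>) k * poly (cycle_poly S \<pi>) s) =
      (if k < ?n then fact ?n * (1 - s) * s ^ k else 0)" for k s
  proof -
    have 1: "(\<Sum>\<pi>\<in>?P. Polynomial.smult (poly (cycle_poly S \<pi>) s) (cycle_poly S \<pi>)) =
        ?e * (\<Sum>k<?n. monom (fact ?n * (1 - s) * s ^ k) k)"
      by (rule poly_ext)
        (simp add: poly_sum pair poly_monom power_mult_distrib sum_distrib_left algebra_simps)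
    have 2: "(\<Sum>\<pi>\<in>?P. Polynomial.smult (poly (cycle_poly S \<pi>) s) (cycle_poly S \<pi>)) =
        ?e * (\<Sum>\<pi>\<in>?P. Polynomial.smult (poly (cycle_poly S \<pi>) s) (hook_poly S \<pi>))"
      unfolding sum_distrib_left
      by (rule sum.cong[OF refl]) (metis eq mult_smult_right)
    have "(\<Sum>\<pi>\<in>?P. Polynomial.smult (poly (cycle_poly S \<pi>) s) (hook_poly S \<pi>)) =
        (\<Sum>k<?n. monom (fact ?n * (1 - s) * s ^ k) k)"
      using trans[OF sym[OF 2] 1] unfolding mult_left_cancel[OF e] .
    then have "coeff (\<Sum>\<pi>\<in>?P. Polynomial.smult (poly (cycle_poly S \<pi>) s) (hook_poly S \<pi>)) k =
        coeff (\<Sum>k<?n. monom (fact ?n * (1 - s) * s ^ k) k) k" by simp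
    then show ?thesis by (simp add: coeff_sum mult.commute)
  qed
  have 1: "(\<Sum>\<pi>\<in>?P. Polynomial.smult (coeff (hook_poly S \<pi>) k) (cycle_poly S \<pi>)) =
      ?e * (if k < ?n then monom (fact ?n) k else 0)"
    by (rule poly_ext) (simp add: poly_sum coeff_k poly_monom, simp add: algebra_simps)
  have 2: "(\<Sum>\<pi>\<in>?P. Polynomial.smult (coeff (hook_poly S \<pi>) k) (cycle_poly S \<pi>)) =
      ?e * (\<Sum>\<pi>\<in>?P. Polynomial.smult (coeff (hook_poly S \<pi>) k) (hook_poly S \<pi>))"
    unfolding sum_distrib_left
    by (rule sum.cong[OF refl]) (metis eq mult_smult_right)
  have "(\<Sum>\<pi>\<in>?P. Polynomial.smult (coeff (hook_poly S \<pi>) k) (hook_poly S \<pi>)) =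
      (if k < ?n then monom (fact ?n) k else 0)"
    using trans[OF sym[OF 2] 1] unfolding mult_left_cancel[OF e] .
  then have "coeff (\<Sum>\<pi>\<in>?P. Polynomial.smult (coeff (hook_poly S \<pi>) k) (hook_poly S \<pi>)) l =
      coeff (if k < ?n then monom (fact ?n) k else 0) l" by simp
  then show ?thesis by (auto simp: coeff_sum)
qed

section \<open>Full cycle sums in terms of hook coefficients\<close>

definition binomial_fps :: "nat \<Rightarrow> real fps" where
  "binomial_fps n = Abs_fps (\<lambda>m. of_nat ((m + n) choose n))"

lemma binomial_fps_mult: "binomial_fps n * (1 - fps_X) ^ Suc n = 1"
proof (induction n)
  case 0
  have "binomial_fps 0 = geometric_fps 1" by (simp add: binomial_fps_def geometric_fps_def)
  then show ?case using geometric_fps_mult[of 1] by simp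
next
  case (Suc n)
  have "binomial_fps (Suc n) * (1 - fps_X) = binomial_fps n"
  proof (rule fps_ext)
    show "(binomial_fps (Suc n) * (1 - fps_X)) $ m = binomial_fps n $ m" for m
      unfolding right_diff_distrib by (cases m) (simp_all add: binomial_fps_def)
  qed
  moreover have "binomial_fps (Suc n) * (1 - fps_X) ^ Suc (Suc n) =
      (binomial_fps (Suc n) * (1 - fps_X)) * (1 - fps_X) ^ Suc n"
    by (simp only: power_Suc mult.assoc)
  ultimately show ?case using Suc.IH by metis
qed

text \<open>The weight is \<open>1 - X\<close> times the hook polynomial \<open>Q\<close>, so the
  generating function is \<open>(n - 1)! X Q / (1 - X)^(n+1)\<close> with \<open>n = card S\<close>.
  The factor X accounts for \<open>m - 1\<close> and for the bound \<open>k < m\<close>.\<close>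

lemma full_cycle_sum_hook_poly:
  assumes "finite S" "S \<noteq> {}" "\<pi> permutes S"
  shows "full_cycle_sum S ((^) (real m)) \<pi> = fact (card S - 1) *
    (\<Sum>k<m. coeff (hook_poly S \<pi>) k * of_nat ((m - 1 - k + card S) choose card S))"
proof -
  let ?n = "card S" and ?Q = "fps_of_poly (hook_poly S \<pi>)" and ?y = "1 - fps_X :: real fps"
  let ?F = "Abs_fps (\<lambda>m. full_cycle_sum S ((^) (real m)) \<pi>)"
  have "fps_of_poly (cycle_poly S \<pi>) = cycle_weight S cycle_fps \<pi>"
    unfolding cycle_poly_def cycle_weight_def fps_of_poly_prod
    by (simp add: cycle_fps_def fps_of_poly_diff fps_of_poly_monom')
  moreover have "fps_of_poly [:1, -1 :: real:] = ?y" by (simp add: fps_of_poly_pCons)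
  ultimately have W: "cycle_weight S cycle_fps \<pi> = ?y * ?Q"
    unfolding cycle_poly_eq[OF assms] fps_of_poly_mult by simp
  have y0: "?y \<noteq> 0" using binomial_fps_mult[of 0] by auto
  have "?y * (?F * ?y ^ Suc ?n) = ?F * ?y ^ (?n + 2)"
    by (simp only: add_2_eq_Suc' power_Suc ac_simps)
  also have "\<dots> = ?y * (fact (?n - 1) * fps_X * ?Q)"
    unfolding full_cycle_sum_fps[OF assms] W by (simp only: ac_simps)
  finally have eq: "?F * ?y ^ Suc ?n = fact (?n - 1) * fps_X * ?Q"
    unfolding mult_left_cancel[OF y0] .
  have "?F * (binomial_fps ?n * ?y ^ Suc ?n) = (?F * ?y ^ Suc ?n) * binomial_fps ?n"
    by (simp only: ac_simps)
  then have "?F = (?F * ?y ^ Suc ?n) * binomial_fps ?n"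
    unfolding binomial_fps_mult mult_1_right .
  also have "\<dots> = fact (?n - 1) * (fps_X * (?Q * binomial_fps ?n))"
    unfolding eq by (simp only: ac_simps)
  finally have "?F $ m = (fact (?n - 1) * (fps_X * (?Q * binomial_fps ?n))) $ m" by simp
  also have "\<dots> = fact (?n - 1) * (fps_X * (?Q * binomial_fps ?n)) $ m"
    by (metis fps_of_nat of_nat_fact fps_mult_left_const_nth)
  also have "(fps_X * (?Q * binomial_fps ?n)) $ m =
      (\<Sum>k<m. coeff (hook_poly S \<pi>) k * of_nat ((m - 1 - k + ?n) choose ?n))"
    unfolding fps_X_mult_nth
    by (cases m) (simp_all add: fps_mult_nth binomial_fps_def atLeast0AtMost lessThan_Suc_atMost)
  finally show ?thesis by simp
qed

lemma cycles_inv: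
  assumes "finite S" "\<kappa> permutes S"
  shows "cycles S (inv_into UNIV \<kappa>) = cycles S \<kappa>"
  unfolding cycles_def using orbit_inv_eq assms permutation_permutes by (metis (no_types, lifting) image_cong)

lemma inv_full_cycles: "\<lbrakk>finite S; \<kappa> \<in> full_cycles S\<rbrakk> \<Longrightarrow> inv_into UNIV \<kappa> \<in> full_cycles S"
  by (simp add: full_cycles_def cycles_inv permutes_inv)

lemma sum_full_cycles_inv:
  assumes "finite S"
  shows "(\<Sum>\<kappa>\<in>full_cycles S. f (inv_into UNIV \<kappa>)) = sum f (full_cycles S)"
  by (rule sum.reindex_bij_witness[of _ "inv_into UNIV" "inv_into UNIV"])
    (auto simp: inv_full_cycles[OF assms] permutes_inv_inv[OF full_cycles_permutes])

text \<open>Replacing \<open>\<pi>\<close> by the inverse of \<open>\<kappa>'\<close> followed after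
  \<open>\<pi>\<close> lets the two full cycles act on different factors. For each
  \<open>\<pi>\<close> the sum is then a product of two full cycle sums, and orthogonality reduces
  the double sum over hooks to its diagonal.\<close>

lemma sum_full_cycles_pair:
  fixes S :: "'a set"
  assumes "finite S" "S \<noteq> {}"
  defines "n \<equiv> card S"
  shows "(\<Sum>\<kappa>\<in>full_cycles S. \<Sum>\<kappa>'\<in>full_cycles S. \<Sum>\<pi> | \<pi> permutes S.
      real m ^ card (cycles S \<pi>) * real l ^ card (cycles S (\<kappa> \<circ> \<kappa>' \<circ> \<pi>))) =
    fact (n - 1) ^ 2 * fact n * (\<Sum>k<n. of_nat ((m + n - 1 - k) choose n) * of_nat ((l + n - 1 - k) choose n))"
proof -
  let ?P = "{\<pi>. \<pi> permutes S}" and ?C = "full_cycles S"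
  let ?c = "\<lambda>\<pi>. card (cycles S \<pi>)"
  let ?q = "\<lambda>\<pi>. coeff (hook_poly S \<pi>)" and ?b = "\<lambda>m k. of_nat ((m - 1 - k + n) choose n) :: real"
  have "(\<Sum>\<kappa>\<in>?C. \<Sum>\<kappa>'\<in>?C. \<Sum>\<pi>\<in>?P. real m ^ ?c \<pi> * real l ^ ?c (\<kappa> \<circ> \<kappa>' \<circ> \<pi>)) =
      (\<Sum>\<kappa>\<in>?C. \<Sum>\<kappa>'\<in>?C. \<Sum>\<pi>\<in>?P. real m ^ ?c (inv_into UNIV \<kappa>' \<circ> \<pi>) * real l ^ ?c (\<kappa> \<circ> \<pi>))"
  proof (rule sum.cong[OF refl], rule sum.cong[OF refl])
    fix \<kappa> \<kappa>' assume "\<kappa>' \<in> ?C"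
    then have \<kappa>': "\<kappa>' permutes S" by (rule full_cycles_permutes)
    have inv: "inv_into UNIV \<kappa>' \<circ> (\<kappa>' \<circ> \<pi>) = \<pi>" for \<pi>
      unfolding comp_assoc[symmetric] permutes_inv_o(2)[OF \<kappa>'] by simp
    show "(\<Sum>\<pi>\<in>?P. real m ^ ?c \<pi> * real l ^ ?c (\<kappa> \<circ> \<kappa>' \<circ> \<pi>)) =
        (\<Sum>\<pi>\<in>?P. real m ^ ?c (inv_into UNIV \<kappa>' \<circ> \<pi>) * real l ^ ?c (\<kappa> \<circ> \<pi>))"
      unfolding setum_permutations_compose_left[OF \<kappa>',
        of "\<lambda>\<pi>. real m ^ ?c (inv_into UNIV \<kappa>' \<circ> \<pi>) * real l ^ ?c (\<kappa> \<circ> \<pi>)"]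
      unfolding inv comp_assoc by (rule refl)
  qed
  also have "\<dots> = (\<Sum>\<pi>\<in>?P. (\<Sum>\<kappa>\<in>?C. real l ^ ?c (\<kappa> \<circ> \<pi>)) * (\<Sum>\<kappa>'\<in>?C. real m ^ ?c (inv_into UNIV \<kappa>' \<circ> \<pi>)))"
    unfolding sum_product
    by (subst (2) sum.swap, subst sum.swap) (simp add: mult.commute)
  also have "\<dots> = (\<Sum>\<pi>\<in>?P. full_cycle_sum S ((^) (real l)) \<pi> * full_cycle_sum S ((^) (real m)) \<pi>)"
    unfolding full_cycle_sum_def
    by (simp add: sum_full_cycles_inv[OF assms(1), of "\<lambda>\<kappa>. real m ^ ?c (\<kappa> \<circ> _)"])
  also have "\<dots> = (\<Sum>\<pi>\<in>?P. fact (n - 1) ^ 2 * (\<Sum>k<l. \<Sum>k'<m. (?b l k * ?b m k') * (?q \<pi> k * ?q \<pi> k')))"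
    using full_cycle_sum_hook_poly[OF assms(1,2)]
    by (intro sum.cong) (simp_all add: n_def power2_eq_square sum_product ac_simps)
  also have "\<dots> = fact (n - 1) ^ 2 * (\<Sum>k<l. \<Sum>k'<m. (?b l k * ?b m k') * (\<Sum>\<pi>\<in>?P. ?q \<pi> k * ?q \<pi> k'))"
    unfolding sum_distrib_left[symmetric]
    by (subst sum.swap, intro arg_cong[of _ _ "(*) _"] sum.cong refl, subst sum.swap) (simp add: sum_distrib_left)
  also have "\<dots> = fact (n - 1) ^ 2 * (\<Sum>k<l. \<Sum>k'<m. if k = k' \<and> k < n then ?b l k * ?b m k * fact n else 0)"
    unfolding sum_hook_poly_orthogonal[OF assms(1,2)] by (intro arg_cong[of _ _ "(*) _"] sum.cong) (auto simp: n_def)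
  also have "\<dots> = fact (n - 1) ^ 2 * (\<Sum>k<l. if k < m \<and> k < n then ?b l k * ?b m k * fact n else 0)"
  proof -
    have "(\<Sum>k'<m. if k = k' \<and> k < n then ?b l k * ?b m k * fact n else 0) =
        (if k < m \<and> k < n then ?b l k * ?b m k * fact n else 0)" for k
      using sum.delta'[of "{..<m}" k "\<lambda>_. if k < n then ?b l k * ?b m k * fact n else 0"]
      by (auto simp: if_distrib cong: if_cong) 
    then show ?thesis by simp
  qed
  also have "(\<Sum>k<l. if k < m \<and> k < n then ?b l k * ?b m k * fact n else 0) =
      (\<Sum>k\<in>{k. k < l \<and> k < m \<and> k < n}. of_nat ((l + n - 1 - k) choose n) * of_nat ((m + n - 1 - k) choose n) * fact n)"
    by (subst sum.inter_filter[symmetric]) (auto intro!: sum.cong)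
  \<comment> \<open>For \<open>k \<ge> m\<close> the upper entry \<open>m + n - 1 - k\<close> is
    below \<open>n\<close> and the binomial vanishes; likewise for \<open>l\<close>.\<close>
  also have "\<dots> = (\<Sum>k<n. of_nat ((l + n - 1 - k) choose n) * of_nat ((m + n - 1 - k) choose n) * fact n)"
    by (rule sum.mono_neutral_left) (auto simp: not_less)
  also have "fact (n - 1) ^ 2 * \<dots> = fact (n - 1) ^ 2 * fact n *
      (\<Sum>k<n. of_nat ((m + n - 1 - k) choose n) * of_nat ((l + n - 1 - k) choose n))"
    by (simp add: sum_distrib_left sum_distrib_right ac_simps)
  finally show ?thesis .
qed

section \<open>Cycle sums for the trivial and the sign character\<close>

text \<open>A new fixed point gives a factor \<open>z\<close>; inserting the new point at one of
  \<open>card S\<close> places keeps the number of cycles and flips the sign. Both formulas come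
  from one induction, in which \<open>e\<close> is the constant 1 or the embedding of the
  sign.\<close>

lemma sum_permutations_power_cycles:
  assumes "finite S"
  shows "(\<Sum>\<pi> | \<pi> permutes S. z ^ card (cycles S \<pi>)) = (\<Prod>i<card S. z + real i)"
    and "(\<Sum>\<pi> | \<pi> permutes S. of_int (sign \<pi>) * z ^ card (cycles S \<pi>)) = (\<Prod>i<card S. z - real i)"
proof -
  have "(\<Sum>\<pi> | \<pi> permutes S. e (sign \<pi>) * z ^ card (cycles S \<pi>)) = (\<Prod>i<card S. z + e (-1) * real i)"
    if e: "e 1 = 1" "e (-1) = 1 \<or> e (-1) = -1" and mult: "\<And>s. s = 1 \<or> s = -1 \<Longrightarrow> e (- s) = e (-1) * e s"
    for e :: "int \<Rightarrow> real"
    using assms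
  proof (induction S rule: finite_induct)
    case empty
    then show ?case by (simp add: cycles_def e)
  next
    case (insert x S)
    let ?Z = "\<Sum>q | q permutes S. e (sign q) * z ^ card (cycles S q)"
    have "(\<Sum>\<pi> | \<pi> permutes insert x S. e (sign \<pi>) * z ^ card (cycles (insert x S) \<pi>)) =
        (\<Sum>b\<in>insert x S. \<Sum>q | q permutes S. e (sign (transpose x b \<circ> q)) *
          z ^ card (cycles (insert x S) (transpose x b \<circ> q)))"
      using insert(1,2) by (rule sum_over_permutations_insert)
    also have "\<dots> = (\<Sum>b\<in>insert x S. if b = x then z * ?Z else e (-1) * ?Z)"
    proof (rule sum.cong[OF refl])
      fix b assume b: "b \<in> insert x S"
      have s: "sign (transpose x b \<circ> q) = (if b = x then sign q else - sign q)" if "q permutes S" for q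
      proof -
        have "permutation q" using insert(1) that permutation_permutes by blast
        then show ?thesis by (simp add: sign_compose permutation_swap_id sign_swap_id)
      qed
      show "(\<Sum>q | q permutes S. e (sign (transpose x b \<circ> q)) * z ^ card (cycles (insert x S) (transpose x b \<circ> q))) =
          (if b = x then z * ?Z else e (-1) * ?Z)"
      proof (cases "b = x")
        case True
        then show ?thesis
          using s card_cycles_insert_fixed[OF insert(1) _ insert(2)]
          by (simp add: sum_distrib_left mult.left_commute)
      next
        case False
        have "e (- sign q) = e (-1) * e (sign q)" for q :: "'a \<Rightarrow> 'a"
          by (rule mult) (cases q rule: sign_cases; simp)
        with False b show ?thesis
          using s card_cycles_transpose_comp_insert[OF insert(1) _ insert(2)]
          by (simp add: sum_distrib_left mult.assoc)
      qed
    qed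
    also have "\<dots> = ?Z * (z + e (-1) * real (card S))"
    proof -
      have "(\<Sum>b\<in>S. if b = x then z * ?Z else e (-1) * ?Z) = (\<Sum>b\<in>S. e (-1) * ?Z)"
        using insert(2) by (intro sum.cong) auto
      then show ?thesis using insert(1,2) by (simp add: algebra_simps)
    qed
    finally show ?case using insert by simp
  qed
  from this[of "\<lambda>_. 1"] this[of of_int]
  show "(\<Sum>\<pi> | \<pi> permutes S. z ^ card (cycles S \<pi>)) = (\<Prod>i<card S. z + real i)"
    "(\<Sum>\<pi> | \<pi> permutes S. of_int (sign \<pi>) * z ^ card (cycles S \<pi>)) = (\<Prod>i<card S. z - real i)"
    by auto
qed

lemma sum_permutations_power_cycles_nat:
  assumes "finite S" "S \<noteq> {}"
  shows "(\<Sum>\<pi> | \<pi> permutes S. real m ^ card (cycles S \<pi>)) = fact (card S) * of_nat ((m + card S - 1) choose card S)"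
    and "(\<Sum>\<pi> | \<pi> permutes S. of_int (sign \<pi>) * real m ^ card (cycles S \<pi>)) = fact (card S) * of_nat (m choose card S)"
proof -
  let ?n = "card S"
  have n0: "?n > 0" using assms by (simp add: card_gt_0_iff)
  show "(\<Sum>\<pi> | \<pi> permutes S. of_int (sign \<pi>) * real m ^ card (cycles S \<pi>)) = fact ?n * of_nat (m choose ?n)"
    unfolding sum_permutations_power_cycles(2)[OF assms(1)]
    by (simp add: binomial_gbinomial gbinomial_prod_rev atLeast0LessThan)
  have "(\<Prod>i<?n. real m + real i) = (\<Prod>i<?n. real (m + ?n - 1) - real i)"
    using n0 by (intro prod.reindex_bij_witness[of _ "\<lambda>i. ?n - 1 - i" "\<lambda>i. ?n - 1 - i"]) (auto simp: of_nat_diff)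
  then show "(\<Sum>\<pi> | \<pi> permutes S. real m ^ card (cycles S \<pi>)) = fact ?n * of_nat ((m + ?n - 1) choose ?n)"
    unfolding sum_permutations_power_cycles(1)[OF assms(1)]
    by (simp add: binomial_gbinomial gbinomial_prod_rev atLeast0LessThan)
qed

section \<open>Products of a full cycle and an almost full cycle\<close>

text \<open>Cuts \<open>v\<close> out of its cycle: \<open>v\<close> becomes fixed and its
  predecessor is sent to \<open>\<pi> v\<close>.\<close>

definition remove_point :: "'a \<Rightarrow> ('a \<Rightarrow> 'a) \<Rightarrow> 'a \<Rightarrow> 'a" where
  "remove_point v \<pi> = transpose v (\<pi> v) \<circ> \<pi>"

text \<open>The number of full cycles \<open>\<kappa>\<close> for which
  \<open>\<kappa> \<circ> \<pi>\<close> is again a full cycle, in a form to which the recursion for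
  \<open>full_cycle_sum\<close> applies.\<close>

definition full_cycle_count :: "'a set \<Rightarrow> ('a \<Rightarrow> 'a) \<Rightarrow> real" where
  "full_cycle_count S = full_cycle_sum S (\<lambda>c. if c = 1 then 1 else 0)"

lemma full_cycle_count_insert_fixed:
  assumes "finite S" "x \<notin> S" "S \<noteq> {}" "\<pi> permutes S"
  shows "full_cycle_count (insert x S) \<pi> = card S * full_cycle_count S \<pi>"
  unfolding full_cycle_count_def by (rule full_cycle_sum_insert_fixed[OF assms])

text \<open>In the general recursion the term with \<open>Suc c\<close> would require
  \<open>c = 0\<close>, but \<open>S\<close> contains \<open>p\<close>; only the transpositions
  remain.\<close>

lemma full_cycle_count_insert:
  assumes "finite S" "x \<notin> S" "\<pi> permutes S" "p \<in> S"
  shows "full_cycle_count (insert x S) (transpose x p \<circ> \<pi>) =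
    (\<Sum>a\<in>S - {p}. full_cycle_count S (transpose a p \<circ> \<pi>))"
proof -
  have "card (cycles S \<pi>') \<noteq> 0" for \<pi>'
    using card_cycles_pos[OF assms(1), of \<pi>'] assms(4) by auto
  then have "full_cycle_sum S (\<lambda>c. if Suc c = 1 then 1 else 0) \<pi> = 0"
    unfolding full_cycle_sum_def by (intro sum.neutral ballI) (metis One_nat_def Suc_inject)
  then show ?thesis
    unfolding full_cycle_count_def full_cycle_sum_insert[OF assms] by simp
qed

lemma remove_point_permutes:
  assumes "\<pi> permutes S" "v \<in> S"
  shows "remove_point v \<pi> permutes S - {v}"
  unfolding remove_point_def
  using permutes_insert_lemma[of \<pi> v "S - {v}"] assms by (simp add: insert_absorb)

lemma transpose_image_apply:
  "inj f \<Longrightarrow> transpose (f a) (f b) (f c) = f (transpose a b c)"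
  by (auto simp: Transposition.transpose_def inj_def)

lemma remove_point_comp_left:
  assumes "inj \<tau>" "\<tau> v = v"
  shows "remove_point v (\<tau> \<circ> \<pi>) = \<tau> \<circ> remove_point v \<pi>"
  using transpose_image_apply[OF assms(1), of v] assms(2)
  by (simp add: remove_point_def fun_eq_iff)

lemma cycles_image:
  assumes "inj \<tau>" "\<And>x. \<tau> (\<pi> x) = \<pi>' (\<tau> x)"
  shows "cycles (\<tau> ` S) \<pi>' = (`) \<tau> ` cycles S \<pi>"
proof -
  have "(\<pi>' ^^ n) (\<tau> x) = \<tau> ((\<pi> ^^ n) x)" for n x
    by (induction n) (auto simp: assms(2))
  then have "orbit \<pi>' (\<tau> x) = \<tau> ` orbit \<pi> x" for x
    unfolding orbit_altdef by auto
  then show ?thesis unfolding cycles_def by (simp add: image_image)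
qed

lemma card_cycles_image:
  assumes "inj \<tau>" "\<And>x. \<tau> (\<pi> x) = \<pi>' (\<tau> x)"
  shows "card (cycles (\<tau> ` S) \<pi>') = card (cycles S \<pi>)"
  unfolding cycles_image[of \<tau> \<pi> \<pi>' S, OF assms] using assms(1)
  by (intro card_image) (auto simp: inj_on_def inj_image_eq_iff)

lemma permutes_conj_involution:
  assumes "\<tau> \<circ> \<tau> = id" "\<pi> permutes S"
  shows "\<tau> \<circ> \<pi> \<circ> \<tau> permutes \<tau> ` S"
proof -
  have tt: "\<tau> (\<tau> x) = x" for x using assms(1) by (simp add: fun_eq_iff)
  have inj: "inj \<tau>" by (metis injI tt)
  show ?thesis
  proof (rule bij_imp_permutes)
    have "bij_betw \<tau> S (\<tau> ` S)" "bij_betw \<tau> (\<tau> ` S) S"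
      using inj tt by (auto simp: bij_betw_def inj_on_def image_image)
    then show "bij_betw (\<tau> \<circ> \<pi> \<circ> \<tau>) (\<tau> ` S) (\<tau> ` S)"
      using permutes_imp_bij[OF assms(2)] by (metis bij_betw_trans)
    fix x assume "x \<notin> \<tau> ` S"
    then have "\<tau> x \<notin> S" using tt by (metis imageI)
    then show "(\<tau> \<circ> \<pi> \<circ> \<tau>) x = x" using permutes_not_in[OF assms(2)] tt by simp
  qed
qed

text \<open>The carrier moves along with the permutation. This serves to compare counts on
  \<open>S - {a}\<close> and on \<open>S - {p}\<close>.\<close>

lemma full_cycle_count_conj:
  assumes "\<tau> \<circ> \<tau> = id" "finite S" "\<pi> permutes S"
  shows "full_cycle_count (\<tau> ` S) (\<tau> \<circ> \<pi> \<circ> \<tau>) = full_cycle_count S \<pi>"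
proof -
  have tt: "\<tau> (\<tau> x) = x" for x using assms(1) by (simp add: fun_eq_iff)
  have inj: "inj \<tau>" by (metis injI tt)
  have tts: "\<tau> ` \<tau> ` S = S" by (simp add: image_image tt)
  have conj: "\<tau> \<circ> \<kappa> \<circ> \<tau> \<in> full_cycles (\<tau> ` S)" if "\<kappa> \<in> full_cycles S" for \<kappa> S
    using that permutes_conj_involution[OF assms(1)] card_cycles_image[OF inj, of \<kappa> "\<tau> \<circ> \<kappa> \<circ> \<tau>"]
    by (simp add: full_cycles_def tt)
  show ?thesis
    unfolding full_cycle_count_def full_cycle_sum_def
  proof (rule sum.reindex_bij_witness[of _ "\<lambda>\<kappa>. \<tau> \<circ> \<kappa> \<circ> \<tau>" "\<lambda>\<kappa>. \<tau> \<circ> \<kappa> \<circ> \<tau>"])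
    fix \<kappa> assume "\<kappa> \<in> full_cycles (\<tau> ` S)"
    then show "\<tau> \<circ> \<kappa> \<circ> \<tau> \<in> full_cycles S" using conj[of \<kappa> "\<tau> ` S"] tts by simp
    have "card (cycles (\<tau> ` S) (\<kappa> \<circ> (\<tau> \<circ> \<pi> \<circ> \<tau>))) = card (cycles S (\<tau> \<circ> \<kappa> \<circ> \<tau> \<circ> \<pi>))"
      by (rule card_cycles_image[OF inj]) (simp add: tt)
    then show "(if card (cycles S (\<tau> \<circ> \<kappa> \<circ> \<tau> \<circ> \<pi>)) = 1 then 1 else 0) =
        (if card (cycles (\<tau> ` S) (\<kappa> \<circ> (\<tau> \<circ> \<pi> \<circ> \<tau>))) = 1 then 1 else (0 :: real))"
      by (simp only:)
  qed (auto simp: conj tt fun_eq_iff)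
qed

text \<open>This counts the factorisations of \<open>\<pi>\<close> into a full cycle of
  \<open>U\<close> and a full cycle of some \<open>U - {v}\<close>. In the induction step
  \<open>\<pi> = transpose x p \<circ> \<sigma>\<close>, the terms for \<open>v = x\<close> and
  \<open>v = p\<close> have the same value \<open>B\<close>, and the others add up to
  \<open>M\<close>. The induction hypothesis is applied to every
  \<open>transpose a p \<circ> \<sigma>\<close>, all of which have the sign of \<open>\<pi>\<close>.
  Summed over \<open>a\<close>, the terms with \<open>v = a\<close> give \<open>B\<close>, those
  with \<open>v = p\<close> give \<open>B\<close>, and the rest is \<open>M\<close>.\<close>

lemma sum_full_cycle_count_remove_point:
  assumes "finite U" "2 \<le> card U" "\<pi> permutes U"
  shows "(\<Sum>v | v \<in> U \<and> \<pi> v \<noteq> v. full_cycle_count (U - {v}) (remove_point v \<pi>)) =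
    fact (card U - 2) * (1 - of_int (sign \<pi>))"
  using assms
proof (induction U arbitrary: \<pi> rule: finite_induct)
  case (insert x S)
  let ?\<rho> = full_cycle_count and ?D = remove_point
  let ?n = "card S"
  have n1: "1 \<le> ?n" using insert by simp
  have cardU: "card (insert x S) = Suc ?n" using insert by simp
  show ?case
  proof (cases "\<pi> x = x")
    case True
    then have \<pi>: "\<pi> permutes S" using insert.prems(2) by (auto simp: permutes_def)
    have "(\<Sum>v | v \<in> insert x S \<and> \<pi> v \<noteq> v. ?\<rho> (insert x S - {v}) (?D v \<pi>)) =
        (\<Sum>v | v \<in> S \<and> \<pi> v \<noteq> v. (real ?n - 1) * ?\<rho> (S - {v}) (?D v \<pi>))"
    proof (rule sum.cong)
      show "{v \<in> insert x S. \<pi> v \<noteq> v} = {v \<in> S. \<pi> v \<noteq> v}" using True by auto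
      fix v assume "v \<in> {v \<in> S. \<pi> v \<noteq> v}"
      then have v: "v \<in> S" "\<pi> v \<noteq> v" by auto
      then have "\<pi> v \<in> S - {v}" using permutes_in_image[OF \<pi>] by simp
      then have "S - {v} \<noteq> {}" by blast
      then have "?\<rho> (insert x (S - {v})) (?D v \<pi>) = card (S - {v}) * ?\<rho> (S - {v}) (?D v \<pi>)"
        using insert(1,2) remove_point_permutes[OF \<pi> v(1)] by (intro full_cycle_count_insert_fixed) auto
      moreover have "insert x S - {v} = insert x (S - {v})" using v insert(2) by auto
      moreover have "real (card (S - {v})) = real ?n - 1" using v insert(1) n1 by (simp add: of_nat_diff)
      ultimately show "?\<rho> (insert x S - {v}) (?D v \<pi>) = (real ?n - 1) * ?\<rho> (S - {v}) (?D v \<pi>)" by simp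
    qed
    also have "\<dots> = (real ?n - 1) * (\<Sum>v | v \<in> S \<and> \<pi> v \<noteq> v. ?\<rho> (S - {v}) (?D v \<pi>))"
      by (simp add: sum_distrib_left)
    also have "\<dots> = fact (?n - 1) * (1 - of_int (sign \<pi>))"
    \<comment> \<open>The induction hypothesis asks for two points. With a single one, both
      \<open>?n - 1\<close> and \<open>1 - sign \<pi>\<close> are zero.\<close>
    proof (cases "?n = 1")
      case True
      then obtain y where "S = {y}" by (auto simp: card_1_singleton_iff)
      then have "\<pi> = id" using \<pi> by auto
      with True show ?thesis by simp
    next
      case False
      with n1 obtain m where m: "?n = Suc (Suc m)" by (metis One_nat_def Suc_le_D not0_implies_Suc)
      with insert.IH[OF _ \<pi>] show ?thesis by simp
    qed
    finally show ?thesis using cardU by simp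
  next
    case False
    define p where "p = \<pi> x"
    define \<sigma> where "\<sigma> = transpose x p \<circ> \<pi>"
    have xS: "x \<notin> S" by fact
    have \<sigma>: "\<sigma> permutes S" unfolding \<sigma>_def p_def using permutes_insert_lemma[OF insert.prems(2)] .
    have pS: "p \<in> S" using False insert.prems permutes_in_image[OF insert.prems(2), of x] by (auto simp: p_def)
    have px: "p \<noteq> x" using pS xS by auto
    have \<pi>: "\<pi> = transpose x p \<circ> \<sigma>" unfolding \<sigma>_def by (simp add: fun_eq_iff)
    have perm\<sigma>: "permutation \<sigma>" using \<sigma> insert(1) permutation_permutes by blast
    have sign\<pi>: "sign \<pi> = - sign \<sigma>"
      unfolding \<pi> using px perm\<sigma> by (simp add: sign_compose permutation_swap_id sign_swap_id)
    have inj_tr: "inj (transpose a b)" for a b :: 'a by (rule injI) (metis transpose_involutory)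
    have \<sigma>x: "\<sigma> x = x" using permutes_not_in[OF \<sigma> xS] .
    have \<sigma>S: "\<sigma> v \<in> S" if "v \<in> S" for v using that permutes_in_image[OF \<sigma>] by simp
    have inj\<sigma>: "\<sigma> a = \<sigma> b \<longleftrightarrow> a = b" for a b using permutes_inj[OF \<sigma>] by (auto simp: inj_def)
    have finSv: "finite (S - {v})" for v using insert(1) by simp
    \<comment> \<open>The count for \<open>\<sigma>\<close> on \<open>S\<close> after one more use
      of the recursion, at \<open>p\<close>. The cases are those of the recursion: \<open>p\<close>
      fixed by \<open>\<sigma>\<close> or not.\<close>
    define B where "B = (if \<sigma> p = p then (real ?n - 1) * ?\<rho> (S - {p}) \<sigma>
      else \<Sum>a\<in>S - {p} - {\<sigma> p}. ?\<rho> (S - {p}) (transpose a (\<sigma> p) \<circ> ?D p \<sigma>))"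
    define K where "K v a = ?\<rho> (S - {v}) (?D v (transpose a p \<circ> \<sigma>))" for v a
    define M where "M = (\<Sum>v\<in>S - {p}. \<Sum>a\<in>S - {p}. if \<sigma> v \<noteq> v \<and> v \<noteq> a then K v a else 0)"
    show ?thesis
    proof (cases "?n = 1")
      case True
      then have Sp: "S = {p}" using pS by (auto simp: card_1_singleton_iff)
      then have "\<sigma> = id" using \<sigma> by auto
      then have \<pi>: "\<pi> = transpose x p" using \<pi> by simp
      have one: "?\<rho> {y} id = 1" for y :: 'a
        by (simp add: full_cycle_count_def full_cycle_sum_def full_cycles_singleton cycles_def)
      have "{v. v \<in> insert x S \<and> \<pi> v \<noteq> v} = {x, p}" using Sp px by (auto simp: \<pi>)
      moreover have "?D x \<pi> = id" "?D p \<pi> = id"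
        by (auto simp: remove_point_def \<pi> transpose_commute)
      moreover have "insert x S - {x} = {p}" "insert x S - {p} = {x}" using Sp px by auto
      ultimately show ?thesis
        using px one cardU True by (simp add: \<pi> sign_swap_id)
    next
      case False
      then have n2: "2 \<le> ?n" using n1 by simp
      have Sp0: "S - {p} \<noteq> {}" using False pS insert(1) by (auto simp: subset_singleton_iff)
      have cSp: "real (card (S - {p})) = real ?n - 1" using pS insert(1) n1 by (simp add: of_nat_diff)
      have set_v: "{v. v \<in> insert x S \<and> \<pi> v \<noteq> v} = insert x (insert p {v \<in> S - {p}. \<sigma> v \<noteq> v})"
      proof -
        have "\<pi> x \<noteq> x" "\<pi> p \<noteq> p" using px xS \<sigma>S[OF pS] \<sigma>x by (auto simp: \<pi> Transposition.transpose_def)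
        moreover have "\<pi> v \<noteq> v \<longleftrightarrow> \<sigma> v \<noteq> v" if "v \<in> S - {p}" for v
          using that xS \<sigma>S[of v] by (auto simp: \<pi> Transposition.transpose_def)
        ultimately show ?thesis using pS by auto
      qed
      have term_x: "?\<rho> (insert x S - {x}) (?D x \<pi>) = B"
      proof -
        have "?D x \<pi> = \<sigma>" using \<sigma>x by (simp add: remove_point_def \<pi> fun_eq_iff)
        moreover have "insert x S - {x} = S" using xS by auto
        moreover have Sp: "S = insert p (S - {p})" using pS by auto
        moreover have "?\<rho> (insert p (S - {p})) \<sigma> = B"
        proof (cases "\<sigma> p = p")
          case True
          then have "\<sigma> permutes S - {p}" using \<sigma> by (auto simp: permutes_def)
          then have "?\<rho> (insert p (S - {p})) \<sigma> = card (S - {p}) * ?\<rho> (S - {p}) \<sigma>"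
            by (intro full_cycle_count_insert_fixed finSv Sp0) auto
          then show ?thesis using True cSp by (simp only: B_def if_True simp_thms)
        next
          case False
          have "\<sigma> = transpose p (\<sigma> p) \<circ> ?D p \<sigma>" by (simp add: remove_point_def fun_eq_iff)
          then have "?\<rho> (insert p (S - {p})) \<sigma> = ?\<rho> (insert p (S - {p})) (transpose p (\<sigma> p) \<circ> ?D p \<sigma>)"
            by (rule arg_cong)
          also have "\<dots> = (\<Sum>a\<in>S - {p} - {\<sigma> p}. ?\<rho> (S - {p}) (transpose a (\<sigma> p) \<circ> ?D p \<sigma>))"
            using False \<sigma>S[OF pS] by (intro full_cycle_count_insert finSv remove_point_permutes[OF \<sigma> pS]) auto
          finally show ?thesis using False by (simp add: B_def)
        qed
        ultimately show ?thesis by metis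
      qed
      \<comment> \<open>Cutting \<open>p\<close> out of the cycle leaves \<open>x\<close> in its
        place, so the recursion at \<open>x\<close> gives what the recursion at \<open>p\<close>
        gave for \<open>\<sigma>\<close>.\<close>
      have term_p: "?\<rho> (insert x S - {p}) (?D p \<pi>) = B"
      proof -
        have U: "insert x S - {p} = insert x (S - {p})" using px by auto
        have xSp: "x \<notin> S - {p}" using xS by auto
        show ?thesis
        proof (cases "\<sigma> p = p")
          case True
          then have "\<sigma> permutes S - {p}" using \<sigma> by (auto simp: permutes_def) 
          moreover have "?D p \<pi> = \<sigma>"
            using True by (simp add: remove_point_def \<pi> fun_eq_iff transpose_commute[of p x])
          ultimately show ?thesis
            unfolding U using full_cycle_count_insert_fixed[OF finSv xSp Sp0] True cSp by (simp add: B_def)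
        next
          case False
          have ne: "\<sigma> p \<noteq> x" using \<sigma>S[OF pS] xS by auto
          have "?D p \<pi> = transpose x (\<sigma> p) \<circ> ?D p \<sigma>"
            using False ne px by (auto simp: remove_point_def \<pi> fun_eq_iff Transposition.transpose_def)
          then have "?\<rho> (insert x (S - {p})) (?D p \<pi>) = ?\<rho> (insert x (S - {p})) (transpose x (\<sigma> p) \<circ> ?D p \<sigma>)"
            by (rule arg_cong)
          also have "\<dots> = (\<Sum>a\<in>S - {p} - {\<sigma> p}. ?\<rho> (S - {p}) (transpose a (\<sigma> p) \<circ> ?D p \<sigma>))"
            using False \<sigma>S[OF pS] by (intro full_cycle_count_insert finSv xSp remove_point_permutes[OF \<sigma> pS]) auto
          finally show ?thesis unfolding U using False by (simp add: B_def)
        qed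
      qed
      \<comment> \<open>Removing \<open>v\<close> commutes with the transposition of
        \<open>x\<close> and \<open>p\<close>, so the recursion at \<open>x\<close> applies on
        \<open>S - {v}\<close>; its sum runs over all \<open>a\<close> other than \<open>v\<close>
        and \<open>p\<close>.\<close>
      have term_v: "?\<rho> (insert x S - {v}) (?D v \<pi>) = (\<Sum>a\<in>S - {p}. if v \<noteq> a then K v a else 0)"
        if v: "v \<in> S - {p}" for v
      proof -
        have U: "insert x S - {v} = insert x (S - {v})" using v xS by auto
        have "?D v \<pi> = transpose x p \<circ> ?D v \<sigma>"
          unfolding \<pi> using v xS by (intro remove_point_comp_left inj_tr) (auto simp: Transposition.transpose_def)
        then have "?\<rho> (insert x (S - {v})) (?D v \<pi>) = ?\<rho> (insert x (S - {v})) (transpose x p \<circ> ?D v \<sigma>)"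
          by (rule arg_cong)
        also have "\<dots> = (\<Sum>a\<in>S - {v} - {p}. ?\<rho> (S - {v}) (transpose a p \<circ> ?D v \<sigma>))"
          using v xS pS by (intro full_cycle_count_insert finSv remove_point_permutes[OF \<sigma>]) auto
        also have "\<dots> = (\<Sum>a\<in>S - {v} - {p}. K v a)"
        proof (rule sum.cong[OF refl])
          fix a assume "a \<in> S - {v} - {p}"
          then have "?D v (transpose a p \<circ> \<sigma>) = transpose a p \<circ> ?D v \<sigma>"
            using v by (intro remove_point_comp_left inj_tr) auto
          then show "?\<rho> (S - {v}) (transpose a p \<circ> ?D v \<sigma>) = K v a" by (simp only: K_def)
        qed
        also have "\<dots> = (\<Sum>a\<in>S - {p}. if v \<noteq> a then K v a else 0)"
          using insert(1) by (intro sum.mono_neutral_cong_left) auto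
        finally show ?thesis unfolding U .
      qed
      have "(\<Sum>v | v \<in> insert x S \<and> \<pi> v \<noteq> v. ?\<rho> (insert x S - {v}) (?D v \<pi>)) = B + (B + M)"
      proof -
        have "(\<Sum>v | v \<in> S - {p} \<and> \<sigma> v \<noteq> v. ?\<rho> (insert x S - {v}) (?D v \<pi>)) =
            (\<Sum>v\<in>S - {p}. if \<sigma> v \<noteq> v then \<Sum>a\<in>S - {p}. if v \<noteq> a then K v a else 0 else 0)"
          using insert(1) by (subst sum.inter_filter) (simp, rule sum.cong[OF refl], simp add: term_v)
        also have "\<dots> = M" unfolding M_def by (intro sum.cong) auto
        finally have M: "(\<Sum>v | v \<in> S - {p} \<and> \<sigma> v \<noteq> v. ?\<rho> (insert x S - {v}) (?D v \<pi>)) = M" .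
        have nx: "x \<notin> insert p {v \<in> S - {p}. \<sigma> v \<noteq> v}" and np: "p \<notin> {v \<in> S - {p}. \<sigma> v \<noteq> v}"
          and fin: "finite {v \<in> S - {p}. \<sigma> v \<noteq> v}" using px xS insert(1) by auto
        show ?thesis
          unfolding set_v sum.insert[OF finite.insertI[OF fin] nx] sum.insert[OF fin np] term_x term_p M ..
      qed
      moreover have "fact (?n - 1) * (1 - of_int (sign \<pi>)) = M + (B + B :: real)"
      proof -
        \<comment> \<open>The points \<open>p\<close> and \<open>a\<close> are taken out of the sum:
          \<open>a\<close> is fixed by \<open>transpose a p \<circ> \<sigma>\<close> iff
          \<open>\<sigma> a = p\<close>, and \<open>p\<close> is fixed iff
          \<open>\<sigma> p = a\<close>. At other points being moved means the same as for
          \<open>\<sigma>\<close>.\<close>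
        have IH: "fact (?n - 2) * (1 - of_int (sign \<pi>)) =
            (if \<sigma> a \<noteq> p then K a a else 0) + (if \<sigma> p \<noteq> a then K p a else 0)
            + (\<Sum>v\<in>S - {p}. if \<sigma> v \<noteq> v \<and> v \<noteq> a then K v a else 0)"
          if a: "a \<in> S - {p}" for a
        proof -
          let ?\<tau> = "transpose a p \<circ> \<sigma>"
          have perm: "?\<tau> permutes S" using a pS \<sigma> by (intro permutes_compose permutes_swap_id) auto
          have sgn: "sign ?\<tau> = sign \<pi>"
            unfolding sign\<pi> using a perm\<sigma> by (simp add: sign_compose permutation_swap_id sign_swap_id)
          have "fact (?n - 2) * (1 - of_int (sign \<pi>)) = (\<Sum>v | v \<in> S \<and> ?\<tau> v \<noteq> v. K v a)"
            unfolding K_def insert.IH[OF n2 perm] sgn ..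
          also have "\<dots> = (\<Sum>v\<in>S. if ?\<tau> v \<noteq> v then K v a else 0)"
            using insert(1) by (rule sum.inter_filter)
          also have "\<dots> = (if ?\<tau> p \<noteq> p then K p a else 0) + ((if ?\<tau> a \<noteq> a then K a a else 0) +
              (\<Sum>v\<in>S - {p} - {a}. if ?\<tau> v \<noteq> v then K v a else 0))"
            using insert(1) pS a by (simp add: sum.remove[of S p] sum.remove[of "S - {p}" a])
          also have "?\<tau> p \<noteq> p \<longleftrightarrow> \<sigma> p \<noteq> a" using a by (auto simp: Transposition.transpose_def)
          also have "?\<tau> a \<noteq> a \<longleftrightarrow> \<sigma> a \<noteq> p" using a by (auto simp: Transposition.transpose_def)
          also have "(\<Sum>v\<in>S - {p} - {a}. if ?\<tau> v \<noteq> v then K v a else 0) =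
              (\<Sum>v\<in>S - {p}. if \<sigma> v \<noteq> v \<and> v \<noteq> a then K v a else 0)"
            using insert(1) a
            by (intro sum.mono_neutral_cong_left) (auto simp: Transposition.transpose_def)
          finally show ?thesis by simp
        qed
        have "fact (?n - 1) = ((real ?n - 1) * fact (?n - 2) :: real)"
        proof -
          obtain m where "?n = Suc (Suc m)" using n2 by (metis Suc_1 Suc_le_D add_2_eq_Suc le_Suc_ex)
          then show ?thesis by simp
        qed
        then have "fact (?n - 1) * (1 - of_int (sign \<pi>)) =
            (\<Sum>a\<in>S - {p}. fact (?n - 2) * (1 - of_int (sign \<pi>)) :: real)"
          using cSp by simp
        also have "\<dots> = (\<Sum>a\<in>S - {p}. (if \<sigma> a \<noteq> p then K a a else 0))
            + (\<Sum>a\<in>S - {p}. (if \<sigma> p \<noteq> a then K p a else 0)) + M"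
          unfolding M_def using IH by (subst sum.swap) (simp add: sum.distrib)
        also have "(\<Sum>a\<in>S - {p}. (if \<sigma> p \<noteq> a then K p a else 0)) = B"
        proof (cases "\<sigma> p = p")
          case True
          have Kp: "K p a = ?\<rho> (S - {p}) \<sigma>" if "a \<in> S - {p}" for a
          proof -
            have "?D p (transpose a p \<circ> \<sigma>) = \<sigma>"
              using True that by (simp add: remove_point_def fun_eq_iff transpose_commute[of p a])
            then show ?thesis by (simp only: K_def)
          qed
          have "(\<Sum>a\<in>S - {p}. (if \<sigma> p \<noteq> a then K p a else 0)) = (\<Sum>a\<in>S - {p}. ?\<rho> (S - {p}) \<sigma>)"
            using True by (intro sum.cong refl) (auto simp: Kp)
          then show ?thesis using True cSp by (simp add: B_def)
        next
          case False
          have "K p a = ?\<rho> (S - {p}) (transpose a (\<sigma> p) \<circ> ?D p \<sigma>)" if "a \<in> S - {p} - {\<sigma> p}" for a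
          proof -
            have "?D p (transpose a p \<circ> \<sigma>) = transpose a (\<sigma> p) \<circ> ?D p \<sigma>"
              using False that by (auto simp: remove_point_def fun_eq_iff Transposition.transpose_def)
            then show ?thesis by (simp only: K_def)
          qed
          then have "B = (\<Sum>a\<in>S - {p} - {\<sigma> p}. K p a)" using False by (simp add: B_def)
          also have "\<dots> = (\<Sum>a\<in>S - {p}. (if \<sigma> p \<noteq> a then K p a else 0))"
            using insert(1) by (intro sum.mono_neutral_cong_left) auto
          finally show ?thesis by simp
        qed
        also have "(\<Sum>a\<in>S - {p}. (if \<sigma> a \<noteq> p then K a a else 0)) = B"
        proof -
          \<comment> \<open>Conjugation by \<open>transpose a p\<close> carries
            \<open>S - {a}\<close> to \<open>S - {p}\<close>, so that the diagonal terms live on the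
            same set as those of \<open>B\<close>.\<close>
          have Kaa: "K a a = ?\<rho> (S - {p}) (transpose p (\<sigma> a) \<circ> (\<sigma> \<circ> transpose a p))"
            if a: "a \<in> S - {p}" for a
          proof -
            let ?t = "transpose a p" let ?E = "?D a (?t \<circ> \<sigma>)"
            have "?t ` (S - {a}) = S - {p}"
              using a pS by (auto simp: Transposition.transpose_def image_iff split: if_splits) 
            moreover have "?t \<circ> ?E \<circ> ?t = transpose p (\<sigma> a) \<circ> (\<sigma> \<circ> ?t)"
            proof
              fix y
              have "?t (transpose a (?t (\<sigma> a)) (?t (\<sigma> (?t y)))) = transpose (?t a) (?t (?t (\<sigma> a))) (?t (?t (\<sigma> (?t y))))"
                by (rule transpose_image_apply[OF inj_tr, symmetric])
              then show "(?t \<circ> ?E \<circ> ?t) y = (transpose p (\<sigma> a) \<circ> (\<sigma> \<circ> ?t)) y"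
                by (simp add: remove_point_def)
            qed
            moreover have "?E permutes S - {a}"
              using a pS \<sigma> by (intro remove_point_permutes permutes_compose permutes_swap_id) auto
            ultimately show ?thesis
              using full_cycle_count_conj[OF transpose_comp_involutory finSv, of ?E a a p] by (simp add: K_def)
          qed
          show ?thesis
          proof (cases "\<sigma> p = p")
            case True
            have Ka: "K a a = ?\<rho> (S - {p}) \<sigma> \<and> \<sigma> a \<noteq> p" if a: "a \<in> S - {p}" for a
            proof -
              have "\<sigma> a \<noteq> p" using a True inj\<sigma>[of a p] by auto
              moreover have "transpose p (\<sigma> a) \<circ> (\<sigma> \<circ> transpose a p) = \<sigma>"
              proof
                fix y
                have "\<sigma> (transpose a p y) = transpose p (\<sigma> a) (\<sigma> y)"
                  using transpose_image_apply[OF permutes_inj[OF \<sigma>], of a p y] True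
                  by (simp add: transpose_commute[of p "\<sigma> a"])
                then show "(transpose p (\<sigma> a) \<circ> (\<sigma> \<circ> transpose a p)) y = \<sigma> y" by simp
              qed
              ultimately show ?thesis unfolding Kaa[OF a] by simp
            qed
            have "(\<Sum>a\<in>S - {p}. (if \<sigma> a \<noteq> p then K a a else 0)) = (\<Sum>a\<in>S - {p}. ?\<rho> (S - {p}) \<sigma>)"
              by (intro sum.cong refl) (auto simp: Ka)
            then show ?thesis using True cSp by (simp add: B_def)
          next
            case False
            have "(\<Sum>a\<in>S - {p}. (if \<sigma> a \<noteq> p then K a a else 0)) =
                (\<Sum>a | a \<in> S - {p} \<and> \<sigma> a \<noteq> p. ?\<rho> (S - {p}) (transpose (\<sigma> a) (\<sigma> p) \<circ> ?D p \<sigma>))"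
            proof -
              have Kab: "K a a = ?\<rho> (S - {p}) (transpose (\<sigma> a) (\<sigma> p) \<circ> ?D p \<sigma>)"
                if a: "a \<in> S - {p}" "\<sigma> a \<noteq> p" for a
              proof -
                have ne: "\<sigma> a \<noteq> \<sigma> p" using a inj\<sigma>[of a p] by auto
                have "\<sigma> \<circ> transpose a p = transpose (\<sigma> a) (\<sigma> p) \<circ> \<sigma>"
                  using transpose_image_apply[OF permutes_inj[OF \<sigma>], of a p] by (simp add: fun_eq_iff)
                moreover have "transpose p (\<sigma> a) \<circ> transpose (\<sigma> a) (\<sigma> p) = transpose (\<sigma> a) (\<sigma> p) \<circ> transpose p (\<sigma> p)"
                  using ne False a(2) by (auto simp: fun_eq_iff Transposition.transpose_def)
                ultimately have "transpose p (\<sigma> a) \<circ> (\<sigma> \<circ> transpose a p) = transpose (\<sigma> a) (\<sigma> p) \<circ> ?D p \<sigma>"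
                  by (simp only: remove_point_def comp_assoc[symmetric])
                then show ?thesis unfolding Kaa[OF a(1)] by (rule arg_cong)
              qed
              show ?thesis
                using insert(1) by (subst sum.inter_filter) (simp, rule sum.cong[OF refl], simp add: Kab)
            qed
            \<comment> \<open>With \<open>b = \<sigma> a\<close> the excluded cases
              \<open>a = p\<close> and \<open>\<sigma> a = p\<close> become
              \<open>b = \<sigma> p\<close> and \<open>b = p\<close>.\<close>
            also have "\<dots> = (\<Sum>b\<in>\<sigma> ` {a. a \<in> S - {p} \<and> \<sigma> a \<noteq> p}. ?\<rho> (S - {p}) (transpose b (\<sigma> p) \<circ> ?D p \<sigma>))"
              by (subst sum.reindex) (auto simp: inj_on_def inj\<sigma>)
            also have "\<sigma> ` {a. a \<in> S - {p} \<and> \<sigma> a \<noteq> p} = S - {p} - {\<sigma> p}"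
            proof -
              have "b \<in> \<sigma> ` S" if "b \<in> S" for b using that permutes_image[OF \<sigma>] by simp
              then show ?thesis using \<sigma>S inj\<sigma> by (auto simp: image_iff)
            qed
            also have "(\<Sum>b\<in>S - {p} - {\<sigma> p}. ?\<rho> (S - {p}) (transpose b (\<sigma> p) \<circ> ?D p \<sigma>)) = B"
              by (simp only: B_def False if_False)
            finally show ?thesis .
          qed
        qed
        finally show ?thesis by simp
      qed
      ultimately show ?thesis using cardU by simp
    qed
  qed
qed simp

section \<open>Parity and equidistribution of the products\<close>

text \<open>Each inserted point adds one transposition. The proof phrases the claim as the vanishing
  of a sum over exceptions, so that the recursion for sums over full cycles carries the
  induction.\<close>

lemma sign_full_cycle:
  assumes "finite S" "S \<noteq> {}" "\<kappa> \<in> full_cycles S"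
  shows "sign \<kappa> = (- 1) ^ (card S - 1)"
proof -
  have "(\<Sum>\<kappa>\<in>full_cycles S. if sign \<kappa> = (- 1) ^ (card S - 1) then 0 else 1 :: nat) = 0"
    using assms(1,2)
  proof (induction S rule: finite_ne_induct)
    case (singleton x)
    then show ?case by (simp add: full_cycles_singleton)
  next
    case (insert x S)
    have step: "sign (transpose x a \<circ> \<kappa>) = - sign \<kappa>" if "a \<in> S" "\<kappa> \<in> full_cycles S" for a \<kappa>
    proof -
      have "permutation \<kappa>" using insert(1) full_cycles_permutes[OF that(2)] permutation_permutes by blast
      then show ?thesis using that(1) insert(3)
        by (auto simp: sign_compose permutation_swap_id sign_swap_id)
    qed
    have "card S \<noteq> 0" using insert(1,2) by simp
    then have "(- 1) ^ (card (insert x S) - 1) = - ((- 1) ^ (card S - 1) :: int)"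
      using insert(1,3) by (cases "card S") simp_all
    then have "(\<Sum>\<kappa>\<in>full_cycles (insert x S). if sign \<kappa> = (- 1) ^ (card (insert x S) - 1) then 0 else 1 :: nat) =
        (\<Sum>a\<in>S. \<Sum>\<kappa>\<in>full_cycles S. if sign \<kappa> = (- 1) ^ (card S - 1) then 0 else 1 :: nat)"
      unfolding sum_full_cycles_insert[OF insert(1,3,2)] using step by (intro sum.cong) auto
    then show ?case using insert.IH by simp
  qed
  then show ?thesis using assms by (auto split: if_splits)
qed

lemma card_full_cycles:
  assumes "finite S" "S \<noteq> {}"
  shows "card (full_cycles S) = fact (card S - 1)"
  using assms
proof (induction S rule: finite_ne_induct)
  case (insert x S)
  have "card (full_cycles (insert x S)) = (\<Sum>\<kappa>\<in>full_cycles (insert x S). 1)" by simp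
  also have "\<dots> = card S * fact (card S - 1)"
    unfolding sum_full_cycles_insert[OF insert(1,3,2)] using insert.IH by simp
  also have "\<dots> = fact (card S)"
  proof -
    have "card S \<noteq> 0" using insert(1,2) by simp
    then show ?thesis by (cases "card S") simp_all
  qed
  finally show ?case using insert by simp
qed (simp add: full_cycles_singleton)

text \<open>Write \<open>\<sigma>\<close> as
  \<open>transpose v (\<sigma> v) \<circ> remove_point v \<sigma>\<close>. Both
  \<open>\<kappa>\<close> and the second factor fix \<open>v\<close>, and for
  \<open>\<sigma> v \<noteq> v\<close> the transposition inserts \<open>v\<close> into a cycle
  without changing the number of cycles. If \<open>\<sigma>\<close> fixes \<open>v\<close>, so does
  the product, which then has a second cycle.\<close>

lemma card_cycles_full_cycle_comp:
  assumes "finite U" "v \<in> U" "2 \<le> card U" "\<sigma> permutes U" "\<kappa> \<in> full_cycles (U - {v})"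
  shows "\<sigma> \<circ> \<kappa> \<in> full_cycles U \<longleftrightarrow>
    \<sigma> v \<noteq> v \<and> card (cycles (U - {v}) (\<kappa> \<circ> remove_point v \<sigma>)) = 1"
proof -
  let ?S = "U - {v}"
  have finS: "finite ?S" using assms(1) by simp
  have U: "U = insert v ?S" and vS: "v \<notin> ?S" using assms(2) by auto
  have "card ?S \<noteq> 0" using assms(1-3) by simp
  then have S0: "?S \<noteq> {}" by (metis card.empty)
  have \<kappa>: "\<kappa> permutes ?S" using full_cycles_permutes[OF assms(5)] .
  have "\<kappa> permutes U" using \<kappa> by (rule permutes_subset) auto
  then have perm: "\<sigma> \<circ> \<kappa> permutes U" using assms(4) by (rule permutes_compose)
  show ?thesis
  proof (cases "\<sigma> v = v")
    case True
    then have "\<sigma> permutes ?S" using assms(4) by (auto simp: permutes_def)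
    then have "\<sigma> \<circ> \<kappa> permutes ?S" using \<kappa> by (intro permutes_compose)
    from card_cycles_insert_fixed[OF finS this vS]
    have "card (cycles U (\<sigma> \<circ> \<kappa>)) = Suc (card (cycles ?S (\<sigma> \<circ> \<kappa>)))" unfolding U[symmetric] .
    then show ?thesis
      using True card_cycles_pos[OF finS S0, of "\<sigma> \<circ> \<kappa>"] by (simp add: full_cycles_def)
  next
    case False
    have \<rho>: "remove_point v \<sigma> permutes ?S" by (rule remove_point_permutes[OF assms(4,2)])
    have p: "\<sigma> v \<in> ?S" using False assms(2) permutes_in_image[OF assms(4)] by simp
    have "remove_point v \<sigma> \<circ> \<kappa> permutes ?S" using \<kappa> \<rho> by (rule permutes_compose)
    from card_cycles_transpose_comp_insert[OF finS this vS p]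
    have "card (cycles U (transpose v (\<sigma> v) \<circ> (remove_point v \<sigma> \<circ> \<kappa>))) =
        card (cycles ?S (remove_point v \<sigma> \<circ> \<kappa>))"
      unfolding U[symmetric] .
    moreover have "transpose v (\<sigma> v) \<circ> (remove_point v \<sigma> \<circ> \<kappa>) = \<sigma> \<circ> \<kappa>"
      by (simp add: remove_point_def fun_eq_iff)
    ultimately have "card (cycles U (\<sigma> \<circ> \<kappa>)) = card (cycles ?S (\<kappa> \<circ> remove_point v \<sigma>))"
      using card_cycles_comp_commute[OF finS \<rho> \<kappa>] by metis
    then show ?thesis using False perm unfolding full_cycles_def by simp
  qed
qed

text \<open>Sorting the triple sum by the product \<open>\<sigma>\<close> leaves for each
  \<open>\<sigma>\<close> the number of its factorisations. As \<open>1 - sign \<sigma>\<close> is 2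
  or 0, all odd permutations occur equally often and even ones never.\<close>

lemma sum_full_cycle_comp_almost_full_cycle:
  fixes f :: "('a \<Rightarrow> 'a) \<Rightarrow> real"
  assumes "finite U" "2 \<le> card U"
  shows "(\<Sum>v\<in>U. \<Sum>\<kappa>'\<in>full_cycles (U - {v}). \<Sum>\<kappa>\<in>full_cycles U. f (\<kappa> \<circ> \<kappa>')) =
    fact (card U - 2) * (\<Sum>\<sigma> | \<sigma> permutes U. (1 - of_int (sign \<sigma>)) * f \<sigma>)"
proof -
  let ?P = "{\<sigma>. \<sigma> permutes U}"
  let ?I = "\<lambda>\<sigma>. if \<sigma> \<in> full_cycles U then 1 else 0 :: real"
  have finP: "finite ?P" using assms(1) by (rule finite_permutations)
  have eq: "(\<Sum>\<kappa>\<in>full_cycles U. f (\<kappa> \<circ> \<kappa>')) = (\<Sum>\<sigma>\<in>?P. ?I (\<sigma> \<circ> inv_into UNIV \<kappa>') * f \<sigma>)"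
    if "v \<in> U" "\<kappa>' \<in> full_cycles (U - {v})" for v \<kappa>'
  proof -
    have \<kappa>': "\<kappa>' permutes U" using full_cycles_permutes[OF that(2)] by (rule permutes_subset) auto
    have inv: "(\<sigma> \<circ> \<kappa>') \<circ> inv_into UNIV \<kappa>' = \<sigma>" for \<sigma>
      unfolding comp_assoc permutes_inv_o(1)[OF \<kappa>'] by simp
    have "(\<Sum>\<sigma>\<in>?P. ?I (\<sigma> \<circ> inv_into UNIV \<kappa>') * f \<sigma>) = (\<Sum>\<sigma>\<in>?P. ?I \<sigma> * f (\<sigma> \<circ> \<kappa>'))"
      unfolding sum_permutations_compose_right[OF \<kappa>', of "\<lambda>\<sigma>. ?I (\<sigma> \<circ> inv_into UNIV \<kappa>') * f \<sigma>"] inv ..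
    also have "\<dots> = (\<Sum>\<sigma>\<in>full_cycles U. f (\<sigma> \<circ> \<kappa>'))"
      using finP by (intro sum.mono_neutral_cong_right) (auto simp: full_cycles_permutes)
    finally show ?thesis by simp
  qed
  have "(\<Sum>v\<in>U. \<Sum>\<kappa>'\<in>full_cycles (U - {v}). \<Sum>\<kappa>\<in>full_cycles U. f (\<kappa> \<circ> \<kappa>')) =
      (\<Sum>v\<in>U. \<Sum>\<kappa>'\<in>full_cycles (U - {v}). \<Sum>\<sigma>\<in>?P. ?I (\<sigma> \<circ> inv_into UNIV \<kappa>') * f \<sigma>)"
    by (rule sum.cong[OF refl], rule sum.cong[OF refl]) (rule eq)
  also have "\<dots> = (\<Sum>v\<in>U. \<Sum>\<sigma>\<in>?P. (\<Sum>\<kappa>'\<in>full_cycles (U - {v}). ?I (\<sigma> \<circ> inv_into UNIV \<kappa>')) * f \<sigma>)"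
    by (subst sum.swap) (simp add: sum_distrib_right)
  \<comment> \<open>The full cycles of \<open>U - {v}\<close> are closed under inversion.\<close>
  also have "\<dots> = (\<Sum>v\<in>U. \<Sum>\<sigma>\<in>?P. (\<Sum>\<kappa>'\<in>full_cycles (U - {v}). ?I (\<sigma> \<circ> \<kappa>')) * f \<sigma>)"
  proof -
    have "(\<Sum>\<kappa>'\<in>full_cycles (U - {v}). ?I (\<sigma> \<circ> inv_into UNIV \<kappa>')) =
        (\<Sum>\<kappa>'\<in>full_cycles (U - {v}). ?I (\<sigma> \<circ> \<kappa>'))" for v \<sigma>
      by (rule sum_full_cycles_inv[where f = "\<lambda>\<kappa>. ?I (\<sigma> \<circ> \<kappa>)"]) (use assms(1) in simp)
    then show ?thesis by simp
  qed
  also have "\<dots> = (\<Sum>v\<in>U. \<Sum>\<sigma>\<in>?P.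
      (if \<sigma> v \<noteq> v then full_cycle_count (U - {v}) (remove_point v \<sigma>) else 0) * f \<sigma>)"
  proof (intro sum.cong refl)
    fix v \<sigma> assume v: "v \<in> U" and "\<sigma> \<in> ?P"
    then have "\<sigma> permutes U" by simp
    then have "(\<Sum>\<kappa>'\<in>full_cycles (U - {v}). ?I (\<sigma> \<circ> \<kappa>')) = (\<Sum>\<kappa>'\<in>full_cycles (U - {v}).
        if \<sigma> v \<noteq> v \<and> card (cycles (U - {v}) (\<kappa>' \<circ> remove_point v \<sigma>)) = 1 then 1 else 0)"
      using card_cycles_full_cycle_comp[OF assms(1) v assms(2)] by (intro sum.cong refl) simp
    also have "\<dots> = (if \<sigma> v \<noteq> v then full_cycle_count (U - {v}) (remove_point v \<sigma>) else 0)"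
      by (simp add: full_cycle_count_def full_cycle_sum_def)
    finally show "(\<Sum>\<kappa>'\<in>full_cycles (U - {v}). ?I (\<sigma> \<circ> \<kappa>')) * f \<sigma> =
        (if \<sigma> v \<noteq> v then full_cycle_count (U - {v}) (remove_point v \<sigma>) else 0) * f \<sigma>" by simp
  qed
  also have "\<dots> = (\<Sum>\<sigma>\<in>?P. (\<Sum>v\<in>U. if \<sigma> v \<noteq> v then full_cycle_count (U - {v}) (remove_point v \<sigma>) else 0) * f \<sigma>)"
    by (subst sum.swap) (simp add: sum_distrib_right)
  also have "\<dots> = (\<Sum>\<sigma>\<in>?P. fact (card U - 2) * (1 - of_int (sign \<sigma>)) * f \<sigma>)"
  proof (rule sum.cong[OF refl])
    fix \<sigma> assume "\<sigma> \<in> ?P"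
    then have "\<sigma> permutes U" by simp
    from sum_full_cycle_count_remove_point[OF assms this]
    show "(\<Sum>v\<in>U. if \<sigma> v \<noteq> v then full_cycle_count (U - {v}) (remove_point v \<sigma>) else 0) * f \<sigma> =
        fact (card U - 2) * (1 - of_int (sign \<sigma>)) * f \<sigma>"
      using assms(1) by (simp add: sum.inter_filter)
  qed
  finally show ?thesis by (simp add: sum_distrib_left mult.assoc)
qed

text \<open>Since \<open>sign \<sigma> = sign (\<sigma> \<circ> \<pi>) * sign \<pi>\<close>, taking
  \<open>\<sigma> \<circ> \<pi>\<close> as the new variable decouples the sums: one product for the
  trivial character and, with factor \<open>\<epsilon>\<close>, one for the sign character.\<close>

lemma sum_parity_power_cycles:
  assumes "finite S" "S \<noteq> {}"
  defines "n \<equiv> card S"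
  shows "(\<Sum>\<sigma> | \<sigma> permutes S. (1 + \<epsilon> * of_int (sign \<sigma>)) *
      (\<Sum>\<pi> | \<pi> permutes S. real m ^ card (cycles S \<pi>) * real l ^ card (cycles S (\<sigma> \<circ> \<pi>)))) =
    fact n ^ 2 * (of_nat ((m + n - 1) choose n) * of_nat ((l + n - 1) choose n)
      + \<epsilon> * (of_nat (m choose n) * of_nat (l choose n)))"
proof -
  let ?P = "{\<sigma>. \<sigma> permutes S}" and ?c = "\<lambda>\<pi>. card (cycles S \<pi>)"
  have inner: "(\<Sum>\<sigma>\<in>?P. (1 + \<epsilon> * of_int (sign \<sigma>)) * (real m ^ ?c \<pi> * real l ^ ?c (\<sigma> \<circ> \<pi>))) =
      (\<Sum>\<sigma>\<in>?P. real m ^ ?c \<pi> * real l ^ ?c \<sigma>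
        + \<epsilon> * ((of_int (sign \<pi>) * real m ^ ?c \<pi>) * (of_int (sign \<sigma>) * real l ^ ?c \<sigma>)))"
    if "\<pi> \<in> ?P" for \<pi>
  proof -
    have \<pi>: "\<pi> permutes S" using that by simp
    have perm: "permutation \<sigma>" if "\<sigma> \<in> ?P" for \<sigma>
      using that assms(1) permutation_permutes by blast
    have "(1 + \<epsilon> * of_int (sign \<sigma>)) * (real m ^ ?c \<pi> * real l ^ ?c (\<sigma> \<circ> \<pi>)) =
        (1 + \<epsilon> * of_int (sign (\<sigma> \<circ> \<pi>) * sign \<pi>)) * (real m ^ ?c \<pi> * real l ^ ?c (\<sigma> \<circ> \<pi>))" if "\<sigma> \<in> ?P" for \<sigma>
      by (simp add: sign_compose[OF perm[OF that] perm[OF \<open>\<pi> \<in> ?P\<close>]] mult.assoc)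
    then have "(\<Sum>\<sigma>\<in>?P. (1 + \<epsilon> * of_int (sign \<sigma>)) * (real m ^ ?c \<pi> * real l ^ ?c (\<sigma> \<circ> \<pi>))) =
        (\<Sum>\<sigma>\<in>?P. (1 + \<epsilon> * of_int (sign (\<sigma> \<circ> \<pi>) * sign \<pi>)) * (real m ^ ?c \<pi> * real l ^ ?c (\<sigma> \<circ> \<pi>)))"
      by (intro sum.cong refl)
    also have "\<dots> = (\<Sum>\<sigma>\<in>?P. (1 + \<epsilon> * of_int (sign \<sigma> * sign \<pi>)) * (real m ^ ?c \<pi> * real l ^ ?c \<sigma>))"
      by (rule sum_permutations_compose_right[OF \<pi>, symmetric])
    also have "\<dots> = (\<Sum>\<sigma>\<in>?P. real m ^ ?c \<pi> * real l ^ ?c \<sigma>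
        + \<epsilon> * ((of_int (sign \<pi>) * real m ^ ?c \<pi>) * (of_int (sign \<sigma>) * real l ^ ?c \<sigma>)))"
      by (intro sum.cong refl) (simp add: algebra_simps)
    finally show ?thesis .
  qed
  have "(\<Sum>\<sigma>\<in>?P. (1 + \<epsilon> * of_int (sign \<sigma>)) * (\<Sum>\<pi>\<in>?P. real m ^ ?c \<pi> * real l ^ ?c (\<sigma> \<circ> \<pi>))) =
      (\<Sum>\<pi>\<in>?P. \<Sum>\<sigma>\<in>?P. (1 + \<epsilon> * of_int (sign \<sigma>)) * (real m ^ ?c \<pi> * real l ^ ?c (\<sigma> \<circ> \<pi>)))"
    by (subst sum.swap) (simp add: sum_distrib_left)
  also have "\<dots> = (\<Sum>\<pi>\<in>?P. \<Sum>\<sigma>\<in>?P. real m ^ ?c \<pi> * real l ^ ?c \<sigma>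
        + \<epsilon> * ((of_int (sign \<pi>) * real m ^ ?c \<pi>) * (of_int (sign \<sigma>) * real l ^ ?c \<sigma>)))"
    by (rule sum.cong[OF refl inner])
  also have "\<dots> = (\<Sum>\<pi>\<in>?P. real m ^ ?c \<pi>) * (\<Sum>\<pi>\<in>?P. real l ^ ?c \<pi>) + \<epsilon> *
      ((\<Sum>\<pi>\<in>?P. of_int (sign \<pi>) * real m ^ ?c \<pi>) * (\<Sum>\<pi>\<in>?P. of_int (sign \<pi>) * real l ^ ?c \<pi>))"
    unfolding sum.distrib sum_distrib_left[of \<epsilon>, symmetric] sum_product ..
  finally show ?thesis
    unfolding sum_permutations_power_cycles_nat[OF assms(1,2)] n_def
    by (simp add: power2_eq_square algebra_simps)
qed

lemma sum_shift_parity: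
  fixes g :: "('a \<Rightarrow> 'a) \<Rightarrow> real"
  assumes "finite S" "\<tau> permutes S" "\<upsilon> permutes S" "sign \<tau> * sign \<upsilon> = -1"
  shows "(\<Sum>\<sigma> | \<sigma> permutes S. (1 - of_int (sign \<sigma>)) * g (\<tau> \<circ> \<sigma> \<circ> \<upsilon>)) =
    (\<Sum>\<sigma> | \<sigma> permutes S. (1 + of_int (sign \<sigma>)) * g \<sigma>)"
proof -
  let ?P = "{\<sigma>. \<sigma> permutes S}"
  have perm: "permutation \<sigma>" if "\<sigma> permutes S" for \<sigma>
    using that assms(1) permutation_permutes by blast
  have "sign (\<tau> \<circ> \<sigma> \<circ> \<upsilon>) = - sign \<sigma>" if "\<sigma> permutes S" for \<sigma>
  proof -
    have "sign (\<tau> \<circ> \<sigma> \<circ> \<upsilon>) = (sign \<tau> * sign \<upsilon>) * sign \<sigma>"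
      using perm[OF assms(2)] perm[OF assms(3)] perm[OF that] by (simp add: sign_compose permutation_compose)
    then show ?thesis using assms(4) by simp
  qed
  then have "(\<Sum>\<sigma>\<in>?P. (1 - of_int (sign \<sigma>)) * g (\<tau> \<circ> \<sigma> \<circ> \<upsilon>)) =
      (\<Sum>\<sigma>\<in>?P. (1 + of_int (sign (\<tau> \<circ> \<sigma> \<circ> \<upsilon>))) * g (\<tau> \<circ> \<sigma> \<circ> \<upsilon>))"
    by (intro sum.cong refl) simp
  also have "\<dots> = (\<Sum>\<sigma>\<in>?P. (1 + of_int (sign (\<sigma> \<circ> \<upsilon>))) * g (\<sigma> \<circ> \<upsilon>))"
    by (rule setum_permutations_compose_left[OF assms(2), symmetric])
  also have "\<dots> = (\<Sum>\<sigma>\<in>?P. (1 + of_int (sign \<sigma>)) * g \<sigma>)"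
    by (rule sum_permutations_compose_right[OF assms(3), symmetric])
  finally show ?thesis .
qed

text \<open>For fixed outer factors \<open>\<kappa>\<close> and \<open>\<rho>'\<close> the middle
  product \<open>\<kappa>' \<circ> \<rho>\<close> is equidistributed on the odd permutations. The
  outer factors are cycles of lengths differing by one, hence of opposite parity, and move this
  distribution to the even permutations. With \<open>n = card U\<close> the constant is
  \<open>(n - 1)!\<close> for \<open>\<kappa>\<close> times \<open>n (n - 2)!\<close> for
  \<open>\<rho>'\<close> times the \<open>(n - 2)!\<close> of the middle product.\<close>

lemma sum_four_cycles:
  fixes g :: "('a \<Rightarrow> 'a) \<Rightarrow> real"
  assumes "finite U" "2 \<le> card U"
  shows "(\<Sum>v'\<in>U. \<Sum>\<rho>'\<in>full_cycles (U - {v'}). \<Sum>v\<in>U. \<Sum>\<rho>\<in>full_cycles (U - {v}).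
      \<Sum>\<kappa>'\<in>full_cycles U. \<Sum>\<kappa>\<in>full_cycles U. g (\<kappa> \<circ> (\<kappa>' \<circ> (\<rho> \<circ> \<rho>')))) =
    fact (card U) * fact (card U - 2) ^ 2 * (\<Sum>\<sigma> | \<sigma> permutes U. (1 + of_int (sign \<sigma>)) * g \<sigma>)"
proof -
  let ?C = "full_cycles U" and ?R = "\<lambda>v. full_cycles (U - {v})"
  let ?E = "\<Sum>\<sigma> | \<sigma> permutes U. (1 + of_int (sign \<sigma>)) * g \<sigma>"
  have cv: "card (U - {v}) = card U - 1" "finite (U - {v})" "U - {v} \<noteq> {}" if "v \<in> U" for v
  proof -
    show c: "card (U - {v}) = card U - 1" "finite (U - {v})" using that assms by auto
    show "U - {v} \<noteq> {}"
    proof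
      assume "U - {v} = {}"
      then have "card (U - {v}) = 0" by (metis card.empty)
      with c assms(2) show False by simp
    qed
  qed
  have U0: "U \<noteq> {}" using assms by auto
  have sgn: "sign \<kappa> * sign \<rho> = -1" if "\<kappa> \<in> ?C" "v \<in> U" "\<rho> \<in> ?R v" for \<kappa> \<rho> v
  proof -
    obtain k where k: "card U = Suc (Suc k)" using assms(2) by (metis add_2_eq_Suc le_Suc_ex)
    have "sign \<kappa> = (- 1) ^ Suc k" "sign \<rho> = (- 1) ^ k"
      using sign_full_cycle[OF assms(1) U0 that(1)] sign_full_cycle[OF cv(2,3)[OF that(2)] that(3)] cv(1)[OF that(2)] k
      by simp_all
    then show ?thesis by (simp flip: power_add mult_2)
  qed
  have inner: "(\<Sum>v\<in>U. \<Sum>\<rho>\<in>?R v. \<Sum>\<kappa>'\<in>?C. \<Sum>\<kappa>\<in>?C. g (\<kappa> \<circ> (\<kappa>' \<circ> (\<rho> \<circ> \<rho>')))) =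
      real (card ?C) * (fact (card U - 2) * ?E)" if a: "v' \<in> U" "\<rho>' \<in> ?R v'" for v' \<rho>'
  proof -
    have \<rho>': "\<rho>' permutes U" using full_cycles_permutes[OF a(2)] by (rule permutes_subset) auto
    \<comment> \<open>The range of \<open>\<rho>\<close> depends on \<open>v\<close>; passing to
      pairs makes the index sets independent, as exchanging the sums requires.\<close>
    have pairs: "(\<Sum>v\<in>U. \<Sum>\<rho>\<in>?R v. h \<rho>) = (\<Sum>z\<in>Sigma U ?R. h (snd z))"
      for h :: "('a \<Rightarrow> 'a) \<Rightarrow> real"
      using assms(1) by (simp add: sum.Sigma case_prod_beta)
    define F where "F \<kappa> \<kappa>' \<rho> = g (\<kappa> \<circ> (\<kappa>' \<circ> \<rho>) \<circ> \<rho>')" for \<kappa> \<kappa>' \<rho> :: "'a \<Rightarrow> 'a"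
    have "(\<Sum>v\<in>U. \<Sum>\<rho>\<in>?R v. \<Sum>\<kappa>'\<in>?C. \<Sum>\<kappa>\<in>?C. g (\<kappa> \<circ> (\<kappa>' \<circ> (\<rho> \<circ> \<rho>')))) =
        (\<Sum>z\<in>Sigma U ?R. \<Sum>\<kappa>'\<in>?C. \<Sum>\<kappa>\<in>?C. F \<kappa> \<kappa>' (snd z))"
      unfolding F_def by (simp only: pairs comp_assoc)
    also have "\<dots> = (\<Sum>z\<in>Sigma U ?R. \<Sum>\<kappa>\<in>?C. \<Sum>\<kappa>'\<in>?C. F \<kappa> \<kappa>' (snd z))"
      by (rule sum.cong[OF refl], rule sum.swap)
    also have "\<dots> = (\<Sum>\<kappa>\<in>?C. \<Sum>z\<in>Sigma U ?R. \<Sum>\<kappa>'\<in>?C. F \<kappa> \<kappa>' (snd z))"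
      by (rule sum.swap)
    also have "\<dots> = (\<Sum>\<kappa>\<in>?C. \<Sum>v\<in>U. \<Sum>\<rho>\<in>?R v. \<Sum>\<kappa>'\<in>?C. F \<kappa> \<kappa>' \<rho>)"
      by (simp only: pairs)
    also have "\<dots> = (\<Sum>\<kappa>\<in>?C. fact (card U - 2) * ?E)"
    proof (rule sum.cong[OF refl])
      fix \<kappa> assume \<kappa>: "\<kappa> \<in> ?C"
      show "(\<Sum>v\<in>U. \<Sum>\<rho>\<in>?R v. \<Sum>\<kappa>'\<in>?C. F \<kappa> \<kappa>' \<rho>) = fact (card U - 2) * ?E"
        unfolding F_def sum_full_cycle_comp_almost_full_cycle[OF assms, of "\<lambda>\<sigma>. g (\<kappa> \<circ> \<sigma> \<circ> \<rho>')"]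
          sum_shift_parity[OF assms(1) full_cycles_permutes[OF \<kappa>] \<rho>' sgn[OF \<kappa> a], of g] ..
    qed
    finally show ?thesis by simp
  qed
  have "(\<Sum>v'\<in>U. \<Sum>\<rho>'\<in>?R v'. \<Sum>v\<in>U. \<Sum>\<rho>\<in>?R v. \<Sum>\<kappa>'\<in>?C. \<Sum>\<kappa>\<in>?C. g (\<kappa> \<circ> (\<kappa>' \<circ> (\<rho> \<circ> \<rho>')))) =
      (\<Sum>v'\<in>U. \<Sum>\<rho>'\<in>?R v'. real (card ?C) * (fact (card U - 2) * ?E))"
    by (rule sum.cong[OF refl], rule sum.cong[OF refl], rule inner)
  also have "\<dots> = real (card ?C) * (\<Sum>v'\<in>U. real (card (?R v'))) * (fact (card U - 2) * ?E)"
  proof -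
    have "(\<Sum>v'\<in>U. \<Sum>\<rho>'\<in>?R v'. real (card ?C) * c) =
        real (card ?C) * (\<Sum>v'\<in>U. real (card (?R v'))) * c" for c :: real
      by (simp add: sum_distrib_right sum_distrib_left ac_simps)
    then show ?thesis .
  qed
  also have "(\<Sum>v'\<in>U. real (card (?R v'))) = real (card U) * fact (card U - 2)"
  proof -
    have "card (?R v') = fact (card U - 2)" if "v' \<in> U" for v'
      using card_full_cycles[OF cv(2,3)[OF that]] cv(1)[OF that] by (simp add: numeral_2_eq_2)
    then show ?thesis by simp
  qed
  also have "real (card ?C) * (real (card U) * fact (card U - 2)) * (fact (card U - 2) * ?E) =
      (real (card U) * fact (card U - 1)) * fact (card U - 2) ^ 2 * ?E"
    unfolding card_full_cycles[OF assms(1) U0] by (simp add: power2_eq_square)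
  also have "real (card U) * fact (card U - 1) = fact (card U)"
    using assms by (simp add: fact_reduce)
  finally show ?thesis .
qed

section \<open>Signed permutations\<close>

text \<open>Extensional functions, so that the set is finite and a matrix determines its sign
  function.\<close>

definition signs :: "nat \<Rightarrow> (nat \<Rightarrow> int) set" where
  "signs N = (\<Pi>\<^sub>E i\<in>{..<N}. {1, -1})"

text \<open>The signs belong to columns, \<open>e j\<close> being the nonzero entry of column
  \<open>j\<close>, whereas \<open>signed_perm_decomp\<close> attaches them to rows. With columns,
  the sign of a cycle is the product of \<open>e\<close> over its points.\<close>

definition signed_perm_mat :: "nat \<Rightarrow> (nat \<Rightarrow> int) \<Rightarrow> (nat \<Rightarrow> nat) \<Rightarrow> int mat" where
  "signed_perm_mat N e \<pi> = Matrix.mat N N (\<lambda>(i, j). if i = \<pi> j then e j else 0)"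

lemma finite_signs [simp]: "finite (signs N)"
  unfolding signs_def by (intro finite_PiE) auto

lemma signs_pm: "\<lbrakk>e \<in> signs N; i < N\<rbrakk> \<Longrightarrow> e i = 1 \<or> e i = -1"
  by (auto simp: signs_def PiE_def Pi_def)

lemma restrict_in_signs: "(\<And>i. i < N \<Longrightarrow> f i = 1 \<or> f i = -1) \<Longrightarrow> restrict f {..<N} \<in> signs N"
  unfolding signs_def by (rule restrict_PiE_iff[THEN iffD2]) auto

lemma prod_pm_one:
  fixes f :: "'a \<Rightarrow> int"
  shows "(\<And>i. i \<in> A \<Longrightarrow> f i = 1 \<or> f i = -1) \<Longrightarrow> prod f A = 1 \<or> prod f A = -1"
proof (induction A rule: infinite_finite_induct)
  case (insert x A)
  then have "prod f A = 1 \<or> prod f A = -1" "f x = 1 \<or> f x = -1" by auto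
  then show ?case using insert(1,2) by auto
qed auto

text \<open>The place of the nonzero entry in each column determines the permutation, so the
  definite description in \<open>underlying_perm\<close> is meaningful on the group.\<close>

lemma signed_perm_decomp_iff:
  assumes "e \<in> signs N" "\<pi> permutes {..<N}"
  shows "signed_perm_decomp N (signed_perm_mat N e \<pi>) \<sigma> \<longleftrightarrow> \<sigma> = \<pi>"
proof
  assume "signed_perm_decomp N (signed_perm_mat N e \<pi>) \<sigma>"
  then obtain d where \<sigma>: "\<sigma> permutes {..<N}" and d: "\<And>i. i < N \<Longrightarrow> d i = 1 \<or> d i = -1"
    and x: "signed_perm_mat N e \<pi> = mat_diag N d * perm_mat N \<sigma>"
    unfolding signed_perm_decomp_def by blast
  have x': "signed_perm_mat N e \<pi> = Matrix.mat N N (\<lambda>(i, j). d i * perm_mat N \<sigma> $$ (i, j))"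
    unfolding x by (rule mat_diag_mult_left) (simp add: perm_mat_def)
  have "\<sigma> j = \<pi> j" if "j < N" for j
  proof (rule ccontr)
    assume "\<sigma> j \<noteq> \<pi> j"
    have sj: "\<sigma> j < N" using permutes_in_image[OF \<sigma>, of j] that by simp
    have "signed_perm_mat N e \<pi> $$ (\<sigma> j, j) = 0"
      using that sj \<open>\<sigma> j \<noteq> \<pi> j\<close> by (simp add: signed_perm_mat_def)
    moreover have "signed_perm_mat N e \<pi> $$ (\<sigma> j, j) = d (\<sigma> j)"
      unfolding x' using that sj by (simp add: perm_mat_def)
    ultimately show False using d[OF sj] by auto
  qed
  moreover have "\<sigma> j = \<pi> j" if "\<not> j < N" for j
    using that permutes_not_in[OF \<sigma>] permutes_not_in[OF assms(2)] by simp
  ultimately show "\<sigma> = \<pi>" by (metis ext)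
next
  assume "\<sigma> = \<pi>"
  define d where "d i = e (inv_into UNIV \<pi> i)" for i
  have inv: "inv_into UNIV \<pi> permutes {..<N}" using permutes_inv[OF assms(2)] .
  have "d i = 1 \<or> d i = -1" if "i < N" for i
    unfolding d_def using that permutes_in_image[OF inv, of i] by (intro signs_pm[OF assms(1)]) simp
  moreover have "signed_perm_mat N e \<pi> = mat_diag N d * perm_mat N \<pi>"
  proof -
    have "mat_diag N d * perm_mat N \<pi> = Matrix.mat N N (\<lambda>(i, j). d i * perm_mat N \<pi> $$ (i, j))"
      by (rule mat_diag_mult_left) (simp add: perm_mat_def)
    also have "\<dots> = signed_perm_mat N e \<pi>"
      unfolding signed_perm_mat_def
      by (rule cong_mat) (auto simp: perm_mat_def d_def permutes_inverses(2)[OF assms(2)])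
    finally show ?thesis by simp
  qed
  ultimately show "signed_perm_decomp N (signed_perm_mat N e \<pi>) \<sigma>"
    unfolding signed_perm_decomp_def \<open>\<sigma> = \<pi>\<close> using assms(2) by blast
qed

lemma underlying_perm_signed_perm_mat:
  assumes "e \<in> signs N" "\<pi> permutes {..<N}"
  shows "underlying_perm N (signed_perm_mat N e \<pi>) = \<pi>"
  unfolding underlying_perm_def signed_perm_decomp_iff[OF assms] by simp

lemma hyperoctahedral_eq:
  "hyperoctahedral N = (\<lambda>(e, \<pi>). signed_perm_mat N e \<pi>) ` (signs N \<times> {\<pi>. \<pi> permutes {..<N}})"
proof (intro equalityI subsetI)
  fix x assume "x \<in> hyperoctahedral N"
  then obtain \<pi> d where \<pi>: "\<pi> permutes {..<N}" and d: "\<And>i. i < N \<Longrightarrow> d i = 1 \<or> d i = -1"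
    and x: "x = mat_diag N d * perm_mat N \<pi>"
    unfolding hyperoctahedral_def signed_perm_decomp_def by blast
  define e where "e = restrict (d \<circ> \<pi>) {..<N}"
  have "e \<in> signs N"
    unfolding signs_def e_def using d permutes_in_image[OF \<pi>] by auto
  moreover have "x = signed_perm_mat N e \<pi>"
  proof -
    have "x = Matrix.mat N N (\<lambda>(i, j). d i * perm_mat N \<pi> $$ (i, j))"
      unfolding x by (rule mat_diag_mult_left) (simp add: perm_mat_def)
    also have "\<dots> = signed_perm_mat N e \<pi>"
      unfolding signed_perm_mat_def by (rule cong_mat) (auto simp: perm_mat_def e_def)
    finally show ?thesis .
  qed
  ultimately show "x \<in> (\<lambda>(e, \<pi>). signed_perm_mat N e \<pi>) ` (signs N \<times> {\<pi>. \<pi> permutes {..<N}})"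
    using \<pi> by force
next
  fix x assume "x \<in> (\<lambda>(e, \<pi>). signed_perm_mat N e \<pi>) ` (signs N \<times> {\<pi>. \<pi> permutes {..<N}})"
  then show "x \<in> hyperoctahedral N"
    unfolding hyperoctahedral_def using signed_perm_decomp_iff by auto
qed

lemma inj_signed_perm_mat:
  "inj_on (\<lambda>(e, \<pi>). signed_perm_mat N e \<pi>) (signs N \<times> {\<pi>. \<pi> permutes {..<N}})"
proof (rule inj_onI, clarify)
  fix e \<pi> e' \<pi>' assume a: "e \<in> signs N" "\<pi> permutes {..<N}" "e' \<in> signs N" "\<pi>' permutes {..<N}"
    and eq: "signed_perm_mat N e \<pi> = signed_perm_mat N e' \<pi>'"
  have \<pi>: "\<pi> = \<pi>'" using underlying_perm_signed_perm_mat a eq by metis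
  have "e j = e' j" if "j < N" for j
  proof -
    have "\<pi> j < N" using permutes_in_image[OF a(2), of j] that by simp
    then have "signed_perm_mat N e \<pi> $$ (\<pi> j, j) = e j" "signed_perm_mat N e' \<pi>' $$ (\<pi> j, j) = e' j"
      using that by (simp_all add: signed_perm_mat_def \<pi>)
    then show ?thesis using eq by simp
  qed
  then have "e = e'" using a(1,3) unfolding signs_def by (intro PiE_ext) auto
  then show "e = e' \<and> \<pi> = \<pi>'" using \<pi> by simp
qed

lemma signed_perm_mat_eq_iff:
  assumes "e \<in> signs N" "\<pi> permutes {..<N}" "e' \<in> signs N" "\<pi>' permutes {..<N}"
  shows "signed_perm_mat N e \<pi> = signed_perm_mat N e' \<pi>' \<longleftrightarrow> e = e' \<and> \<pi> = \<pi>'"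
  using inj_onD[OF inj_signed_perm_mat, of N "(e, \<pi>)" "(e', \<pi>')"] assms by auto

lemma signed_perm_mat_mult:
  assumes "\<pi>' permutes {..<N}"
  shows "signed_perm_mat N e \<pi> * signed_perm_mat N e' \<pi>' =
    signed_perm_mat N (\<lambda>j\<in>{..<N}. e (\<pi>' j) * e' j) (\<pi> \<circ> \<pi>')"
proof (rule eq_matI)
  fix i j assume "i < dim_row (signed_perm_mat N (\<lambda>j\<in>{..<N}. e (\<pi>' j) * e' j) (\<pi> \<circ> \<pi>'))"
    "j < dim_col (signed_perm_mat N (\<lambda>j\<in>{..<N}. e (\<pi>' j) * e' j) (\<pi> \<circ> \<pi>'))"
  then have ij: "i < N" "j < N" by (auto simp: signed_perm_mat_def)
  then have "\<pi>' j < N" using permutes_in_image[OF assms, of j] by simp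
  have "(signed_perm_mat N e \<pi> * signed_perm_mat N e' \<pi>') $$ (i, j) =
      (\<Sum>k<N. (if i = \<pi> k then e k else 0) * (if k = \<pi>' j then e' j else 0))"
    using ij by (simp add: signed_perm_mat_def scalar_prod_def atLeast0LessThan)
  also have "\<dots> = (\<Sum>k<N. if k = \<pi>' j then (if i = \<pi> k then e k * e' j else 0) else 0)"
    by (intro sum.cong) auto
  also have "\<dots> = (if i = \<pi> (\<pi>' j) then e (\<pi>' j) * e' j else 0)"
    using \<open>\<pi>' j < N\<close> by (simp add: sum.delta)
  finally show "(signed_perm_mat N e \<pi> * signed_perm_mat N e' \<pi>') $$ (i, j) =
      signed_perm_mat N (\<lambda>j\<in>{..<N}. e (\<pi>' j) * e' j) (\<pi> \<circ> \<pi>') $$ (i, j)"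
    using ij by (simp add: signed_perm_mat_def)
qed (auto simp: signed_perm_mat_def)

text \<open>By the second claim the product of all signs is multiplicative. This linear character
  decides later whether the second term of a pairing is added or subtracted.\<close>

lemma signs_shift:
  assumes "e \<in> signs N" "e' \<in> signs N" "\<pi> permutes {..<N}"
  shows "(\<lambda>j\<in>{..<N}. e (\<pi> j) * e' j) \<in> signs N"
    and "(\<Prod>j<N. (\<lambda>j\<in>{..<N}. e (\<pi> j) * e' j) j) = prod e {..<N} * prod e' {..<N}"
proof -
  show "(\<lambda>j\<in>{..<N}. e (\<pi> j) * e' j) \<in> signs N"
  proof (rule restrict_in_signs)
    fix j assume j: "j < N"
    then have "\<pi> j < N" using permutes_in_image[OF assms(3), of j] by simp
    from signs_pm[OF assms(1) this] signs_pm[OF assms(2) j]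
    show "e (\<pi> j) * e' j = 1 \<or> e (\<pi> j) * e' j = -1" by auto
  qed
  have "(\<Prod>j<N. e (\<pi> j)) = prod e {..<N}"
    using prod.permute[OF assms(3), of e] by (simp add: comp_def)
  then show "(\<Prod>j<N. (\<lambda>j\<in>{..<N}. e (\<pi> j) * e' j) j) = prod e {..<N} * prod e' {..<N}"
    by (simp add: prod.distrib)
qed

lemma cycles_of_signed_perm_mat:
  assumes "e \<in> signs N" "\<pi> permutes {..<N}"
  shows "cycles_of N (signed_perm_mat N e \<pi>) = cycles {..<N} \<pi>"
  unfolding cycles_of_def cycles_def underlying_perm_signed_perm_mat[OF assms] ..

lemma cycle_sign_signed_perm_mat:
  assumes "e \<in> signs N" "\<pi> permutes {..<N}" "C \<in> cycles {..<N} \<pi>"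
  shows "cycle_sign N (signed_perm_mat N e \<pi>) C = prod e C"
proof -
  have "C \<subseteq> {..<N}" using Union_cycles[OF _ assms(2)] assms(3) by blast
  then show ?thesis
    unfolding cycle_sign_def underlying_perm_signed_perm_mat[OF assms(1,2)]
    using permutes_in_image[OF assms(2)] by (intro prod.cong) (auto simp: signed_perm_mat_def)
qed

lemma type_part_signed_perm_mat:
  assumes "e \<in> signs N" "\<pi> permutes {..<N}"
  shows "type_part N (signed_perm_mat N e \<pi>) j =
    image_mset card (mset_set {C \<in> cycles {..<N} \<pi>. prod e C = (-1) ^ j})"
proof -
  have "{C \<in> cycles {..<N} \<pi>. cycle_sign N (signed_perm_mat N e \<pi>) C = (-1) ^ j} =
      {C \<in> cycles {..<N} \<pi>. prod e C = (-1) ^ j}"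
    using cycle_sign_signed_perm_mat[OF assms] by auto
  then show ?thesis unfolding type_part_def cycles_of_signed_perm_mat[OF assms] by simp
qed

lemma ell_signed_perm_mat:
  assumes "e \<in> signs N" "\<pi> permutes {..<N}"
  shows "ell N (signed_perm_mat N e \<pi>) = card {C \<in> cycles {..<N} \<pi>. prod e C = 1}"
  unfolding ell_def signed_type_def fst_conv type_part_signed_perm_mat[OF assms] by simp

section \<open>Sums over signs\<close>

text \<open>Orthogonality of the characters of the group of sign vectors: each index in
  \<open>U\<close> contributes the factor \<open>1 + (-1)\<close>, every other index the factor
  2.\<close>

lemma sum_signs_prod:
  assumes "U \<subseteq> {..<N}"
  shows "(\<Sum>e\<in>signs N. of_int (prod e U) :: real) = (if U = {} then 2 ^ N else 0)"
proof -
  have "(\<Sum>e\<in>signs N. of_int (prod e U) :: real) =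
      (\<Sum>e\<in>signs N. \<Prod>i<N. if i \<in> U then of_int (e i) else 1)"
    using assms by (intro sum.cong refl) (simp add: prod.If_cases Int_absorb1)
  also have "\<dots> = (\<Prod>i<N. \<Sum>s\<in>{1, -1 :: int}. if i \<in> U then of_int s else 1)"
    unfolding signs_def by (rule prod_sum_PiE[symmetric]) auto
  also have "\<dots> = (\<Prod>i<N. if i \<in> U then 0 else 2)"
    by (intro prod.cong refl) auto
  also have "\<dots> = (if U = {} then 2 ^ N else 0)"
  proof (cases "U = {}")
    case False
    then obtain i where "i \<in> U" "i < N" using assms by auto
    then show ?thesis using False by (auto intro!: prod_zero bexI[of _ i])
  qed simp
  finally show ?thesis .
qed

lemma card_signs: "card (signs N) = 2 ^ N"
  unfolding signs_def by (simp add: card_PiE numeral_2_eq_2)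

text \<open>A cycle of sign \<open>s\<close> contributes \<open>2m + 1\<close> for
  \<open>s = 1\<close> and \<open>1\<close> for \<open>s = -1\<close>, that is,
  \<open>m s + (m + 1)\<close>. Expanding the product over cycles gives one term for each set
  \<open>\<T>\<close> of cycles contributing \<open>m s\<close>.\<close>

lemma power_card_positive_cycles:
  fixes m :: nat
  assumes "e \<in> signs N" "\<pi> permutes {..<N}"
  shows "(2 * real m + 1) ^ ell N (signed_perm_mat N e \<pi>) =
    (\<Sum>\<T>\<in>Pow (cycles {..<N} \<pi>). real m ^ card \<T> * (real m + 1) ^ card (cycles {..<N} \<pi> - \<T>)
      * of_int (prod e (\<Union>\<T>)))"
proof -
  let ?C = "cycles {..<N} \<pi>"
  have fin: "finite ?C" by simp
  have pm: "prod e C = 1 \<or> prod e C = -1" if "C \<in> ?C" for C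
    using that Union_cycles[OF _ assms(2)] by (intro prod_pm_one signs_pm[OF assms(1)]) auto
  have "(2 * real m + 1) ^ ell N (signed_perm_mat N e \<pi>) =
      (\<Prod>C\<in>?C. if prod e C = 1 then 2 * real m + 1 else 1)"
    unfolding ell_signed_perm_mat[OF assms] using fin by (simp add: prod.If_cases Int_def conj_commute)
  also have "\<dots> = (\<Prod>C\<in>?C. real m * of_int (prod e C) + (real m + 1))"
  proof (rule prod.cong[OF refl])
    fix C assume "C \<in> ?C"
    from pm[OF this] show "(if prod e C = 1 then 2 * real m + 1 else 1) =
        real m * of_int (prod e C) + (real m + 1)" by (elim disjE) simp_all
  qed
  also have "\<dots> = (\<Sum>\<T>\<in>Pow ?C. (\<Prod>C\<in>\<T>. real m * of_int (prod e C)) * (\<Prod>C\<in>?C - \<T>. real m + 1))"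
    by (rule prod_add[OF fin])
  also have "\<dots> = (\<Sum>\<T>\<in>Pow ?C. real m ^ card \<T> * (real m + 1) ^ card (?C - \<T>) * of_int (prod e (\<Union>\<T>)))"
  proof (rule sum.cong[OF refl])
    fix \<T> assume "\<T> \<in> Pow ?C"
    then have sub: "\<T> \<subseteq> ?C" by simp
    have "prod e (\<Union>\<T>) = (prod \<circ> prod) e \<T>"
    proof (rule prod.Union_disjoint)
      show "\<forall>A\<in>\<T>. finite A"
        using sub Union_cycles[OF _ assms(2)] by (metis Sup_upper finite_lessThan finite_subset subsetD)
      show "\<forall>A\<in>\<T>. \<forall>B\<in>\<T>. A \<noteq> B \<longrightarrow> A \<inter> B = {}"
        using sub cycles_disjoint[OF _ assms(2)] by blast
    qed
    then show "(\<Prod>C\<in>\<T>. real m * of_int (prod e C)) * (\<Prod>C\<in>?C - \<T>. real m + 1) =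
        real m ^ card \<T> * (real m + 1) ^ card (?C - \<T>) * of_int (prod e (\<Union>\<T>))"
      by (simp add: prod.distrib)
  qed
  finally show ?thesis .
qed

text \<open>By orthogonality only \<open>\<T> = {}\<close> survives, which leaves the power of
  \<open>m + 1\<close>. The total sign replaces each union of cycles by its complement, so in the
  twisted sum only the set of all cycles survives, which leaves the power of
  \<open>m\<close>.\<close>

lemma sum_signs_power_ell:
  fixes m :: nat
  assumes "\<pi> permutes {..<N}" "0 < N"
  shows "(\<Sum>e\<in>signs N. (2 * real m + 1) ^ ell N (signed_perm_mat N e \<pi>)) =
      2 ^ N * (real m + 1) ^ card (cycles {..<N} \<pi>)"
    and "(\<Sum>e\<in>signs N. of_int (prod e {..<N}) * (2 * real m + 1) ^ ell N (signed_perm_mat N e \<pi>)) =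
      2 ^ N * real m ^ card (cycles {..<N} \<pi>)"
proof -
  let ?C = "cycles {..<N} \<pi>"
  let ?w = "\<lambda>\<T>. real m ^ card \<T> * (real m + 1) ^ card (?C - \<T>)"
  have fin: "finite (Pow ?C)" by simp
  have U: "\<Union>?C = {..<N}" using Union_cycles[OF _ assms(1)] by simp
  have ne: "C \<noteq> {}" if "C \<in> ?C" for C
    using that card_cycle_pos[OF _ assms(1)] by fastforce
  have sub: "\<Union>\<T> \<subseteq> {..<N}" if "\<T> \<in> Pow ?C" for \<T> using that U by blast
  have empty: "\<Union>\<T> = {} \<longleftrightarrow> \<T> = {}" if "\<T> \<in> Pow ?C" for \<T> using that ne by blast
  have full: "{..<N} - \<Union>\<T> = {} \<longleftrightarrow> \<T> = ?C" if T: "\<T> \<in> Pow ?C" for \<T>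
  proof
    assume "{..<N} - \<Union>\<T> = {}"
    show "\<T> = ?C"
    proof (rule ccontr)
      assume "\<T> \<noteq> ?C"
      then obtain C where C: "C \<in> ?C" "C \<notin> \<T>" using T by blast
      then obtain x where x: "x \<in> C" using ne by blast
      then have "x \<in> \<Union>\<T>" using \<open>{..<N} - \<Union>\<T> = {}\<close> C U by blast
      then obtain D where "D \<in> \<T>" "x \<in> D" by blast
      then show False using cycles_disjoint[OF _ assms(1) C(1), of D] C T x by blast
    qed
  qed (use U in auto)
  have "(\<Sum>e\<in>signs N. (2 * real m + 1) ^ ell N (signed_perm_mat N e \<pi>)) =
      (\<Sum>\<T>\<in>Pow ?C. ?w \<T> * (\<Sum>e\<in>signs N. of_int (prod e (\<Union>\<T>))))"
  proof -
    have "(\<Sum>e\<in>signs N. (2 * real m + 1) ^ ell N (signed_perm_mat N e \<pi>)) =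
        (\<Sum>e\<in>signs N. \<Sum>\<T>\<in>Pow ?C. ?w \<T> * of_int (prod e (\<Union>\<T>)))"
      by (rule sum.cong[OF refl], rule power_card_positive_cycles[OF _ assms(1)])
    also have "\<dots> = (\<Sum>\<T>\<in>Pow ?C. ?w \<T> * (\<Sum>e\<in>signs N. of_int (prod e (\<Union>\<T>))))"
      unfolding sum_distrib_left by (rule sum.swap)
    finally show ?thesis .
  qed
  also have "\<dots> = (\<Sum>\<T>\<in>Pow ?C. if \<T> = {} then 2 ^ N * (real m + 1) ^ card ?C else 0)"
  proof (rule sum.cong[OF refl])
    fix \<T> assume T: "\<T> \<in> Pow ?C"
    show "?w \<T> * (\<Sum>e\<in>signs N. of_int (prod e (\<Union>\<T>))) =
        (if \<T> = {} then 2 ^ N * (real m + 1) ^ card ?C else 0)"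
      unfolding sum_signs_prod[OF sub[OF T]] empty[OF T] by simp
  qed
  also have "\<dots> = 2 ^ N * (real m + 1) ^ card ?C" using fin by (simp add: sum.delta)
  finally show "(\<Sum>e\<in>signs N. (2 * real m + 1) ^ ell N (signed_perm_mat N e \<pi>)) =
      2 ^ N * (real m + 1) ^ card ?C" .
  have flip: "prod e {..<N} * prod e (\<Union>\<T>) = prod e ({..<N} - \<Union>\<T>)" if "e \<in> signs N" "\<T> \<in> Pow ?C" for e \<T>
  proof -
    have "prod e {..<N} = prod e ({..<N} - \<Union>\<T>) * prod e (\<Union>\<T>)"
      by (rule prod.subset_diff) (use sub[OF that(2)] in auto)
    moreover have "prod e (\<Union>\<T>) = 1 \<or> prod e (\<Union>\<T>) = -1"
      using sub[OF that(2)] by (intro prod_pm_one signs_pm[OF that(1)]) auto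
    ultimately show ?thesis by auto
  qed
  have "(\<Sum>e\<in>signs N. of_int (prod e {..<N}) * (2 * real m + 1) ^ ell N (signed_perm_mat N e \<pi>)) =
      (\<Sum>e\<in>signs N. \<Sum>\<T>\<in>Pow ?C. ?w \<T> * of_int (prod e ({..<N} - \<Union>\<T>)))"
  proof (rule sum.cong[OF refl])
    fix e assume e: "e \<in> signs N"
    have "of_int (prod e {..<N}) * (2 * real m + 1) ^ ell N (signed_perm_mat N e \<pi>) =
        (\<Sum>\<T>\<in>Pow ?C. ?w \<T> * of_int (prod e {..<N} * prod e (\<Union>\<T>)))"
      unfolding power_card_positive_cycles[OF e assms(1)] sum_distrib_left of_int_mult
      by (intro sum.cong refl) (simp only: ac_simps)
    also have "\<dots> = (\<Sum>\<T>\<in>Pow ?C. ?w \<T> * of_int (prod e ({..<N} - \<Union>\<T>)))"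
      by (intro sum.cong refl) (simp only: flip[OF e])
    finally show "of_int (prod e {..<N}) * (2 * real m + 1) ^ ell N (signed_perm_mat N e \<pi>) =
        (\<Sum>\<T>\<in>Pow ?C. ?w \<T> * of_int (prod e ({..<N} - \<Union>\<T>)))" .
  qed
  also have "\<dots> = (\<Sum>\<T>\<in>Pow ?C. ?w \<T> * (\<Sum>e\<in>signs N. of_int (prod e ({..<N} - \<Union>\<T>))))"
    unfolding sum_distrib_left by (rule sum.swap)
  also have "\<dots> = (\<Sum>\<T>\<in>Pow ?C. if \<T> = ?C then 2 ^ N * real m ^ card ?C else 0)"
  proof (rule sum.cong[OF refl])
    fix \<T> assume T: "\<T> \<in> Pow ?C"
    show "?w \<T> * (\<Sum>e\<in>signs N. of_int (prod e ({..<N} - \<Union>\<T>))) =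
        (if \<T> = ?C then 2 ^ N * real m ^ card ?C else 0)"
      unfolding sum_signs_prod[OF Diff_subset] full[OF T] by simp
  qed
  also have "\<dots> = 2 ^ N * real m ^ card ?C" using fin by (simp add: sum.delta)
  finally show "(\<Sum>e\<in>signs N. of_int (prod e {..<N}) * (2 * real m + 1) ^ ell N (signed_perm_mat N e \<pi>)) =
      2 ^ N * real m ^ card ?C" .
qed

text \<open>Multiplication by \<open>e'\<close> shifts the sign vectors of total sign 1 onto those
  of total sign \<open>prod e' {..<N}\<close>. The indicator of the latter set is a half sum of the
  trivial character and the total sign, which reduces the claim to the two sums over all
  signs.\<close>

lemma sum_positive_signs_power_ell:
  fixes m :: nat
  assumes "e' \<in> signs N" "\<kappa> permutes {..<N}" "\<sigma> permutes {..<N}" "0 < N"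
  shows "(\<Sum>e | e \<in> signs N \<and> prod e {..<N} = 1.
      (2 * real m + 1) ^ ell N (signed_perm_mat N e \<kappa> * signed_perm_mat N e' \<sigma>)) =
    2 ^ (N - 1) * ((real m + 1) ^ card (cycles {..<N} (\<kappa> \<circ> \<sigma>))
      + of_int (prod e' {..<N}) * real m ^ card (cycles {..<N} (\<kappa> \<circ> \<sigma>)))"
proof -
  let ?sh = "\<lambda>e. \<lambda>j\<in>{..<N}. e (\<sigma> j) * e' j"
  let ?\<epsilon> = "prod e' {..<N}" and ?p = "\<lambda>e. (2 * real m + 1) ^ ell N (signed_perm_mat N e (\<kappa> \<circ> \<sigma>))"
  let ?un = "\<lambda>e. \<lambda>j\<in>{..<N}. e (inv_into UNIV \<sigma> j) * e' (inv_into UNIV \<sigma> j)"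
  have perm: "\<kappa> \<circ> \<sigma> permutes {..<N}" using assms by (intro permutes_compose)
  have inv: "inv_into UNIV \<sigma> permutes {..<N}" using permutes_inv[OF assms(3)] .
  have inN: "\<sigma> j < N" "inv_into UNIV \<sigma> j < N" if "j < N" for j
    using that permutes_in_image[OF assms(3), of j] permutes_in_image[OF inv, of j] by auto
  have e'2: "e' j * e' j = 1" if "j < N" for j using signs_pm[OF assms(1) that] by auto
  have \<epsilon>: "?\<epsilon> = 1 \<or> ?\<epsilon> = -1" by (intro prod_pm_one signs_pm[OF assms(1)]) simp
  have "(\<Sum>e | e \<in> signs N \<and> prod e {..<N} = 1.
      (2 * real m + 1) ^ ell N (signed_perm_mat N e \<kappa> * signed_perm_mat N e' \<sigma>)) =
      (\<Sum>e | e \<in> signs N \<and> prod e {..<N} = 1. ?p (?sh e))"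
    unfolding signed_perm_mat_mult[OF assms(3)] ..
  also have "\<dots> = (\<Sum>e | e \<in> signs N \<and> prod e {..<N} = ?\<epsilon>. ?p e)"
  proof (rule sum.reindex_bij_witness[of _ ?un ?sh])
    fix e assume e: "e \<in> {e \<in> signs N. prod e {..<N} = 1}"
    show "?un (?sh e) = e"
    proof (rule extensionalityI[of _ "{..<N}"])
      show "e \<in> extensional {..<N}" using e by (auto simp: signs_def PiE_def)
      show "?un (?sh e) j = e j" if "j \<in> {..<N}" for j
        using that inN e'2 by (simp add: permutes_inverses(1)[OF assms(3)] mult.assoc)
    qed simp
    show "?sh e \<in> {e \<in> signs N. prod e {..<N} = ?\<epsilon>}"
      using signs_shift[OF _ assms(1,3), of e] e by simp
  next
    fix e assume e: "e \<in> {e \<in> signs N. prod e {..<N} = ?\<epsilon>}"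
    show "?sh (?un e) = e"
    proof (rule extensionalityI[of _ "{..<N}"])
      show "e \<in> extensional {..<N}" using e by (auto simp: signs_def PiE_def)
      show "?sh (?un e) j = e j" if "j \<in> {..<N}" for j
        using that inN e'2 by (simp add: permutes_inverses(2)[OF assms(3)] mult.assoc)
    qed simp
    have un: "?un e \<in> signs N"
    proof (rule restrict_in_signs)
      fix j assume "j < N"
      then have j: "inv_into UNIV \<sigma> j < N" by (rule inN)
      have "e \<in> signs N" using e by simp
      from signs_pm[OF assms(1) j] signs_pm[OF this j]
      show "e (inv_into UNIV \<sigma> j) * e' (inv_into UNIV \<sigma> j) = 1 \<or>
          e (inv_into UNIV \<sigma> j) * e' (inv_into UNIV \<sigma> j) = -1" by auto
    qed
    have "prod (?sh (?un e)) {..<N} = prod (?un e) {..<N} * ?\<epsilon>"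
      by (rule signs_shift(2)[OF un assms(1,3)])
    then have "?\<epsilon> = prod (?un e) {..<N} * ?\<epsilon>" unfolding \<open>?sh (?un e) = e\<close> using e by simp
    then have "prod (?un e) {..<N} = 1" using \<epsilon> by (metis mult_cancel_right1 zero_neq_neg_one zero_neq_one)
    then show "?un e \<in> {e \<in> signs N. prod e {..<N} = 1}" using un by (simp only: mem_Collect_eq simp_thms)
  qed simp
  also have "\<dots> = (\<Sum>e\<in>signs N. if prod e {..<N} = ?\<epsilon> then ?p e else 0)"
    by (rule sum.inter_filter) simp
  also have "\<dots> = (\<Sum>e\<in>signs N. (?p e + of_int ?\<epsilon> * (of_int (prod e {..<N}) * ?p e)) / 2)"
  proof (rule sum.cong[OF refl])
    fix e assume e: "e \<in> signs N"
    have "prod e {..<N} = 1 \<or> prod e {..<N} = -1" by (intro prod_pm_one signs_pm[OF e]) simp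
    then show "(if prod e {..<N} = ?\<epsilon> then ?p e else 0) = (?p e + of_int ?\<epsilon> * (of_int (prod e {..<N}) * ?p e)) / 2"
      using \<epsilon> by (auto simp del: of_int_prod)
  qed
  also have "\<dots> = ((\<Sum>e\<in>signs N. ?p e) + of_int ?\<epsilon> * (\<Sum>e\<in>signs N. of_int (prod e {..<N}) * ?p e)) / 2"
    by (simp only: sum_divide_distrib[symmetric] sum.distrib sum_distrib_left)
  also have "\<dots> = 2 ^ (N - 1) * ((real m + 1) ^ card (cycles {..<N} (\<kappa> \<circ> \<sigma>))
      + of_int ?\<epsilon> * real m ^ card (cycles {..<N} (\<kappa> \<circ> \<sigma>)))"
    unfolding sum_signs_power_ell[OF perm assms(4)] using assms(4) by (cases N) (simp_all add: algebra_simps)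
  finally show ?thesis .
qed

section \<open>The group and its classes under \<open>ell\<close>\<close>

lemma hyperoctahedralE:
  assumes "x \<in> hyperoctahedral N"
  obtains e \<pi> where "e \<in> signs N" "\<pi> permutes {..<N}" "x = signed_perm_mat N e \<pi>"
  using assms unfolding hyperoctahedral_eq by auto

lemma signed_perm_mat_in_hyperoctahedral [simp]:
  "\<lbrakk>e \<in> signs N; \<pi> permutes {..<N}\<rbrakk> \<Longrightarrow> signed_perm_mat N e \<pi> \<in> hyperoctahedral N"
  unfolding hyperoctahedral_eq by force

lemma finite_hyperoctahedral [simp]: "finite (hyperoctahedral N)"
  unfolding hyperoctahedral_eq by (intro finite_imageI finite_cartesian_product finite_permutations) auto

lemma hyperoctahedral_carrier: "x \<in> hyperoctahedral N \<Longrightarrow> x \<in> carrier_mat N N"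
  by (elim hyperoctahedralE) (simp add: signed_perm_mat_def)

lemma sum_hyperoctahedral:
  "sum F (hyperoctahedral N) = (\<Sum>e\<in>signs N. \<Sum>\<pi> | \<pi> permutes {..<N}. F (signed_perm_mat N e \<pi>))"
  unfolding hyperoctahedral_eq sum.reindex[OF inj_signed_perm_mat]
  by (simp add: sum.cartesian_product case_prod_beta comp_def)

lemma card_hyperoctahedral: "card (hyperoctahedral N) = 2 ^ N * fact N"
  unfolding hyperoctahedral_eq card_image[OF inj_signed_perm_mat]
  by (simp add: card_cartesian_product card_signs card_permutations)

lemma hyperoctahedral_mult:
  assumes "x \<in> hyperoctahedral N" "y \<in> hyperoctahedral N"
  shows "x * y \<in> hyperoctahedral N"
proof -
  obtain e \<pi> where x: "e \<in> signs N" "\<pi> permutes {..<N}" "x = signed_perm_mat N e \<pi>"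
    using assms(1) by (rule hyperoctahedralE)
  obtain e' \<pi>' where y: "e' \<in> signs N" "\<pi>' permutes {..<N}" "y = signed_perm_mat N e' \<pi>'"
    using assms(2) by (rule hyperoctahedralE)
  show ?thesis
    unfolding x(3) y(3) signed_perm_mat_mult[OF y(2)]
    using signs_shift(1)[OF x(1) y(1,2)] permutes_compose[OF y(2) x(2)] by simp
qed

lemma inj_on_hyperoctahedral_mult:
  assumes "k \<in> hyperoctahedral N"
  shows "inj_on (\<lambda>x. k * x) (hyperoctahedral N)"
proof (rule inj_onI)
  fix x y assume x: "x \<in> hyperoctahedral N" and y: "y \<in> hyperoctahedral N" and eq: "k * x = k * y"
  obtain e \<kappa> where k: "e \<in> signs N" "\<kappa> permutes {..<N}" "k = signed_perm_mat N e \<kappa>"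
    using assms by (rule hyperoctahedralE)
  obtain a \<pi> where x: "a \<in> signs N" "\<pi> permutes {..<N}" "x = signed_perm_mat N a \<pi>"
    using x by (rule hyperoctahedralE)
  obtain b \<sigma> where y: "b \<in> signs N" "\<sigma> permutes {..<N}" "y = signed_perm_mat N b \<sigma>"
    using y by (rule hyperoctahedralE)
  let ?a = "\<lambda>j\<in>{..<N}. e (\<pi> j) * a j" and ?b = "\<lambda>j\<in>{..<N}. e (\<sigma> j) * b j"
  have "?a = ?b \<and> \<kappa> \<circ> \<pi> = \<kappa> \<circ> \<sigma>"
    using eq unfolding k(3) x(3) y(3) signed_perm_mat_mult[OF x(2)] signed_perm_mat_mult[OF y(2)]
      signed_perm_mat_eq_iff[OF signs_shift(1)[OF k(1) x(1,2)] permutes_compose[OF x(2) k(2)]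
        signs_shift(1)[OF k(1) y(1,2)] permutes_compose[OF y(2) k(2)]] .
  then have ab: "?a = ?b" and "\<kappa> \<circ> \<pi> = \<kappa> \<circ> \<sigma>" by auto
  then have \<pi>\<sigma>: "\<pi> = \<sigma>" using permutes_inj[OF k(2)] by (auto simp: fun_eq_iff inj_def)
  have "a j = b j" if "j < N" for j
  proof -
    have "\<pi> j < N" using permutes_in_image[OF x(2), of j] that by simp
    then have "e (\<pi> j) \<noteq> 0" using signs_pm[OF k(1)] by fastforce
    moreover have "e (\<pi> j) * a j = e (\<pi> j) * b j" using fun_cong[OF ab, of j] that \<pi>\<sigma> by simp
    ultimately show ?thesis by simp
  qed
  then have "a = b" using x(1) y(1) unfolding signs_def by (intro PiE_ext) auto
  then show "x = y" unfolding x(3) y(3) \<pi>\<sigma> by simp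
qed

lemma one_mat_in_hyperoctahedral: "1\<^sub>m N \<in> hyperoctahedral N"
proof -
  have "1\<^sub>m N = signed_perm_mat N (restrict (\<lambda>_. 1) {..<N}) id"
    by (rule eq_matI) (auto simp: signed_perm_mat_def)
  then show ?thesis using restrict_in_signs[of N "\<lambda>_. 1"] permutes_id[of "{..<N}"] by simp
qed

lemma ell_le: "x \<in> hyperoctahedral N \<Longrightarrow> ell N x \<le> N"
proof (elim hyperoctahedralE)
  fix e \<pi> assume a: "e \<in> signs N" "\<pi> permutes {..<N}" "x = signed_perm_mat N e \<pi>"
  have "ell N x \<le> card (cycles {..<N} \<pi>)"
    unfolding a(3) ell_signed_perm_mat[OF a(1,2)] by (intro card_mono) auto
  also have "\<dots> \<le> N" unfolding cycles_def using card_image_le[of "{..<N}" "orbit \<pi>"] by simp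
  finally show "ell N x \<le> N" .
qed

text \<open>Left multiplication is injective, so the cardinality counts the \<open>x\<close> with
  prescribed values of \<open>ell\<close> at \<open>x\<close> and at \<open>k * x\<close>. Both
  values are at most \<open>N\<close>, so every group element is counted once.\<close>

lemma sum_ell_class_pairs:
  fixes f g :: "nat \<Rightarrow> real"
  assumes "k \<in> hyperoctahedral N"
  shows "(\<Sum>i=0..N. \<Sum>j=0..N. f i * g j * real (card ((\<lambda>x. k * x) ` ell_class N i \<inter> ell_class N j))) =
    (\<Sum>x\<in>hyperoctahedral N. f (ell N x) * g (ell N (k * x)))"
proof -
  let ?B = "hyperoctahedral N"
  have card_eq: "real (card ((\<lambda>x. k * x) ` ell_class N i \<inter> ell_class N j)) =
      (\<Sum>x\<in>?B. if ell N x = i \<and> ell N (k * x) = j then 1 else 0)" for i j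
  proof -
    have "(\<lambda>x. k * x) ` ell_class N i \<inter> ell_class N j = (\<lambda>x. k * x) ` {x \<in> ?B. ell N x = i \<and> ell N (k * x) = j}"
      using hyperoctahedral_mult[OF assms] by (auto simp: ell_class_def)
    also have "card \<dots> = card {x \<in> ?B. ell N x = i \<and> ell N (k * x) = j}"
      by (intro card_image inj_on_subset[OF inj_on_hyperoctahedral_mult[OF assms]]) auto
    finally show ?thesis by (simp add: sum.inter_filter[symmetric])
  qed
  have "(\<Sum>i=0..N. \<Sum>j=0..N. f i * g j * real (card ((\<lambda>x. k * x) ` ell_class N i \<inter> ell_class N j))) =
      (\<Sum>i=0..N. \<Sum>j=0..N. \<Sum>x\<in>?B. if j = ell N (k * x) then (if i = ell N x then f i * g j else 0) else 0)"
    unfolding card_eq sum_distrib_left by (intro sum.cong refl) auto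
  also have "\<dots> = (\<Sum>x\<in>?B. \<Sum>i=0..N. \<Sum>j=0..N. if j = ell N (k * x) then (if i = ell N x then f i * g j else 0) else 0)"
    by (subst (2) sum.swap, subst sum.swap) (rule refl)
  also have "\<dots> = (\<Sum>x\<in>?B. f (ell N x) * g (ell N (k * x)))"
  proof (rule sum.cong[OF refl])
    fix x assume x: "x \<in> ?B"
    have "ell N x \<le> N" "ell N (k * x) \<le> N"
      using ell_le x hyperoctahedral_mult[OF assms x] by auto
    then show "(\<Sum>i=0..N. \<Sum>j=0..N. if j = ell N (k * x) then (if i = ell N x then f i * g j else 0) else 0) =
        f (ell N x) * g (ell N (k * x))"
      by (simp add: sum.delta)
  qed
  finally show ?thesis .
qed

section \<open>Averages over conjugacy classes\<close>

text \<open>Peels off one of the independent random factors.\<close>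

lemma sum_PiE_dflt_insert:
  assumes "x \<notin> A"
  shows "sum F (PiE_dflt (insert x A) d B) = (\<Sum>y\<in>B x. \<Sum>f\<in>PiE_dflt A d B. F (f(x := y)))"
proof -
  have "sum F (PiE_dflt (insert x A) d B) = (\<Sum>(y, f)\<in>B x \<times> PiE_dflt A d B. F (f(x := y)))"
    using assms
    by (intro sum.reindex_bij_witness[of _ "\<lambda>(y, f). f(x := y)" "\<lambda>k. (k x, k(x := d))"])
      (auto simp: PiE_dflt_def fun_eq_iff)
  then show ?thesis by (simp add: sum.cartesian_product)
qed

lemma PiE_dflt_empty: "PiE_dflt {} d B = {\<lambda>_. d}"
  by (auto simp: PiE_dflt_def)

lemma foldr_mult_in_hyperoctahedral:
  assumes "\<And>u. u \<in> set us \<Longrightarrow> k u \<in> hyperoctahedral N"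
  shows "foldr (\<lambda>u A. k u * A) us (1\<^sub>m N) \<in> hyperoctahedral N"
  using assms by (induction us) (auto simp: one_mat_in_hyperoctahedral intro: hyperoctahedral_mult)

text \<open>The tuple of independent uniform factors is uniform on the finite set of all tuples, so
  the expectation is a sum divided by the number of tuples.\<close>

lemma sum_class_walk:
  fixes f g :: "nat \<Rightarrow> real"
  assumes "\<And>K. K \<in> set Ks \<Longrightarrow> K \<noteq> {} \<and> K \<subseteq> hyperoctahedral N"
  shows "(\<Sum>i=0..N. \<Sum>j=0..N. f i * g j * class_walk N Ks (ell_class N i) (ell_class N j)) =
    (\<Sum>k\<in>PiE_dflt {..<length Ks} (1\<^sub>m N) ((!) Ks). \<Sum>x\<in>hyperoctahedral N.
      f (ell N x) * g (ell N (foldr (\<lambda>u A. k u * A) [0..<length Ks] (1\<^sub>m N) * x)))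
    / real (prod_list (map card Ks))"
proof -
  let ?D = "PiE_dflt {..<length Ks} (1\<^sub>m N) ((!) Ks)"
  let ?P = "\<lambda>k. foldr (\<lambda>u A. k u * A) [0..<length Ks] (1\<^sub>m N)"
  have fin: "finite (Ks ! u)" "Ks ! u \<noteq> {}" "Ks ! u \<subseteq> hyperoctahedral N" if "u < length Ks" for u
    using assms[OF nth_mem[OF that]] finite_subset[OF _ finite_hyperoctahedral] by auto
  have finD: "finite ?D" using fin by (intro finite_PiE_dflt) auto
  have card_prod: "card ?D = (\<Prod>u<length Ks. card (Ks ! u))"
    by (rule card_PiE_dflt) (use fin in auto)
  then have cardD: "card ?D = prod_list (map card Ks)"
    by (simp add: prod.list_conv_set_nth atLeast0LessThan)
  moreover have "(\<Prod>u<length Ks. card (Ks ! u)) \<noteq> 0" using fin by (simp add: card_gt_0_iff)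
  ultimately have D0: "?D \<noteq> {}" using card_prod by (metis card.empty)
  have P: "?P k \<in> hyperoctahedral N" if "k \<in> ?D" for k
    using that fin(3) by (intro foldr_mult_in_hyperoctahedral) (force simp: PiE_dflt_def)
  have walk: "class_walk N Ks S T = (\<Sum>k\<in>?D. real (card ((\<lambda>x. ?P k * x) ` S \<inter> T))) / real (card ?D)" for S T
  proof -
    have "Pi_pmf {..<length Ks} (1\<^sub>m N) (\<lambda>u. pmf_of_set (Ks ! u)) = pmf_of_set ?D"
      by (rule Pi_pmf_of_set) (use fin in auto)
    then show ?thesis
      unfolding class_walk_def by (simp add: integral_pmf_of_set[OF D0 finD])
  qed
  have "(\<Sum>i=0..N. \<Sum>j=0..N. f i * g j * class_walk N Ks (ell_class N i) (ell_class N j)) =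
      (\<Sum>i=0..N. \<Sum>j=0..N. \<Sum>k\<in>?D. f i * g j * real (card ((\<lambda>x. ?P k * x) ` ell_class N i \<inter> ell_class N j)))
      / real (card ?D)"
    unfolding walk by (simp add: sum_divide_distrib sum_distrib_left)
  also have "(\<Sum>i=0..N. \<Sum>j=0..N. \<Sum>k\<in>?D. f i * g j * real (card ((\<lambda>x. ?P k * x) ` ell_class N i \<inter> ell_class N j))) =
      (\<Sum>k\<in>?D. \<Sum>i=0..N. \<Sum>j=0..N. f i * g j * real (card ((\<lambda>x. ?P k * x) ` ell_class N i \<inter> ell_class N j)))"
    by (subst (2) sum.swap, subst sum.swap) (rule refl)
  also have "\<dots> = (\<Sum>k\<in>?D. \<Sum>x\<in>hyperoctahedral N. f (ell N x) * g (ell N (?P k * x)))"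
    using P by (intro sum.cong refl sum_ell_class_pairs) auto
  finally show ?thesis unfolding cardD .
qed

lemma sum_class_walk_2:
  fixes f g :: "nat \<Rightarrow> real"
  assumes "K \<noteq> {}" "K \<subseteq> hyperoctahedral N" "L \<noteq> {}" "L \<subseteq> hyperoctahedral N"
  shows "(\<Sum>i=0..N. \<Sum>j=0..N. f i * g j * class_walk N [K, L] (ell_class N i) (ell_class N j)) =
    (\<Sum>l\<in>L. \<Sum>k\<in>K. \<Sum>x\<in>hyperoctahedral N. f (ell N x) * g (ell N (k * (l * x)))) / (real (card K) * real (card L))"
proof -
  have two: "{..<length [K, L]} = insert 1 (insert 0 {})" by auto
  have sub: "\<And>M. M \<in> set [K, L] \<Longrightarrow> M \<noteq> {} \<and> M \<subseteq> hyperoctahedral N" using assms by auto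
  have upt: "[0..<length [K, L]] = [0, 1]" by (simp add: upt_rec)
  have "(\<Sum>i=0..N. \<Sum>j=0..N. f i * g j * class_walk N [K, L] (ell_class N i) (ell_class N j)) =
    (\<Sum>l\<in>L. \<Sum>k\<in>K. \<Sum>x\<in>hyperoctahedral N. f (ell N x) * g (ell N (k * (l * 1\<^sub>m N) * x)))
      / real (prod_list (map card [K, L]))"
    using sum_class_walk[of "[K, L]" N f g, OF sub, unfolded two upt]
    by (simp add: sum_PiE_dflt_insert PiE_dflt_empty)
  moreover have "k * (l * 1\<^sub>m N) * x = k * (l * x)"
    if "k \<in> K" "l \<in> L" "x \<in> hyperoctahedral N" for k l x
    using hyperoctahedral_carrier[of k N] hyperoctahedral_carrier[of l N] hyperoctahedral_carrier[of x N] that assms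
    by (simp add: assoc_mult_mat[of _ N N _ N _ N] subset_iff)
  ultimately show ?thesis by simp
qed

text \<open>The bracketing isolates the leftmost factor: sums over the signs of \<open>k\<close> and
  of \<open>x\<close> are evaluated first, with the product of the other three factors
  fixed.\<close>

lemma sum_class_walk_4:
  fixes f g :: "nat \<Rightarrow> real"
  assumes "K \<noteq> {}" "K \<subseteq> hyperoctahedral N" "L \<noteq> {}" "L \<subseteq> hyperoctahedral N"
  shows "(\<Sum>i=0..N. \<Sum>j=0..N. f i * g j * class_walk N [K, K, L, L] (ell_class N i) (ell_class N j)) =
    (\<Sum>l'\<in>L. \<Sum>l\<in>L. \<Sum>k'\<in>K. \<Sum>k\<in>K. \<Sum>x\<in>hyperoctahedral N.
      f (ell N x) * g (ell N (k * ((k' * (l * l')) * x)))) / (real (card K) * real (card L)) ^ 2"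
proof -
  have four: "{..<length [K, K, L, L]} = insert 3 (insert 2 (insert 1 (insert 0 {})))" by auto
  have sub: "\<And>M. M \<in> set [K, K, L, L] \<Longrightarrow> M \<noteq> {} \<and> M \<subseteq> hyperoctahedral N" using assms by auto
  have upt: "[0..<length [K, K, L, L]] = [0, 1, 2, 3]" by (simp add: upt_rec)
  have "(\<Sum>i=0..N. \<Sum>j=0..N. f i * g j * class_walk N [K, K, L, L] (ell_class N i) (ell_class N j)) =
    (\<Sum>l'\<in>L. \<Sum>l\<in>L. \<Sum>k'\<in>K. \<Sum>k\<in>K. \<Sum>x\<in>hyperoctahedral N.
      f (ell N x) * g (ell N (k * (k' * (l * (l' * 1\<^sub>m N))) * x))) / real (prod_list (map card [K, K, L, L]))"
    using sum_class_walk[of "[K, K, L, L]" N f g, OF sub, unfolded four upt]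
    by (simp add: sum_PiE_dflt_insert PiE_dflt_empty)
  moreover have "k * (k' * (l * (l' * 1\<^sub>m N))) * x = k * ((k' * (l * l')) * x)"
    if "k \<in> K" "k' \<in> K" "l \<in> L" "l' \<in> L" "x \<in> hyperoctahedral N" for k k' l l' x
  proof -
    have "k \<in> carrier_mat N N" "k' \<in> carrier_mat N N" "l \<in> carrier_mat N N" "l' \<in> carrier_mat N N" "x \<in> carrier_mat N N"
      using that assms by (auto intro!: hyperoctahedral_carrier)
    then show ?thesis by (simp add: assoc_mult_mat[of _ N N _ N _ N])
  qed
  ultimately show ?thesis by (simp add: power2_eq_square ac_simps)
qed

section \<open>Parametrisation of the three conjugacy classes\<close>

definition positive_signs :: "nat \<Rightarrow> (nat \<Rightarrow> int) set" where
  "positive_signs N = {e \<in> signs N. prod e {..<N} = 1}"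

lemma cycles_full_cycle:
  assumes "finite S" "\<kappa> \<in> full_cycles S"
  shows "cycles S \<kappa> = {S}"
proof -
  have "card (cycles S \<kappa>) = 1" "\<kappa> permutes S" using assms(2) by (auto simp: full_cycles_def)
  then obtain C where "cycles S \<kappa> = {C}" by (auto simp: card_1_singleton_iff)
  then show ?thesis using Union_cycles[OF assms(1) \<open>\<kappa> permutes S\<close>] by simp
qed

lemma cycles_pm:
  assumes "e \<in> signs N" "\<pi> permutes {..<N}" "C \<in> cycles {..<N} \<pi>"
  shows "prod e C = 1 \<or> prod e C = -1"
  using assms(3) Union_cycles[OF _ assms(2)] by (intro prod_pm_one signs_pm[OF assms(1)]) auto

lemma class_of_type_eq:
  assumes "\<And>e \<pi>. \<lbrakk>e \<in> signs N; \<pi> permutes {..<N}\<rbrakk> \<Longrightarrow> signed_type N (signed_perm_mat N e \<pi>) = \<tau> \<longleftrightarrow> P e \<pi>"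
  shows "class_of_type N \<tau> = (\<lambda>(e, \<pi>). signed_perm_mat N e \<pi>) `
    {(e, \<pi>). e \<in> signs N \<and> \<pi> permutes {..<N} \<and> P e \<pi>}"
proof (intro equalityI subsetI)
  fix x assume "x \<in> class_of_type N \<tau>"
  then have x: "x \<in> hyperoctahedral N" "signed_type N x = \<tau>" by (auto simp: class_of_type_def)
  obtain e \<pi> where e: "e \<in> signs N" "\<pi> permutes {..<N}" "x = signed_perm_mat N e \<pi>"
    using x(1) by (rule hyperoctahedralE)
  then show "x \<in> (\<lambda>(e, \<pi>). signed_perm_mat N e \<pi>) ` {(e, \<pi>). e \<in> signs N \<and> \<pi> permutes {..<N} \<and> P e \<pi>}"
    using assms[OF e(1,2)] x(2) by (intro image_eqI[of _ _ "(e, \<pi>)"]) auto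
next
  fix x assume "x \<in> (\<lambda>(e, \<pi>). signed_perm_mat N e \<pi>) ` {(e, \<pi>). e \<in> signs N \<and> \<pi> permutes {..<N} \<and> P e \<pi>}"
  then show "x \<in> class_of_type N \<tau>" using assms by (auto simp: class_of_type_def)
qed

lemma full_cycle_class:
  assumes "0 < N"
  shows "class_of_type N ({#N#}, {#}) = (\<lambda>(e, \<pi>). signed_perm_mat N e \<pi>) ` (positive_signs N \<times> full_cycles {..<N})"
proof -
  have "signed_type N (signed_perm_mat N e \<pi>) = ({#N#}, {#}) \<longleftrightarrow> prod e {..<N} = 1 \<and> \<pi> \<in> full_cycles {..<N}"
    if e: "e \<in> signs N" and \<pi>: "\<pi> permutes {..<N}" for e \<pi>
  proof
    let ?C = "cycles {..<N} \<pi>"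
    assume "signed_type N (signed_perm_mat N e \<pi>) = ({#N#}, {#})"
    then have p: "image_mset card (mset_set {C \<in> ?C. prod e C = 1}) = {#N#}"
      and n: "image_mset card (mset_set {C \<in> ?C. prod e C = -1}) = {#}"
      unfolding signed_type_def type_part_signed_perm_mat[OF e \<pi>] by simp_all
    have "{C \<in> ?C. prod e C = -1} = {}" using n by (simp add: mset_set_empty_iff)
    then have all: "{C \<in> ?C. prod e C = 1} = ?C" using cycles_pm[OF e \<pi>] by blast
    have "size (image_mset card (mset_set ?C)) = 1" using p unfolding all by simp
    then have fc: "\<pi> \<in> full_cycles {..<N}" using \<pi> by (simp add: full_cycles_def)
    then have "?C = {{..<N}}" by (intro cycles_full_cycle) auto
    with all fc show "prod e {..<N} = 1 \<and> \<pi> \<in> full_cycles {..<N}" by blast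
  next
    assume a: "prod e {..<N} = 1 \<and> \<pi> \<in> full_cycles {..<N}"
    then have C: "cycles {..<N} \<pi> = {{..<N}}" by (intro cycles_full_cycle) auto
    have split: "{C \<in> {{..<N}}. prod e C = (-1) ^ 0} = {{..<N}}" "{C \<in> {{..<N}}. prod e C = (-1) ^ 1} = {}"
      using a by auto
    show "signed_type N (signed_perm_mat N e \<pi>) = ({#N#}, {#})"
      unfolding signed_type_def type_part_signed_perm_mat[OF e \<pi>] C split by simp
  qed
  then have "class_of_type N ({#N#}, {#}) = (\<lambda>(e, \<pi>). signed_perm_mat N e \<pi>) `
      {(e, \<pi>). e \<in> signs N \<and> \<pi> permutes {..<N} \<and> prod e {..<N} = 1 \<and> \<pi> \<in> full_cycles {..<N}}"
    by (rule class_of_type_eq)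
  moreover have "{(e, \<pi>). e \<in> signs N \<and> \<pi> permutes {..<N} \<and> prod e {..<N} = 1 \<and> \<pi> \<in> full_cycles {..<N}} =
      positive_signs N \<times> full_cycles {..<N}"
    by (auto simp: positive_signs_def full_cycles_def)
  ultimately show ?thesis by simp
qed

text \<open>Signs of an element with a 1-cycle at \<open>v\<close> of sign \<open>\<eta>\<close> and
  a positive cycle on the remaining points. Both classes with a cycle of length \<open>N - 1\<close>
  have this shape: \<open>\<eta> = -1\<close> for a_3 and \<open>\<eta> = 1\<close> for a_4.\<close>

definition near_signs :: "nat \<Rightarrow> int \<Rightarrow> nat \<Rightarrow> (nat \<Rightarrow> int) set" where
  "near_signs N \<eta> v = {e \<in> signs N. e v = \<eta> \<and> prod e ({..<N} - {v}) = 1}"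

lemma prod_near_signs: "\<lbrakk>e \<in> near_signs N \<eta> v; v < N\<rbrakk> \<Longrightarrow> prod e {..<N} = \<eta>"
  by (simp add: near_signs_def prod.remove[of "{..<N}" v])

lemma card_near_signs:
  assumes "2 \<le> N" "v < N" "\<eta> = 1 \<or> \<eta> = -1"
  shows "card (near_signs N \<eta> v) = 2 ^ (N - 2)"
proof -
  let ?R = "{..<N} - {v}"
  have R0: "?R \<noteq> {}"
  proof
    assume "?R = {}"
    then have "card ?R = 0" by (metis card.empty)
    with assms(1,2) show False by simp
  qed
  have "real (card (near_signs N \<eta> v)) = (\<Sum>e\<in>signs N. if e v = \<eta> \<and> prod e ?R = 1 then 1 else 0)"
    unfolding near_signs_def by (subst sum.inter_filter[symmetric]) auto
  \<comment> \<open>The indicator is \<open>(1 + \<eta> * e v) * (1 + prod e ?R) / 4\<close>,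
    expanded; only the constant term survives the summation over \<open>e\<close>.\<close>
  also have "\<dots> = (\<Sum>e\<in>signs N. (of_int (prod e {}) + of_int \<eta> * of_int (prod e {v}) + of_int (prod e ?R)
      + of_int \<eta> * of_int (prod e {..<N})) / 4)"
  proof (rule sum.cong[OF refl])
    fix e assume e: "e \<in> signs N"
    have v: "e v = 1 \<or> e v = -1" by (rule signs_pm[OF e assms(2)])
    have R: "prod e ?R = 1 \<or> prod e ?R = -1" by (intro prod_pm_one signs_pm[OF e]) simp
    have all: "prod e {..<N} = e v * prod e ?R" using assms(2) by (intro prod.remove) auto
    show "(if e v = \<eta> \<and> prod e ?R = 1 then 1 else 0) = (of_int (prod e {}) + of_int \<eta> * of_int (prod e {v}) + of_int (prod e ?R)
      + of_int \<eta> * of_int (prod e {..<N})) / (4 :: real)"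
      unfolding all using v R assms(3) by (elim disjE) (simp_all del: of_int_prod)
  qed
  also have "\<dots> = ((\<Sum>e\<in>signs N. of_int (prod e {})) + of_int \<eta> * (\<Sum>e\<in>signs N. of_int (prod e {v}))
      + (\<Sum>e\<in>signs N. of_int (prod e ?R)) + of_int \<eta> * (\<Sum>e\<in>signs N. of_int (prod e {..<N}))) / 4"
    by (simp only: sum_divide_distrib[symmetric] sum.distrib sum_distrib_left)
  also have "\<dots> = 2 ^ N / 4"
  proof -
    have "(\<Sum>e\<in>signs N. of_int (prod e {v}) :: real) = 0" "(\<Sum>e\<in>signs N. of_int (prod e ?R) :: real) = 0"
      "(\<Sum>e\<in>signs N. of_int (prod e {..<N}) :: real) = 0" "(\<Sum>e\<in>signs N. of_int (prod e {}) :: real) = 2 ^ N"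
      using assms(1,2) R0 by (subst sum_signs_prod; auto)+
    then show ?thesis by simp
  qed
  also have "\<dots> = 2 ^ (N - 2)"
    using assms(1) by (auto simp: power_add dest!: le_Suc_ex)
  finally show ?thesis by (metis of_nat_eq_iff of_nat_numeral of_nat_power)
qed

lemma almost_full_cycle_cycles:
  fixes N :: nat
  assumes "v < N" "2 \<le> N" "\<pi> \<in> full_cycles ({..<N} - {v})"
  shows "\<pi> permutes {..<N}" "cycles {..<N} \<pi> = {{v}, {..<N} - {v}}"
proof -
  have p: "\<pi> permutes {..<N} - {v}" using assms(3) by (rule full_cycles_permutes)
  then show "\<pi> permutes {..<N}" by (rule permutes_subset) auto
  have ins: "insert v ({..<N} - {v}) = {..<N}" using assms(1) by auto
  have "cycles ({..<N} - {v}) \<pi> = {{..<N} - {v}}" using assms(3) by (intro cycles_full_cycle) auto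
  then show "cycles {..<N} \<pi> = {{v}, {..<N} - {v}}"
    using cycles_insert_fixed[OF p, of v] unfolding ins by simp
qed

lemma almost_full_cycleI:
  fixes N :: nat
  assumes "\<pi> permutes {..<N}" "card (cycles {..<N} \<pi>) = 2" "{v} \<in> cycles {..<N} \<pi>"
  shows "v < N" "\<pi> \<in> full_cycles ({..<N} - {v})"
proof -
  have fin: "finite {..<N}" by simp
  show v: "v < N" using Union_cycles[OF fin assms(1)] assms(3) by auto
  obtain x where "{v} = orbit \<pi> x" using assms(3) by (auto simp: cycles_def)
  moreover from this have "v \<in> orbit \<pi> x" by blast
  ultimately have "orbit \<pi> v = {v}" using orbit_eq_permutes[OF fin assms(1), of v x] by metis
  then have "\<pi> v = v" by (simp add: orbit_eq_singleton_iff)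
  then have p: "\<pi> permutes {..<N} - {v}" using assms(1) by (auto simp: permutes_def)
  have ins: "insert v ({..<N} - {v}) = {..<N}" using v by auto
  have "card (cycles {..<N} \<pi>) = Suc (card (cycles ({..<N} - {v}) \<pi>))"
    using card_cycles_insert_fixed[OF _ p, of v] unfolding ins by simp
  then show "\<pi> \<in> full_cycles ({..<N} - {v})" using p assms(2) by (simp add: full_cycles_def)
qed

definition near_type :: "nat \<Rightarrow> int \<Rightarrow> nat multiset \<times> nat multiset" where
  "near_type N \<eta> = (if \<eta> = 1 then ({#N - 1, 1#}, {#}) else ({#N - 1#}, {#1#}))"

lemma signed_type_near_iff:
  assumes "2 \<le> N" "\<eta> = 1 \<or> \<eta> = -1" "e \<in> signs N" "\<pi> permutes {..<N}"
  shows "signed_type N (signed_perm_mat N e \<pi>) = near_type N \<eta> \<longleftrightarrow>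
    (\<exists>v<N. e \<in> near_signs N \<eta> v \<and> \<pi> \<in> full_cycles ({..<N} - {v}))"
proof -
  let ?C = "cycles {..<N} \<pi>"
  let ?P = "{C \<in> ?C. prod e C = 1}" and ?M = "{C \<in> ?C. prod e C = -1}"
  have fin: "finite ?C" by simp
  have PM: "?C = ?P \<union> ?M" "?P \<inter> ?M = {}" using cycles_pm[OF assms(3,4)] by auto
  have ty: "signed_type N (signed_perm_mat N e \<pi>) = (image_mset card (mset_set ?P), image_mset card (mset_set ?M))"
    unfolding signed_type_def type_part_signed_perm_mat[OF assms(3,4)] by simp
  have near: "e \<in> near_signs N \<eta> v \<and> \<pi> \<in> full_cycles ({..<N} - {v})" "v < N"
    if c2: "card ?C = 2" and vC: "{v} \<in> ?C" and ev: "e v = \<eta>" and rest: "\<And>D. \<lbrakk>D \<in> ?C; D \<noteq> {v}\<rbrakk> \<Longrightarrow> prod e D = 1" for v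
  proof -
    show v: "v < N" using almost_full_cycleI[OF assms(4) c2 vC] by simp
    have fc: "\<pi> \<in> full_cycles ({..<N} - {v})" using almost_full_cycleI[OF assms(4) c2 vC] by simp
    have "{..<N} - {v} \<in> ?C" using almost_full_cycle_cycles[OF v assms(1) fc] by simp
    then have "prod e ({..<N} - {v}) = 1" by (rule rest) auto
    then show "e \<in> near_signs N \<eta> v \<and> \<pi> \<in> full_cycles ({..<N} - {v})"
      using fc ev assms(3) by (simp add: near_signs_def)
  qed
  show ?thesis
  proof
    assume "signed_type N (signed_perm_mat N e \<pi>) = near_type N \<eta>"
    then have t: "(image_mset card (mset_set ?P), image_mset card (mset_set ?M)) = near_type N \<eta>" unfolding ty .
    show "\<exists>v<N. e \<in> near_signs N \<eta> v \<and> \<pi> \<in> full_cycles ({..<N} - {v})"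
    proof (cases "\<eta> = 1")
      case True
      then have p: "image_mset card (mset_set ?P) = {#N - 1, 1#}" and n: "image_mset card (mset_set ?M) = {#}"
        using t by (auto simp: near_type_def)
      have "?M = {}" using n fin by (simp add: mset_set_empty_iff)
      then have CP: "?C = ?P" using PM by blast
      have "size (image_mset card (mset_set ?P)) = 2" unfolding p by simp
      then have c2: "card ?C = 2" using CP by simp
      have "1 \<in># image_mset card (mset_set ?P)" unfolding p by simp
      then obtain C where C: "C \<in> ?P" "card C = 1" using fin by auto
      then obtain v where v: "C = {v}" by (auto simp: card_1_singleton_iff)
      have "prod e D = 1" if "D \<in> ?C" "D \<noteq> {v}" for D using that CP by blast
      moreover have "{v} \<in> ?C" "e v = \<eta>" using C v True by auto
      ultimately show ?thesis using near[OF c2, of v] by blast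
    next
      case False
      then have \<eta>: "\<eta> = -1" using assms(2) by simp
      have p: "image_mset card (mset_set ?P) = {#N - 1#}" and n: "image_mset card (mset_set ?M) = {#1#}"
        using t False by (auto simp: near_type_def)
      have "size (image_mset card (mset_set ?P)) = 1" "size (image_mset card (mset_set ?M)) = 1" unfolding p n by simp_all
      then have cP: "card ?P = 1" and cM: "card ?M = 1" by simp_all
      have c2: "card ?C = 2" using card_Un_disjoint[of ?P ?M] PM fin cP cM by simp
      have "1 \<in># image_mset card (mset_set ?M)" unfolding n by simp
      then obtain C where C: "C \<in> ?M" "card C = 1" using fin by auto
      then obtain v where v: "C = {v}" by (auto simp: card_1_singleton_iff)
      obtain X where X: "?M = {X}" using cM by (rule card_1_singletonE)
      have "{v} \<in> ?M" using C(1) unfolding v .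
      with X have M: "?M = {{v}}" by (metis singletonD)
      have "prod e D = 1" if "D \<in> ?C" "D \<noteq> {v}" for D using that M PM(1) by blast
      moreover have "{v} \<in> ?C" "e v = \<eta>" using C v \<eta> by auto
      ultimately show ?thesis using near[OF c2, of v] by blast
    qed
  next
    assume "\<exists>v<N. e \<in> near_signs N \<eta> v \<and> \<pi> \<in> full_cycles ({..<N} - {v})"
    then obtain v where v: "v < N" and e: "e v = \<eta>" "prod e ({..<N} - {v}) = 1" and fc: "\<pi> \<in> full_cycles ({..<N} - {v})"
      by (auto simp: near_signs_def)
    let ?R = "{..<N} - {v}"
    have C: "?C = {{v}, ?R}" using almost_full_cycle_cycles[OF v assms(1) fc] by simp
    have ne: "{v} \<noteq> ?R" by auto
    have cR: "card ?R = N - 1" using v by simp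
    show "signed_type N (signed_perm_mat N e \<pi>) = near_type N \<eta>"
    proof (cases "\<eta> = 1")
      case True
      then have PM: "?P = {{v}, ?R}" "?M = {}" unfolding C using e by auto
      show ?thesis unfolding ty PM using ne cR True by (simp add: near_type_def add_mset_commute)
    next
      case False
      then have "\<eta> = -1" using assms(2) by simp
      then have PM: "?P = {?R}" "?M = {{v}}" unfolding C using e by auto
      show ?thesis unfolding ty PM using cR False by (simp add: near_type_def)
    qed
  qed
qed

text \<open>The map from triples \<open>(v, \<kappa>, e)\<close> onto the class has fibres of
  constant size \<open>c\<close>. The size is kept existential since it cancels in averages.\<close>

lemma sum_near_class:
  fixes F :: "int mat \<Rightarrow> real"
  assumes "2 \<le> N" "\<eta> = 1 \<or> \<eta> = -1"
  shows "\<exists>c>0. \<forall>F :: int mat \<Rightarrow> real. (\<Sum>v<N. \<Sum>\<kappa>\<in>full_cycles ({..<N} - {v}). \<Sum>e\<in>near_signs N \<eta> v. F (signed_perm_mat N e \<kappa>)) =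
    c * sum F (class_of_type N (near_type N \<eta>))"
proof -
  let ?A = "signs N \<times> {\<pi>. \<pi> permutes {..<N}}"
  let ?Q = "\<lambda>v e \<pi>. e \<in> near_signs N \<eta> v \<and> \<pi> \<in> full_cycles ({..<N} - {v})"
  let ?V = "\<lambda>e \<pi>. {v \<in> {..<N}. ?Q v e \<pi>}"
  \<comment> \<open>The element determines \<open>v\<close> except for \<open>N = 2\<close> and
    \<open>\<eta> = 1\<close>, where the class consists of the identity, which has two positive
    1-cycles.\<close>
  define c :: nat where "c = (if N = 2 \<and> \<eta> = 1 then 2 else 1)"
  have finA: "finite ?A" by (intro finite_cartesian_product finite_permutations) auto
  have mult: "card (?V e \<pi>) = c" if Q: "?Q v e \<pi>" and v: "v < N" for v e \<pi>
  proof -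
    have other: "{v'} = {..<N} - {v}" if "?Q v' e \<pi>" "v' < N" "v' \<noteq> v" for v'
    proof -
      have "{{v'}, {..<N} - {v'}} = {{v}, {..<N} - {v}}"
        using almost_full_cycle_cycles(2)[OF v assms(1)] almost_full_cycle_cycles(2)[OF that(2) assms(1)] Q that(1) by metis
      then show ?thesis using that(3) by (metis insertE insertI1 singletonD singleton_inject)
    qed
    show ?thesis
    proof (cases "N = 2 \<and> \<eta> = 1")
      case True
      define v' where "v' = 1 - v"
      have R: "{..<N} - {v} = {v'}" "{..<N} - {v'} = {v}" "v' < N" "v' \<noteq> v"
      proof -
        have v01: "v = 0 \<or> v = 1" and L: "{..<N} = {0, 1}" using True v by (auto simp: numeral_2_eq_2)
        show "{..<N} - {v} = {v'}" "{..<N} - {v'} = {v}" unfolding L v'_def using v01 by auto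
        show "v' < N" "v' \<noteq> v" using v01 True v by (auto simp: v'_def)
      qed
      have Q': "?Q v' e \<pi>"
        using Q True unfolding near_signs_def R(1,2) by (auto simp: full_cycles_singleton)
      have "{..<N} = {v, v'}" using R(1) v by blast
      then have "?Q u e \<pi>" if "u < N" for u
        using that Q Q' by (metis insertE lessThan_iff singletonD)
      then have "?V e \<pi> = {..<N}" by (simp only: Collect_mem_eq lessThan_iff simp_thms cong: conj_cong) (simp only: lessThan_def)
      then show ?thesis using True by (simp add: c_def)
    next
      case False
      have "v' = v" if v': "?Q v' e \<pi>" "v' < N" for v'
      proof (rule ccontr)
        assume "v' \<noteq> v"
        then have R: "{v'} = {..<N} - {v}" using other v' by blast
        have "card ({..<N} - {v}) = 1" unfolding R[symmetric] by simp
        then have "N = 2" using v by simp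
        with False assms(2) have "\<eta> = -1" by simp
        moreover have "prod e {v'} = 1" unfolding R using Q by (simp add: near_signs_def)
        ultimately show False using v' by (simp add: near_signs_def)
      qed
      then have "?V e \<pi> = {v}" using Q v by blast
      then show ?thesis using False by (auto simp: c_def)
    qed
  qed
  have "(\<Sum>v<N. \<Sum>\<kappa>\<in>full_cycles ({..<N} - {v}). \<Sum>e\<in>near_signs N \<eta> v. F (signed_perm_mat N e \<kappa>)) =
      real c * sum F (class_of_type N (near_type N \<eta>))" for F :: "int mat \<Rightarrow> real"
  proof -
    let ?F = "\<lambda>(e, \<pi>). F (signed_perm_mat N e \<pi>)"
    have "(\<Sum>v<N. \<Sum>\<kappa>\<in>full_cycles ({..<N} - {v}). \<Sum>e\<in>near_signs N \<eta> v. F (signed_perm_mat N e \<kappa>)) =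
        (\<Sum>v<N. \<Sum>z\<in>?A. if ?Q v (fst z) (snd z) then ?F z else 0)"
    proof (rule sum.cong[OF refl])
      fix v assume "v \<in> {..<N}"
      then have v: "v < N" by simp
      have "(\<Sum>\<kappa>\<in>full_cycles ({..<N} - {v}). \<Sum>e\<in>near_signs N \<eta> v. F (signed_perm_mat N e \<kappa>)) =
          (\<Sum>z\<in>near_signs N \<eta> v \<times> full_cycles ({..<N} - {v}). ?F z)"
        by (subst sum.swap) (simp add: sum.cartesian_product)
      also have "near_signs N \<eta> v \<times> full_cycles ({..<N} - {v}) = {z \<in> ?A. ?Q v (fst z) (snd z)}"
        using almost_full_cycle_cycles(1)[OF v assms(1)] by (auto simp: near_signs_def)
      also have "(\<Sum>z\<in>{z \<in> ?A. ?Q v (fst z) (snd z)}. ?F z) = (\<Sum>z\<in>?A. if ?Q v (fst z) (snd z) then ?F z else 0)"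
        by (rule sum.inter_filter[OF finA])
      finally show "(\<Sum>\<kappa>\<in>full_cycles ({..<N} - {v}). \<Sum>e\<in>near_signs N \<eta> v. F (signed_perm_mat N e \<kappa>)) =
          (\<Sum>z\<in>?A. if ?Q v (fst z) (snd z) then ?F z else 0)" .
    qed
    also have "\<dots> = (\<Sum>z\<in>?A. real (card (?V (fst z) (snd z))) * ?F z)"
      by (subst sum.swap) (simp add: sum.inter_filter[symmetric])
    also have "\<dots> = (\<Sum>z\<in>?A. if (\<exists>v<N. ?Q v (fst z) (snd z)) then real c * ?F z else 0)"
    proof (rule sum.cong[OF refl])
      fix z
      show "real (card (?V (fst z) (snd z))) * ?F z = (if (\<exists>v<N. ?Q v (fst z) (snd z)) then real c * ?F z else 0)"
      proof (cases "\<exists>v<N. ?Q v (fst z) (snd z)")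
        case True
        then obtain v where "v < N" "?Q v (fst z) (snd z)" by blast
        then show ?thesis using mult[where v = v and e = "fst z" and \<pi> = "snd z"] True by simp
      next
        case False
        then have V: "?V (fst z) (snd z) = {}" by blast
        show ?thesis unfolding V by (simp only: False if_False card.empty of_nat_0 mult_zero_left)
      qed
    qed
    also have "\<dots> = (\<Sum>z\<in>{z \<in> ?A. \<exists>v<N. ?Q v (fst z) (snd z)}. real c * ?F z)"
      by (rule sum.inter_filter[OF finA, symmetric])
    also have "{z \<in> ?A. \<exists>v<N. ?Q v (fst z) (snd z)} =
        {(e, \<pi>). e \<in> signs N \<and> \<pi> permutes {..<N} \<and> (\<exists>v<N. ?Q v e \<pi>)}" by auto
    also have "(\<Sum>z\<in>\<dots>. real c * ?F z) = real c * (\<Sum>z\<in>{(e, \<pi>). e \<in> signs N \<and> \<pi> permutes {..<N} \<and> (\<exists>v<N. ?Q v e \<pi>)}. ?F z)"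
      by (simp add: sum_distrib_left)
    also have "(\<Sum>z\<in>{(e, \<pi>). e \<in> signs N \<and> \<pi> permutes {..<N} \<and> (\<exists>v<N. ?Q v e \<pi>)}. ?F z) =
        sum F (class_of_type N (near_type N \<eta>))"
    proof -
      have "class_of_type N (near_type N \<eta>) = (\<lambda>(e, \<pi>). signed_perm_mat N e \<pi>) `
          {(e, \<pi>). e \<in> signs N \<and> \<pi> permutes {..<N} \<and> (\<exists>v<N. ?Q v e \<pi>)}"
        by (rule class_of_type_eq) (rule signed_type_near_iff[OF assms])
      moreover have inj: "inj_on (\<lambda>(e, \<pi>). signed_perm_mat N e \<pi>)
          {(e, \<pi>). e \<in> signs N \<and> \<pi> permutes {..<N} \<and> (\<exists>v<N. ?Q v e \<pi>)}"
        by (rule inj_on_subset[OF inj_signed_perm_mat]) auto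
      ultimately show ?thesis
        using sum.reindex[OF inj, of F] by (simp add: case_prod_beta comp_def)
    qed
    finally show ?thesis .
  qed
  moreover have "real c > 0" by (simp add: c_def)
  ultimately show ?thesis by blast
qed

lemma class_of_type_subset: "class_of_type N \<tau> \<subseteq> hyperoctahedral N"
  by (auto simp: class_of_type_def)

text \<open>The values of \<open>F\<close> do not depend on the signs, and the number of sign
  vectors as well as the fibre size is constant. These cancel, and \<open>N (N - 2)!\<close> is the
  number of pairs \<open>(v, \<kappa>)\<close>.\<close>

lemma average_near_class:
  fixes F :: "int mat \<Rightarrow> real"
  assumes "2 \<le> N" "\<eta> = 1 \<or> \<eta> = -1"
    and F: "\<And>e \<kappa> v. \<lbrakk>v < N; e \<in> near_signs N \<eta> v; \<kappa> \<in> full_cycles ({..<N} - {v})\<rbrakk> \<Longrightarrow> F (signed_perm_mat N e \<kappa>) = G \<kappa>"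
  defines "K \<equiv> class_of_type N (near_type N \<eta>)"
  shows "K \<noteq> {}" "sum F K / real (card K) =
    (\<Sum>v<N. \<Sum>\<kappa>\<in>full_cycles ({..<N} - {v}). G \<kappa>) / (real N * fact (N - 2))"
proof -
  obtain c where c: "c > 0" and eq: "\<And>F :: int mat \<Rightarrow> real.
      (\<Sum>v<N. \<Sum>\<kappa>\<in>full_cycles ({..<N} - {v}). \<Sum>e\<in>near_signs N \<eta> v. F (signed_perm_mat N e \<kappa>)) = c * sum F K"
    using sum_near_class[OF assms(1,2)] unfolding K_def by blast
  have cfc: "card (full_cycles ({..<N} - {v})) = fact (N - 2)" if "v < N" for v
  proof -
    have c1: "card ({..<N} - {v}) = N - 1" using that by simp
    then have "{..<N} - {v} \<noteq> {}" using assms(1) by (metis card.empty diff_is_0_eq not_less_eq_eq numeral_2_eq_2 One_nat_def)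
    then show ?thesis using card_full_cycles[of "{..<N} - {v}"] c1 by (simp add: numeral_2_eq_2)
  qed
  have "c * real (card K) = (\<Sum>v<N. \<Sum>\<kappa>\<in>full_cycles ({..<N} - {v}). \<Sum>e\<in>near_signs N \<eta> v. 1)"
    unfolding eq[of "\<lambda>_. 1"] by simp
  also have "\<dots> = (\<Sum>v<N. fact (N - 2) * 2 ^ (N - 2))"
    using cfc card_near_signs[OF assms(1) _ assms(2)] by (intro sum.cong refl) simp
  finally have cK: "c * real (card K) = real N * fact (N - 2) * 2 ^ (N - 2)" by simp
  moreover have "real N * fact (N - 2) * 2 ^ (N - 2) \<noteq> (0 :: real)" using assms(1) by simp
  ultimately have "real (card K) \<noteq> 0" by (metis mult_zero_right)
  then show "K \<noteq> {}" by auto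
  have "c * sum F K = (\<Sum>v<N. \<Sum>\<kappa>\<in>full_cycles ({..<N} - {v}). 2 ^ (N - 2) * G \<kappa>)"
    unfolding eq[symmetric] using F card_near_signs[OF assms(1) _ assms(2)]
    by (intro sum.cong refl) simp
  then have cF: "c * sum F K = 2 ^ (N - 2) * (\<Sum>v<N. \<Sum>\<kappa>\<in>full_cycles ({..<N} - {v}). G \<kappa>)"
    by (simp add: sum_distrib_left)
  have "sum F K / real (card K) = (c * sum F K) / (c * real (card K))" using c by simp
  then show "sum F K / real (card K) = (\<Sum>v<N. \<Sum>\<kappa>\<in>full_cycles ({..<N} - {v}). G \<kappa>) / (real N * fact (N - 2))"
    unfolding cF cK by simp
qed

lemma card_positive_signs: "0 < N \<Longrightarrow> card (positive_signs N) = 2 ^ (N - 1)"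
proof -
  assume N: "0 < N"
  have "real (card (positive_signs N)) = (\<Sum>e\<in>signs N. if prod e {..<N} = 1 then 1 else 0)"
    unfolding positive_signs_def by (subst sum.inter_filter[symmetric]) auto
  also have "\<dots> = (\<Sum>e\<in>signs N. (of_int (prod e {}) + of_int (prod e {..<N})) / 2)"
  proof (rule sum.cong[OF refl])
    fix e assume e: "e \<in> signs N"
    have "prod e {..<N} = 1 \<or> prod e {..<N} = -1" by (intro prod_pm_one signs_pm[OF e]) simp
    then show "(if prod e {..<N} = 1 then 1 else 0) = (of_int (prod e {}) + of_int (prod e {..<N})) / (2 :: real)"
      by (elim disjE) (simp_all del: of_int_prod)
  qed
  also have "\<dots> = ((\<Sum>e\<in>signs N. of_int (prod e {})) + (\<Sum>e\<in>signs N. of_int (prod e {..<N}))) / 2"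
    by (simp only: sum_divide_distrib[symmetric] sum.distrib)
  also have "\<dots> = 2 ^ N / 2"
  proof -
    have "(\<Sum>e\<in>signs N. of_int (prod e {..<N}) :: real) = 0" "(\<Sum>e\<in>signs N. of_int (prod e {}) :: real) = 2 ^ N"
      using N by (subst sum_signs_prod; auto)+
    then show ?thesis by simp
  qed
  also have "\<dots> = 2 ^ (N - 1)" using N by (cases N) auto
  finally show ?thesis by (metis of_nat_eq_iff of_nat_numeral of_nat_power)
qed

lemma sum_full_cycle_class:
  assumes "0 < N"
  shows "sum F (class_of_type N ({#N#}, {#})) =
    (\<Sum>\<kappa>\<in>full_cycles {..<N}. \<Sum>e\<in>positive_signs N. F (signed_perm_mat N e \<kappa>))"
proof -
  have inj: "inj_on (\<lambda>(e, \<pi>). signed_perm_mat N e \<pi>) (positive_signs N \<times> full_cycles {..<N})"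
    by (rule inj_on_subset[OF inj_signed_perm_mat]) (auto simp: positive_signs_def full_cycles_def)
  show ?thesis
    unfolding full_cycle_class[OF assms] sum.reindex[OF inj]
      sum.swap[of _ "positive_signs N" "full_cycles {..<N}"]
    by (simp add: sum.cartesian_product case_prod_beta comp_def)
qed

lemma card_full_cycle_class:
  assumes "0 < N"
  shows "card (class_of_type N ({#N#}, {#})) = 2 ^ (N - 1) * fact (N - 1)"
proof -
  have "card (class_of_type N ({#N#}, {#})) = (\<Sum>x\<in>class_of_type N ({#N#}, {#}). 1)" by simp
  also have "\<dots> = 2 ^ (N - 1) * fact (N - 1)"
    unfolding sum_full_cycle_class[OF assms]
    using card_positive_signs[OF assms] card_full_cycles[of "{..<N}"] assms by (simp add: lessThan_empty_iff)
  finally show ?thesis .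
qed

lemma average_full_cycle_class:
  fixes F :: "int mat \<Rightarrow> real"
  assumes "0 < N"
    and F: "\<And>e \<kappa>. \<lbrakk>e \<in> positive_signs N; \<kappa> \<in> full_cycles {..<N}\<rbrakk> \<Longrightarrow> F (signed_perm_mat N e \<kappa>) = G \<kappa>"
  defines "K \<equiv> class_of_type N ({#N#}, {#})"
  shows "K \<noteq> {}" "sum F K / real (card K) = (\<Sum>\<kappa>\<in>full_cycles {..<N}. G \<kappa>) / fact (N - 1)"
proof -
  have cK: "card K = 2 ^ (N - 1) * fact (N - 1)" unfolding K_def by (rule card_full_cycle_class[OF assms(1)])
  then have "card K \<noteq> 0" by simp
  then show "K \<noteq> {}" by auto
  have "sum F K = 2 ^ (N - 1) * (\<Sum>\<kappa>\<in>full_cycles {..<N}. G \<kappa>)"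
    unfolding K_def sum_full_cycle_class[OF assms(1)]
    using F card_positive_signs[OF assms(1)] by (simp add: sum_distrib_left)
  then show "sum F K / real (card K) = (\<Sum>\<kappa>\<in>full_cycles {..<N}. G \<kappa>) / fact (N - 1)"
    unfolding cK by simp
qed

section \<open>Evaluation of the three walks\<close>

definition cycle_pairing :: "nat \<Rightarrow> nat \<Rightarrow> nat \<Rightarrow> (nat \<Rightarrow> nat) \<Rightarrow> real" where
  "cycle_pairing N m l \<sigma> = (\<Sum>\<pi> | \<pi> permutes {..<N}.
    real m ^ card (cycles {..<N} \<pi>) * real l ^ card (cycles {..<N} (\<sigma> \<circ> \<pi>)))"

text \<open>The sum over the signs of \<open>k\<close> yields the power of \<open>j + 1\<close> plus
  the power of \<open>j\<close> times the total signs of \<open>e\<close> and of \<open>x\<close>.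
  The first part leaves the sum over the signs of \<open>x\<close> untwisted, which produces
  \<open>i + 1\<close>; the second twists it by the total sign, which produces \<open>i\<close>.
  Hence no mixed pairings occur.\<close>

lemma sum_full_cycle_class_pairing:
  assumes "0 < N" "e \<in> signs N" "\<gamma> permutes {..<N}"
  shows "(\<Sum>k\<in>class_of_type N ({#N#}, {#}). \<Sum>x\<in>hyperoctahedral N.
      (2 * real i + 1) ^ ell N x * (2 * real j + 1) ^ ell N (k * (signed_perm_mat N e \<gamma> * x))) =
    2 ^ (N - 1) * 2 ^ N * (\<Sum>\<kappa>\<in>full_cycles {..<N}. cycle_pairing N (Suc i) (Suc j) (\<kappa> \<circ> \<gamma>)
      + of_int (prod e {..<N}) * cycle_pairing N i j (\<kappa> \<circ> \<gamma>))"
proof -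
  let ?P = "{\<pi>. \<pi> permutes {..<N}}"
  let ?p = "\<lambda>a \<pi>. (2 * real i + 1) ^ ell N (signed_perm_mat N a \<pi>)"
  let ?c = "\<lambda>\<pi>. card (cycles {..<N} \<pi>)"
  let ?q = "\<lambda>e1 \<kappa> a \<pi>. (2 * real j + 1) ^ ell N (signed_perm_mat N e1 \<kappa> * (signed_perm_mat N e \<gamma> * signed_perm_mat N a \<pi>))"
  have inner: "(\<Sum>e1\<in>positive_signs N. ?q e1 \<kappa> a \<pi>) =
      2 ^ (N - 1) * (real (Suc j) ^ ?c (\<kappa> \<circ> \<gamma> \<circ> \<pi>) + of_int (prod e {..<N} * prod a {..<N}) * real j ^ ?c (\<kappa> \<circ> \<gamma> \<circ> \<pi>))"
    if "\<kappa> \<in> full_cycles {..<N}" "a \<in> signs N" "\<pi> \<in> ?P" for \<kappa> a \<pi>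
  proof -
    have \<pi>: "\<pi> permutes {..<N}" using that by simp
    note sh = signs_shift[OF assms(2) that(2) \<pi>]
    have "\<gamma> \<circ> \<pi> permutes {..<N}" using \<pi> assms(3) by (rule permutes_compose)
    from sum_positive_signs_power_ell[OF sh(1) full_cycles_permutes[OF that(1)] this assms(1), of j]
    show ?thesis
      unfolding signed_perm_mat_mult[OF \<pi>] positive_signs_def sh(2)
      by (simp add: comp_assoc add.commute)
  qed
  have "(\<Sum>k\<in>class_of_type N ({#N#}, {#}). \<Sum>x\<in>hyperoctahedral N.
      (2 * real i + 1) ^ ell N x * (2 * real j + 1) ^ ell N (k * (signed_perm_mat N e \<gamma> * x))) =
      (\<Sum>\<kappa>\<in>full_cycles {..<N}. \<Sum>e1\<in>positive_signs N. \<Sum>a\<in>signs N. \<Sum>\<pi>\<in>?P. ?p a \<pi> * ?q e1 \<kappa> a \<pi>)"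
    unfolding sum_full_cycle_class[OF assms(1)] sum_hyperoctahedral ..
  also have "\<dots> = (\<Sum>\<kappa>\<in>full_cycles {..<N}. \<Sum>\<pi>\<in>?P. \<Sum>a\<in>signs N. ?p a \<pi> * (\<Sum>e1\<in>positive_signs N. ?q e1 \<kappa> a \<pi>))"
  proof (rule sum.cong[OF refl])
    fix \<kappa>
    have "(\<Sum>e1\<in>positive_signs N. \<Sum>a\<in>signs N. \<Sum>\<pi>\<in>?P. ?p a \<pi> * ?q e1 \<kappa> a \<pi>) =
        (\<Sum>a\<in>signs N. \<Sum>e1\<in>positive_signs N. \<Sum>\<pi>\<in>?P. ?p a \<pi> * ?q e1 \<kappa> a \<pi>)" by (rule sum.swap)
    also have "\<dots> = (\<Sum>a\<in>signs N. \<Sum>\<pi>\<in>?P. \<Sum>e1\<in>positive_signs N. ?p a \<pi> * ?q e1 \<kappa> a \<pi>)"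
      by (rule sum.cong[OF refl], rule sum.swap)
    also have "\<dots> = (\<Sum>\<pi>\<in>?P. \<Sum>a\<in>signs N. \<Sum>e1\<in>positive_signs N. ?p a \<pi> * ?q e1 \<kappa> a \<pi>)"
      by (rule sum.swap)
    finally show "(\<Sum>e1\<in>positive_signs N. \<Sum>a\<in>signs N. \<Sum>\<pi>\<in>?P. ?p a \<pi> * ?q e1 \<kappa> a \<pi>) =
        (\<Sum>\<pi>\<in>?P. \<Sum>a\<in>signs N. ?p a \<pi> * (\<Sum>e1\<in>positive_signs N. ?q e1 \<kappa> a \<pi>))"
      by (simp only: sum_distrib_left)
  qed
  also have "\<dots> = (\<Sum>\<kappa>\<in>full_cycles {..<N}. \<Sum>\<pi>\<in>?P. 2 ^ (N - 1) * 2 ^ N *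
      (real (Suc i) ^ ?c \<pi> * real (Suc j) ^ ?c (\<kappa> \<circ> \<gamma> \<circ> \<pi>)
        + of_int (prod e {..<N}) * (real i ^ ?c \<pi> * real j ^ ?c (\<kappa> \<circ> \<gamma> \<circ> \<pi>))))"
  proof (rule sum.cong[OF refl], rule sum.cong[OF refl])
    fix \<kappa> \<pi> assume \<kappa>: "\<kappa> \<in> full_cycles {..<N}" and \<pi>: "\<pi> \<in> ?P"
    define A where "A = real (Suc j) ^ ?c (\<kappa> \<circ> \<gamma> \<circ> \<pi>)"
    define B where "B = of_int (prod e {..<N}) * real j ^ ?c (\<kappa> \<circ> \<gamma> \<circ> \<pi>)"
    have "(\<Sum>a\<in>signs N. ?p a \<pi> * (\<Sum>e1\<in>positive_signs N. ?q e1 \<kappa> a \<pi>)) =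
        (\<Sum>a\<in>signs N. 2 ^ (N - 1) * (A * ?p a \<pi> + B * (of_int (prod a {..<N}) * ?p a \<pi>)))"
    proof (rule sum.cong[OF refl])
      fix a assume "a \<in> signs N"
      from inner[OF \<kappa> this \<pi>]
      show "?p a \<pi> * (\<Sum>e1\<in>positive_signs N. ?q e1 \<kappa> a \<pi>) =
          2 ^ (N - 1) * (A * ?p a \<pi> + B * (of_int (prod a {..<N}) * ?p a \<pi>))"
        unfolding A_def B_def by (simp add: algebra_simps del: of_int_prod)
    qed
    also have "\<dots> = 2 ^ (N - 1) * (A * (\<Sum>a\<in>signs N. ?p a \<pi>) + B * (\<Sum>a\<in>signs N. of_int (prod a {..<N}) * ?p a \<pi>))"
      by (simp only: sum_distrib_left[symmetric] sum.distrib)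
    also have "\<dots> = 2 ^ (N - 1) * (A * (2 ^ N * (real i + 1) ^ ?c \<pi>) + B * (2 ^ N * real i ^ ?c \<pi>))"
      using sum_signs_power_ell[OF _ assms(1), of \<pi> i] \<pi> by simp
    finally show "(\<Sum>a\<in>signs N. ?p a \<pi> * (\<Sum>e1\<in>positive_signs N. ?q e1 \<kappa> a \<pi>)) =
        2 ^ (N - 1) * 2 ^ N * (real (Suc i) ^ ?c \<pi> * real (Suc j) ^ ?c (\<kappa> \<circ> \<gamma> \<circ> \<pi>)
        + of_int (prod e {..<N}) * (real i ^ ?c \<pi> * real j ^ ?c (\<kappa> \<circ> \<gamma> \<circ> \<pi>)))"
      unfolding A_def B_def by (simp add: algebra_simps del: of_int_prod)
  qed
  also have "\<dots> = 2 ^ (N - 1) * 2 ^ N * (\<Sum>\<kappa>\<in>full_cycles {..<N}. cycle_pairing N (Suc i) (Suc j) (\<kappa> \<circ> \<gamma>)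
      + of_int (prod e {..<N}) * cycle_pairing N i j (\<kappa> \<circ> \<gamma>))"
    unfolding cycle_pairing_def by (simp only: sum_distrib_left[symmetric] sum.distrib)
  finally show ?thesis .
qed

text \<open>The \<open>k\<close>-th summand comes from the hook \<open>(N - k, 1^k)\<close>.\<close>

definition hook_pairing :: "nat \<Rightarrow> nat \<Rightarrow> nat \<Rightarrow> real" where
  "hook_pairing N m l = (\<Sum>k<N. of_nat ((m + N - 1 - k) choose N) * of_nat ((l + N - 1 - k) choose N))"

text \<open>The contribution of the trivial character plus \<open>\<epsilon>\<close> times that of
  the sign character; \<open>\<epsilon>\<close> is -1 for a walk on odd permutations and 1 for one
  on even permutations.\<close>

definition parity_pairing :: "nat \<Rightarrow> real \<Rightarrow> nat \<Rightarrow> nat \<Rightarrow> real" where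
  "parity_pairing N \<epsilon> m l = of_nat ((m + N - 1) choose N) * of_nat ((l + N - 1) choose N)
    + \<epsilon> * (of_nat (m choose N) * of_nat (l choose N))"

lemma fact_split: "0 < N \<Longrightarrow> fact N = real N * fact (N - 1)"
  by (simp add: fact_reduce)

lemma sum_cycle_pairing_parity:
  assumes "0 < N"
  shows "(\<Sum>\<sigma> | \<sigma> permutes {..<N}. (1 + \<epsilon> * of_int (sign \<sigma>)) * cycle_pairing N m l \<sigma>) =
    fact N ^ 2 * parity_pairing N \<epsilon> m l"
  unfolding cycle_pairing_def parity_pairing_def
  using sum_parity_power_cycles[of "{..<N}" \<epsilon> m l] assms by (simp add: lessThan_empty_iff)

text \<open>All signs in the class multiply to 1, so the inner sum \<open>\<Lambda>\<close> depends
  on the right factor only through its permutation, and the average becomes a double sum over full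
  cycles.\<close>

lemma walk_full_full:
  assumes "2 \<le> N"
  defines "K \<equiv> class_of_type N ({#N#}, {#})"
  shows "(\<Sum>a=0..N. \<Sum>b=0..N. (2 * real i + 1) ^ a * (2 * real j + 1) ^ b *
      class_walk N [K, K] (ell_class N a) (ell_class N b)) =
    2 ^ N * fact N * (hook_pairing N (Suc i) (Suc j) + hook_pairing N i j)"
proof -
  have N0: "0 < N" using assms(1) by simp
  let ?F = "full_cycles {..<N}" and ?A = "cycle_pairing N (Suc i) (Suc j)" and ?A' = "cycle_pairing N i j"
  define \<Lambda> where "\<Lambda> l = (\<Sum>k\<in>K. \<Sum>x\<in>hyperoctahedral N.
      (2 * real i + 1) ^ ell N x * (2 * real j + 1) ^ ell N (k * (l * x)))" for l
  define G where "G \<gamma> = 2 ^ (N - 1) * 2 ^ N * (\<Sum>\<kappa>\<in>?F. ?A (\<kappa> \<circ> \<gamma>) + ?A' (\<kappa> \<circ> \<gamma>))" for \<gamma>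
  have \<Lambda>: "\<Lambda> (signed_perm_mat N e \<gamma>) = G \<gamma>" if "e \<in> positive_signs N" "\<gamma> \<in> ?F" for e \<gamma>
  proof -
    have e: "e \<in> signs N" and pe: "prod e {..<N} = 1" using that(1) by (auto simp: positive_signs_def)
    from sum_full_cycle_class_pairing[OF N0 e full_cycles_permutes[OF that(2)], of i j]
    show ?thesis unfolding \<Lambda>_def G_def K_def pe by simp
  qed
  have K0: "K \<noteq> {}" and avg: "sum \<Lambda> K / real (card K) = (\<Sum>\<gamma>\<in>?F. G \<gamma>) / fact (N - 1)"
    using average_full_cycle_class[where F = \<Lambda> and G = G, OF N0 \<Lambda>] unfolding K_def by blast+
  have KB: "K \<subseteq> hyperoctahedral N" unfolding K_def by (rule class_of_type_subset)
  have cK: "real (card K) = 2 ^ (N - 1) * fact (N - 1)"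
    unfolding K_def card_full_cycle_class[OF N0] by simp
  have sums: "(\<Sum>\<gamma>\<in>?F. \<Sum>\<kappa>\<in>?F. cycle_pairing N m l (\<kappa> \<circ> \<gamma>)) = fact (N - 1) ^ 2 * fact N * hook_pairing N m l" for m l
  proof -
    have "(\<Sum>\<gamma>\<in>?F. \<Sum>\<kappa>\<in>?F. cycle_pairing N m l (\<kappa> \<circ> \<gamma>)) = (\<Sum>\<kappa>\<in>?F. \<Sum>\<gamma>\<in>?F. cycle_pairing N m l (\<kappa> \<circ> \<gamma>))"
      by (rule sum.swap)
    also have "\<dots> = fact (N - 1) ^ 2 * fact N * hook_pairing N m l"
      unfolding cycle_pairing_def hook_pairing_def
      using sum_full_cycles_pair[of "{..<N}" m l] N0 by (simp add: lessThan_empty_iff)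
    finally show ?thesis .
  qed
  have GG: "(\<Sum>\<gamma>\<in>?F. G \<gamma>) = 2 ^ (N - 1) * 2 ^ N * (fact (N - 1) ^ 2 * fact N *
      (hook_pairing N (Suc i) (Suc j) + hook_pairing N i j))"
    unfolding G_def sum_distrib_left[symmetric] sum.distrib sums by (simp add: algebra_simps)
  have "(\<Sum>a=0..N. \<Sum>b=0..N. (2 * real i + 1) ^ a * (2 * real j + 1) ^ b *
      class_walk N [K, K] (ell_class N a) (ell_class N b)) = (sum \<Lambda> K / real (card K)) / real (card K)"
    unfolding sum_class_walk_2[OF K0 KB K0 KB] \<Lambda>_def by simp
  also have "\<dots> = 2 ^ N * fact N * (hook_pairing N (Suc i) (Suc j) + hook_pairing N i j)"
    unfolding avg GG unfolding cK by (simp add: field_simps power2_eq_square)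
  finally show ?thesis .
qed

text \<open>The negative 1-cycle makes the total sign -1, so the pairing at \<open>(i, j)\<close> is
  subtracted; the product of the two permutations is odd, which gives the parameter -1 of
  \<open>parity_pairing\<close>.\<close>

lemma walk_full_near:
  assumes "2 \<le> N"
  defines "K \<equiv> class_of_type N ({#N#}, {#})" and "L \<equiv> class_of_type N (near_type N (-1))"
  shows "(\<Sum>a=0..N. \<Sum>b=0..N. (2 * real i + 1) ^ a * (2 * real j + 1) ^ b *
      class_walk N [K, L] (ell_class N a) (ell_class N b)) =
    2 ^ N * fact N * (parity_pairing N (-1) (Suc i) (Suc j) - parity_pairing N (-1) i j)"
proof -
  have N0: "0 < N" using assms(1) by simp
  let ?F = "full_cycles {..<N}" and ?A = "cycle_pairing N (Suc i) (Suc j)" and ?A' = "cycle_pairing N i j"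
  let ?R = "\<lambda>v. full_cycles ({..<N} - {v})"
  define \<Lambda> where "\<Lambda> l = (\<Sum>k\<in>K. \<Sum>x\<in>hyperoctahedral N.
      (2 * real i + 1) ^ ell N x * (2 * real j + 1) ^ ell N (k * (l * x)))" for l
  define G where "G \<gamma> = 2 ^ (N - 1) * 2 ^ N * (\<Sum>\<kappa>\<in>?F. ?A (\<kappa> \<circ> \<gamma>) - ?A' (\<kappa> \<circ> \<gamma>))" for \<gamma>
  have \<Lambda>: "\<Lambda> (signed_perm_mat N e \<gamma>) = G \<gamma>" if "v < N" "e \<in> near_signs N (-1) v" "\<gamma> \<in> ?R v" for e \<gamma> v
  proof -
    have "e \<in> signs N" using that(2) by (simp add: near_signs_def)
    from sum_full_cycle_class_pairing[OF N0 this almost_full_cycle_cycles(1)[OF that(1) assms(1) that(3)], of i j]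
    show ?thesis unfolding \<Lambda>_def G_def K_def prod_near_signs[OF that(2,1)] by simp
  qed
  have L0: "L \<noteq> {}"
    unfolding L_def by (rule average_near_class(1)[OF assms(1), where F = "\<lambda>_. 0" and G = "\<lambda>_. 0"]) auto
  have avg: "sum \<Lambda> L / real (card L) = (\<Sum>v<N. \<Sum>\<gamma>\<in>?R v. G \<gamma>) / (real N * fact (N - 2))"
    unfolding L_def by (rule average_near_class(2)[OF assms(1)]) (auto intro: \<Lambda>)
  have K0: "K \<noteq> {}" using card_full_cycle_class[OF N0] unfolding K_def by force
  have B: "K \<subseteq> hyperoctahedral N" "L \<subseteq> hyperoctahedral N" unfolding K_def L_def by (rule class_of_type_subset)+
  have cK: "real (card K) = 2 ^ (N - 1) * fact (N - 1)"
    unfolding K_def card_full_cycle_class[OF N0] by simp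
  have sums: "(\<Sum>v<N. \<Sum>\<gamma>\<in>?R v. \<Sum>\<kappa>\<in>?F. cycle_pairing N m l (\<kappa> \<circ> \<gamma>)) =
      fact (N - 2) * (fact N ^ 2 * parity_pairing N (-1) m l)" for m l
    using sum_full_cycle_comp_almost_full_cycle[of "{..<N}" "cycle_pairing N m l"]
      sum_cycle_pairing_parity[OF N0, of "-1" m l] assms(1) by simp
  have GG: "(\<Sum>v<N. \<Sum>\<gamma>\<in>?R v. G \<gamma>) = 2 ^ (N - 1) * 2 ^ N * (fact (N - 2) * fact N ^ 2 *
      (parity_pairing N (-1) (Suc i) (Suc j) - parity_pairing N (-1) i j))"
    unfolding G_def sum_distrib_left[symmetric] sum_subtractf sums by (simp add: algebra_simps)
  have "(\<Sum>a=0..N. \<Sum>b=0..N. (2 * real i + 1) ^ a * (2 * real j + 1) ^ b *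
      class_walk N [K, L] (ell_class N a) (ell_class N b)) = (sum \<Lambda> L / real (card L)) / real (card K)"
    unfolding sum_class_walk_2[OF K0 B(1) L0 B(2)] \<Lambda>_def by simp
  also have "\<dots> = 2 ^ N * fact N * (parity_pairing N (-1) (Suc i) (Suc j) - parity_pairing N (-1) i j)"
    unfolding avg GG cK fact_split[OF N0] using N0 by (simp add: field_simps power2_eq_square)
  finally show ?thesis .
qed

text \<open>The leftmost factor is absorbed into \<open>\<Lambda>\<close>, and the other three are
  averaged one at a time with the rest fixed. All total signs are 1, and the product of the four
  permutations is even.\<close>

lemma walk_full_full_near_near:
  assumes "2 \<le> N"
  defines "K \<equiv> class_of_type N ({#N#}, {#})" and "L \<equiv> class_of_type N (near_type N 1)"
  shows "(\<Sum>a=0..N. \<Sum>b=0..N. (2 * real i + 1) ^ a * (2 * real j + 1) ^ b *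
      class_walk N [K, K, L, L] (ell_class N a) (ell_class N b)) =
    2 ^ N * fact N * (parity_pairing N 1 (Suc i) (Suc j) + parity_pairing N 1 i j)"
proof -
  have N0: "0 < N" using assms(1) by simp
  let ?F = "full_cycles {..<N}" and ?A = "cycle_pairing N (Suc i) (Suc j)" and ?A' = "cycle_pairing N i j"
  let ?R = "\<lambda>v. full_cycles ({..<N} - {v})"
  define \<Lambda> where "\<Lambda> l = (\<Sum>k\<in>K. \<Sum>x\<in>hyperoctahedral N.
      (2 * real i + 1) ^ ell N x * (2 * real j + 1) ^ ell N (k * (l * x)))" for l
  define G where "G \<gamma> = 2 ^ (N - 1) * 2 ^ N * (\<Sum>\<kappa>\<in>?F. ?A (\<kappa> \<circ> \<gamma>) + ?A' (\<kappa> \<circ> \<gamma>))" for \<gamma>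
  have \<Lambda>: "\<Lambda> (signed_perm_mat N e \<gamma>) = G \<gamma>" if "e \<in> signs N" "prod e {..<N} = 1" "\<gamma> permutes {..<N}" for e \<gamma>
    using sum_full_cycle_class_pairing[OF N0 that(1,3), of i j] unfolding \<Lambda>_def G_def K_def that(2) by simp
  have near: "e \<in> signs N" "prod e {..<N} = 1" "\<gamma> permutes {..<N}"
    if "v < N" "e \<in> near_signs N 1 v" "\<gamma> \<in> ?R v" for e \<gamma> v
    using that prod_near_signs[OF that(2,1)] almost_full_cycle_cycles(1)[OF that(1) assms(1) that(3)]
    by (auto simp: near_signs_def)
  have comp: "\<Lambda> (signed_perm_mat N e1 \<kappa> * (signed_perm_mat N e2 \<rho> * signed_perm_mat N e3 \<rho>')) = G (\<kappa> \<circ> (\<rho> \<circ> \<rho>'))"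
    if 1: "e1 \<in> positive_signs N" "\<kappa> \<in> ?F" and 2: "v < N" "e2 \<in> near_signs N 1 v" "\<rho> \<in> ?R v"
      and 3: "v' < N" "e3 \<in> near_signs N 1 v'" "\<rho>' \<in> ?R v'" for e1 e2 e3 \<kappa> \<rho> \<rho>' v v'
  proof -
    have e1: "e1 \<in> signs N" "prod e1 {..<N} = 1" using 1 by (auto simp: positive_signs_def)
    note sh = signs_shift[OF near(1)[OF 2] near(1)[OF 3] near(3)[OF 3]]
    have \<rho>\<rho>': "\<rho> \<circ> \<rho>' permutes {..<N}" using near(3)[OF 3] near(3)[OF 2] by (rule permutes_compose)
    note sh' = signs_shift[OF e1(1) sh(1) \<rho>\<rho>']
    have "\<kappa> \<circ> (\<rho> \<circ> \<rho>') permutes {..<N}" using \<rho>\<rho>' full_cycles_permutes[OF 1(2)] by (rule permutes_compose)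
    then show ?thesis
      unfolding signed_perm_mat_mult[OF near(3)[OF 3]] signed_perm_mat_mult[OF \<rho>\<rho>']
      by (rule \<Lambda>[OF sh'(1), rotated]) (simp only: sh'(2) sh(2) e1(2) near(2)[OF 2] near(2)[OF 3] mult_1_left)
  qed
  have K0: "K \<noteq> {}" using card_full_cycle_class[OF N0] unfolding K_def by force
  have B: "K \<subseteq> hyperoctahedral N" "L \<subseteq> hyperoctahedral N" unfolding K_def L_def by (rule class_of_type_subset)+
  have cK: "real (card K) = 2 ^ (N - 1) * fact (N - 1)"
    unfolding K_def card_full_cycle_class[OF N0] by simp
  have avgK: "(\<Sum>k'\<in>K. \<Lambda> (k' * (signed_perm_mat N e2 \<rho> * signed_perm_mat N e3 \<rho>'))) / real (card K) =
      (\<Sum>\<kappa>\<in>?F. G (\<kappa> \<circ> (\<rho> \<circ> \<rho>'))) / fact (N - 1)"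
    if 2: "v < N" "e2 \<in> near_signs N 1 v" "\<rho> \<in> ?R v" and 3: "v' < N" "e3 \<in> near_signs N 1 v'" "\<rho>' \<in> ?R v'"
    for e2 e3 \<rho> \<rho>' v v'
    unfolding K_def
    by (rule average_full_cycle_class(2)[OF N0]) (rule comp[OF _ _ 2 3])
  define H where "H l' l = (\<Sum>k'\<in>K. \<Lambda> (k' * (l * l'))) / real (card K)" for l l'
  have avgL: "(\<Sum>l\<in>L. H (signed_perm_mat N e3 \<rho>') l) / real (card L) =
      (\<Sum>v<N. \<Sum>\<rho>\<in>?R v. (\<Sum>\<kappa>\<in>?F. G (\<kappa> \<circ> (\<rho> \<circ> \<rho>'))) / fact (N - 1)) / (real N * fact (N - 2))"
    if 3: "v' < N" "e3 \<in> near_signs N 1 v'" "\<rho>' \<in> ?R v'" for e3 \<rho>' v'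
    unfolding L_def
    by (rule average_near_class(2)[OF assms(1)]) (auto simp: H_def avgK[OF _ _ _ 3])
  have avgL': "(\<Sum>l'\<in>L. (\<Sum>l\<in>L. H l' l) / real (card L)) / real (card L) =
      (\<Sum>v'<N. \<Sum>\<rho>'\<in>?R v'. (\<Sum>v<N. \<Sum>\<rho>\<in>?R v. (\<Sum>\<kappa>\<in>?F. G (\<kappa> \<circ> (\<rho> \<circ> \<rho>'))) / fact (N - 1)) / (real N * fact (N - 2)))
        / (real N * fact (N - 2))"
    by (subst (2) L_def, subst (3) L_def, rule average_near_class(2)[OF assms(1)]) (auto simp: avgL)
  have L0: "L \<noteq> {}"
    unfolding L_def by (rule average_near_class(1)[OF assms(1), where F = "\<lambda>_. 0" and G = "\<lambda>_. 0"]) auto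
  let ?S = "\<lambda>m l. \<Sum>v'<N. \<Sum>\<rho>'\<in>?R v'. \<Sum>v<N. \<Sum>\<rho>\<in>?R v. \<Sum>\<kappa>'\<in>?F. \<Sum>\<kappa>\<in>?F. cycle_pairing N m l (\<kappa> \<circ> (\<kappa>' \<circ> (\<rho> \<circ> \<rho>')))"
  have sums: "?S m l = fact N * fact (N - 2) ^ 2 * (fact N ^ 2 * parity_pairing N 1 m l)" for m l
    using sum_four_cycles[of "{..<N}" "cycle_pairing N m l"]
      sum_cycle_pairing_parity[OF N0, of 1 m l] assms(1) by simp
  have GG: "(\<Sum>v'<N. \<Sum>\<rho>'\<in>?R v'. \<Sum>v<N. \<Sum>\<rho>\<in>?R v. \<Sum>\<kappa>\<in>?F. G (\<kappa> \<circ> (\<rho> \<circ> \<rho>'))) =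
      2 ^ (N - 1) * 2 ^ N * (fact N * fact (N - 2) ^ 2 * fact N ^ 2 *
        (parity_pairing N 1 (Suc i) (Suc j) + parity_pairing N 1 i j))"
    unfolding G_def sum_distrib_left[symmetric] sum.distrib sums by (simp add: algebra_simps)
  have "(\<Sum>a=0..N. \<Sum>b=0..N. (2 * real i + 1) ^ a * (2 * real j + 1) ^ b *
      class_walk N [K, K, L, L] (ell_class N a) (ell_class N b)) =
      ((\<Sum>l'\<in>L. (\<Sum>l\<in>L. H l' l) / real (card L)) / real (card L)) / real (card K)"
    unfolding sum_class_walk_4[OF K0 B(1) L0 B(2)] H_def \<Lambda>_def
    by (simp add: sum_divide_distrib[symmetric] power2_eq_square)
  also have "\<dots> = (\<Sum>v'<N. \<Sum>\<rho>'\<in>?R v'. \<Sum>v<N. \<Sum>\<rho>\<in>?R v. \<Sum>\<kappa>\<in>?F. G (\<kappa> \<circ> (\<rho> \<circ> \<rho>')))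
      / (fact (N - 1) * (real N * fact (N - 2)) ^ 2 * real (card K))"
    unfolding avgL' by (simp add: sum_divide_distrib[symmetric] power2_eq_square)
  also have "\<dots> = 2 ^ N * fact N * (parity_pairing N 1 (Suc i) (Suc j) + parity_pairing N 1 i j)"
    unfolding GG cK fact_split[OF N0] using N0 by (simp add: field_simps power2_eq_square)
  finally show ?thesis .
qed

lemma sum_power_ell_mu:
  assumes "2 \<le> N"
  shows "(\<Sum>a=0..N. \<Sum>b=0..N. (2 * real i + 1) ^ a * (2 * real j + 1) ^ b * mu N (ell_class N a) (ell_class N b)) =
    2 ^ N * fact N * (\<Sum>k=0..N. of_nat ((i + N - k) choose N) * of_nat ((j + N - k) choose N))"
proof -
  let ?f = "\<lambda>a b. (2 * real i + 1) ^ a * (2 * real j + 1) ^ b"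
  let ?w = "\<lambda>Ks. \<Sum>a=0..N. \<Sum>b=0..N. ?f a b * class_walk N Ks (ell_class N a) (ell_class N b)"
  let ?K = "class_of_type N ({#N#}, {#})" and ?L = "class_of_type N (near_type N (-1))" and ?M = "class_of_type N (near_type N 1)"
  let ?b = "\<lambda>k. of_nat ((i + N - k) choose N) * of_nat ((j + N - k) choose N) :: real"
  have "(\<Sum>a=0..N. \<Sum>b=0..N. ?f a b * mu N (ell_class N a) (ell_class N b)) =
      1 / 2 * ?w [?K, ?K] + 1 / 4 * ?w [?K, ?L] + 1 / 4 * ?w [?K, ?K, ?M, ?M]"
    unfolding mu_def Let_def near_type_def sum_distrib_left
    by (simp add: sum.distrib[symmetric] algebra_simps)
  \<comment> \<open>The products built from \<open>(i + 1) choose N\<close> and from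
    \<open>(i + N - 1) choose N\<close> occur with opposite signs in the two parity walks and
    cancel, while \<open>?b 0\<close> and \<open>?b N\<close> occur twice.\<close>
  also have "\<dots> = 2 ^ N * fact N * (1 / 2 * (hook_pairing N (Suc i) (Suc j) + hook_pairing N i j) + 1 / 2 * (?b 0 + ?b N))"
    unfolding walk_full_full[OF assms] walk_full_near[OF assms] walk_full_full_near_near[OF assms] parity_pairing_def
    by (simp add: algebra_simps)
  also have "hook_pairing N (Suc i) (Suc j) = (\<Sum>k<N. ?b k)"
    by (simp add: hook_pairing_def)
  also have "hook_pairing N i j = (\<Sum>k<N. ?b (Suc k))"
    by (simp add: hook_pairing_def)
  \<comment> \<open>The two hook sums are the full sum without its last and without its first
    term.\<close>
  also have "1 / 2 * ((\<Sum>k<N. ?b k) + (\<Sum>k<N. ?b (Suc k))) + 1 / 2 * (?b 0 + ?b N) = (\<Sum>k=0..N. ?b k)"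
  proof -
    have "(\<Sum>k=0..N. ?b k) = (\<Sum>k<N. ?b k) + ?b N" by (simp add: atLeast0AtMost lessThan_Suc_atMost[symmetric])
    moreover have "(\<Sum>k=0..N. ?b k) = ?b 0 + (\<Sum>k<N. ?b (Suc k))"
      by (simp only: atLeast0AtMost lessThan_Suc_atMost[symmetric] sum.lessThan_Suc_shift)
    moreover have "1 / 2 * (A + B) + 1 / 2 * (x + y) = S"
      if "S = A + y" "S = x + B" for A B x y S :: real
      using that by (simp add: field_simps)
    ultimately show ?thesis by blast
  qed
  finally show ?thesis .
qed

section \<open>Foulkes characters and carries\<close>

text \<open>The two sequences are the coefficients of \<open>(1 - X)^(N+1)\<close> and of
  \<open>X^k / (1 - X)^(N+1)\<close>, and the product of these series is \<open>X^k\<close>.\<close>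

lemma sum_alternating_binomial:
  assumes "i \<le> N" "k \<le> N"
  shows "(\<Sum>r=0..i. (-1) ^ (i - r) * of_nat ((N + 1) choose (i - r)) * of_nat ((r + N - k) choose N) :: real) =
    (if i = k then 1 else 0)"
proof -
  have expand: "((1 - fps_X) ^ Suc N :: real fps) $ n = (-1) ^ n * of_nat ((N + 1) choose n)" for n
  proof -
    have "(1 - fps_X) ^ Suc N = fps_of_poly ([:1, -1 :: real:] ^ Suc N)"
      by (simp only: fps_of_poly_power) (simp add: fps_of_poly_pCons)
    moreover have "coeff ([:1, -1 :: real:] ^ Suc N) n = (-1) ^ n * of_nat ((N + 1) choose n)"
    proof (cases "n \<le> Suc N")
      case True
      then show ?thesis using coeff_linear_poly_power[of n "Suc N" 1 "-1 :: real"] by simp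
    next
      case False
      then have "degree ([:1, -1 :: real:] ^ Suc N) < n" by (simp add: degree_linear_power degree_power_eq del: power_Suc)
      then show ?thesis using False by (simp add: coeff_eq_0 binomial_eq_0 del: power_Suc)
    qed
    ultimately show ?thesis by (simp only: fps_of_poly_nth)
  qed
  have "(\<Sum>r=0..i. (-1) ^ (i - r) * of_nat ((N + 1) choose (i - r)) * of_nat ((r + N - k) choose N) :: real) =
      (\<Sum>r=0..i. (fps_X ^ k * binomial_fps N) $ r * ((1 - fps_X) ^ Suc N) $ (i - r))"
  proof (rule sum.cong[OF refl])
    fix r
    have "(fps_X ^ k * binomial_fps N) $ r = of_nat ((r + N - k) choose N)"
    \<comment> \<open>For \<open>r < k\<close> the series has no term, and \<open>r + N - k\<close>
      is below \<open>N\<close>, so the binomial is zero as well.\<close>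
    proof (cases "r < k")
      case True
      then have "r + N - k < N" using assms(2) by linarith
      then show ?thesis unfolding fps_X_power_mult_nth using True by (simp add: binomial_eq_0)
    next
      case False
      then have "r - k + N = r + N - k" by simp
      then show ?thesis unfolding fps_X_power_mult_nth using False by (simp add: binomial_fps_def)
    qed
    then show "(-1) ^ (i - r) * of_nat ((N + 1) choose (i - r)) * of_nat ((r + N - k) choose N) =
        (fps_X ^ k * binomial_fps N) $ r * ((1 - fps_X) ^ Suc N) $ (i - r)"
      unfolding expand by simp
  qed
  also have "\<dots> = (fps_X ^ k * binomial_fps N * (1 - fps_X) ^ Suc N) $ i"
    by (simp only: fps_mult_nth)
  also have "\<dots> = (if i = k then 1 else 0)"
    unfolding mult.assoc binomial_fps_mult by (simp add: fps_X_power_nth)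
  finally show ?thesis .
qed

section \<open>Counting digit vectors\<close>

lemma card_bounded_sum:
  fixes b n :: nat
  shows "of_nat (card {D \<in> {..<n} \<rightarrow>\<^sub>E {..<b}. (\<Sum>t<n. D t) = r}) = ((\<Sum>d<b. fps_X ^ d :: real fps) ^ n) $ r"
proof -
  have "(\<Sum>d<b. fps_X ^ d :: real fps) ^ n = (\<Prod>t<n. \<Sum>d<b. fps_X ^ d)" by simp
  also have "\<dots> = (\<Sum>D\<in>{..<n} \<rightarrow>\<^sub>E {..<b}. \<Prod>t<n. fps_X ^ D t)"
    by (rule prod_sum_PiE) auto
  also have "\<dots> = (\<Sum>D\<in>{..<n} \<rightarrow>\<^sub>E {..<b}. fps_X ^ (\<Sum>t<n. D t))"
    by (simp add: power_sum)
  also have "\<dots> $ r = (\<Sum>D\<in>{..<n} \<rightarrow>\<^sub>E {..<b}. if (\<Sum>t<n. D t) = r then 1 else 0)"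
    unfolding fps_sum_nth fps_X_power_nth by (rule sum.cong[OF refl], rule if_cong[OF eq_commute refl refl])
  also have "\<dots> = of_nat (card {D \<in> {..<n} \<rightarrow>\<^sub>E {..<b}. (\<Sum>t<n. D t) = r})"
    by (subst sum.inter_filter[symmetric]) (auto intro: finite_PiE)
  finally show ?thesis by simp
qed

text \<open>The power equals \<open>(1 - X^b)^(n+1) / (1 - X)^(n+1)\<close>. Choosing
  \<open>k\<close> digits that violate the bound gives the sign and the shift by
  \<open>b k\<close>.\<close>

lemma geometric_sum_power_nth:
  "((\<Sum>d<b. fps_X ^ d :: real fps) ^ Suc n) $ r =
    (\<Sum>k | k \<le> Suc n \<and> b * k \<le> r. (-1) ^ k * of_nat (Suc n choose k) * of_nat ((r - b * k + n) choose n))"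
proof -
  let ?G = "\<Sum>d<b. fps_X ^ d :: real fps"
  have "?G * (1 - fps_X) = 1 - (fps_X ^ b)"
  proof (induction b)
    case (Suc b)
    have "(\<Sum>d<Suc b. fps_X ^ d) * (1 - fps_X) = (\<Sum>d<b. fps_X ^ d) * (1 - fps_X) + fps_X ^ b * (1 - fps_X :: real fps)"
      by (simp add: distrib_right)
    also have "\<dots> = 1 - fps_X ^ Suc b" unfolding Suc.IH by (simp add: algebra_simps)
    finally show ?case .
  qed simp
  then have "?G ^ Suc n * (1 - fps_X) ^ Suc n = (1 - fps_X ^ b) ^ Suc n"
    unfolding power_mult_distrib[symmetric] by simp
  then have "?G ^ Suc n * (binomial_fps n * (1 - fps_X) ^ Suc n) = (1 - fps_X ^ b) ^ Suc n * binomial_fps n"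
    by (simp only: ac_simps)
  then have "?G ^ Suc n = (1 - fps_X ^ b) ^ Suc n * binomial_fps n"
    unfolding binomial_fps_mult by simp
  also have "(1 - fps_X ^ b) ^ Suc n = (\<Sum>k\<le>Suc n. of_nat (Suc n choose k) * (- (fps_X ^ b)) ^ k :: real fps)"
    using binomial_ring[of "- (fps_X ^ b)" "1 :: real fps" "Suc n"] by simp
  also have "\<dots> = (\<Sum>k\<le>Suc n. fps_const ((-1) ^ k * of_nat (Suc n choose k)) * fps_X ^ (b * k))"
  proof (rule sum.cong[OF refl])
    fix k
    have m1: "(- (fps_X ^ b)) ^ k = (-1) ^ k * (fps_X ^ (b * k) :: real fps)"
      by (simp only: power_mult power_minus[of "fps_X ^ b"])
    have m2: "(-1) ^ k * of_nat (Suc n choose k) = fps_const ((-1) ^ k * of_nat (Suc n choose k) :: real)"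
      by (simp only: fps_const_mult[symmetric] fps_const_power[symmetric] fps_of_nat fps_const_neg[symmetric] fps_const_1_eq_1)
    show "of_nat (Suc n choose k) * (- (fps_X ^ b)) ^ k =
        fps_const ((-1) ^ k * of_nat (Suc n choose k)) * (fps_X ^ (b * k) :: real fps)"
      unfolding m1 m2[symmetric] by (simp only: ac_simps)
  qed
  finally have "?G ^ Suc n = (\<Sum>k\<le>Suc n. fps_const ((-1) ^ k * of_nat (Suc n choose k)) * (fps_X ^ (b * k) * binomial_fps n))"
    by (simp only: sum_distrib_right mult.assoc)
  then have "(?G ^ Suc n) $ r = (\<Sum>k\<le>Suc n. (-1) ^ k * of_nat (Suc n choose k) *
      (if b * k \<le> r then of_nat ((r - b * k + n) choose n) else 0))"
    by (simp only: fps_sum_nth fps_mult_left_const_nth)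
      (intro sum.cong refl, auto simp: fps_X_power_mult_nth binomial_fps_def)
  also have "\<dots> = (\<Sum>k\<in>{k\<in>{..Suc n}. b * k \<le> r}. (-1) ^ k * of_nat (Suc n choose k) * of_nat ((r - b * k + n) choose n))"
    by (subst sum.inter_filter) (auto intro!: sum.cong)
  finally show ?thesis by simp
qed

text \<open>The balanced digits are \<open>b\<close> consecutive integers starting at
  \<open>-h\<close>, so the next carry is \<open>\<kappa> + s + h\<close> divided by
  \<open>b\<close>, rounded down.\<close>

lemma next_carry_eq_iff:
  fixes b h :: int
  assumes "b = 2 * h + 1" "0 \<le> h"
  shows "next_carry b \<kappa> s = \<kappa>' \<longleftrightarrow> - h \<le> \<kappa> + s - b * \<kappa>' \<and> \<kappa> + s - b * \<kappa>' \<le> h"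
proof -
  have half: "(b - 1) div 2 = h" using assms by simp
  have digit: "\<kappa> + s - b * c \<in> balanced_digits b \<longleftrightarrow> c = (\<kappa> + s + h) div b" for c
  proof -
    have "\<kappa> + s - b * c \<in> balanced_digits b \<longleftrightarrow> 0 \<le> (\<kappa> + s + h) - b * c \<and> (\<kappa> + s + h) - b * c < b"
      unfolding balanced_digits_def half using assms by auto
    also have "\<dots> \<longleftrightarrow> c = (\<kappa> + s + h) div b"
    proof
      assume "0 \<le> (\<kappa> + s + h) - b * c \<and> (\<kappa> + s + h) - b * c < b"
      then show "c = (\<kappa> + s + h) div b" by (intro int_div_pos_eq[symmetric, of _ b c "(\<kappa> + s + h) - b * c"]) auto
    next
      assume c: "c = (\<kappa> + s + h) div b"
      have b0: "0 < b" using assms by simp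
      have eq: "(\<kappa> + s + h) - b * c = (\<kappa> + s + h) mod b" unfolding c by (simp add: minus_mult_div_eq_mod)
      show "0 \<le> (\<kappa> + s + h) - b * c \<and> (\<kappa> + s + h) - b * c < b"
        unfolding eq by (rule conjI[OF pos_mod_sign[OF b0] pos_mod_bound[OF b0]])
    qed
    finally show ?thesis .
  qed
  have "next_carry b \<kappa> s = (\<kappa> + s + h) div b" unfolding next_carry_def digit by simp
  then show ?thesis using digit[of \<kappa>'] unfolding balanced_digits_def half by auto
qed

text \<open>Adding \<open>h\<close> to every digit moves the digits to \<open>0, ..., 2h\<close>;
  the total shift \<open>N h\<close> equals \<open>(b - 1) N / 2\<close> and absorbs the shift of
  the two states. That the remaining digit lies between \<open>-h\<close> and \<open>h\<close>
  becomes an equation with a slack variable, whose range is again \<open>0, ..., 2h\<close>; it is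
  stored as digit number \<open>N\<close>.\<close>

lemma carries_matrix_eq:
  fixes h :: nat
  assumes "even N" "b = 2 * int h + 1"
  shows "carries_matrix b N i j = real (card {D \<in> {..<Suc N} \<rightarrow>\<^sub>E {..<2 * h + 1}.
      int i + (\<Sum>t<Suc N. int (D t)) = b * int j + int h}) / real_of_int b ^ N"
proof -
  let ?dig = "balanced_digits b" and ?B = "2 * h + 1"
  have dig: "?dig = {- int h .. int h}" using assms(2) by (simp add: balanced_digits_def)
  have b0: "0 < b" using assms(2) by simp
  have card_dig: "card ?dig = nat b" unfolding dig using assms(2) by simp
  let ?S = "PiE_dflt {..<N} 0 (\<lambda>_. ?dig)"
  have S: "finite ?S" "?S \<noteq> {}" unfolding dig by auto
  have cardS: "real (card ?S) = real_of_int b ^ N"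
    using card_PiE_dflt[of "{..<N}" "\<lambda>_. ?dig" 0] card_dig b0 by (simp add: dig)
  define ok where "ok U \<longleftrightarrow> next_carry b (int i - int (N div 2)) (\<Sum>t<N. U t) = int j - int (N div 2)" for U
  have "carries_matrix b N i j = real (card {U \<in> ?S. ok U}) / real_of_int b ^ N"
  proof -
    have "column_pmf b N = pmf_of_set ?S"
      unfolding column_pmf_def by (rule Pi_pmf_of_set) (auto simp: dig)
    then have "carries_matrix b N i j = measure (measure_pmf (pmf_of_set ?S)) {U. ok U}"
      unfolding carries_matrix_def carry_kernel_def pmf_map ok_def by (simp add: vimage_def)
    also have "\<dots> = real (card (?S \<inter> {U. ok U})) / real (card ?S)"
      by (rule measure_pmf_of_set[OF S(2,1)])
    finally show ?thesis unfolding cardS by (simp add: Int_def)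
  qed
  also have "card {U \<in> ?S. ok U} = card {D \<in> {..<Suc N} \<rightarrow>\<^sub>E {..<?B}. int i + (\<Sum>t<Suc N. int (D t)) = b * int j + int h}"
  proof -
    let ?X = "{D \<in> {..<Suc N} \<rightarrow>\<^sub>E {..<?B}. int i + (\<Sum>t<Suc N. int (D t)) = b * int j + int h}"
    obtain M where M: "N = 2 * M" using assms(1) by blast
    have ok_iff: "ok U \<longleftrightarrow> - int h \<le> int i + (\<Sum>t<N. U t + int h) - b * int j \<and>
        int i + (\<Sum>t<N. U t + int h) - b * int j \<le> int h" for U
    proof -
      have eq: "int i - int (N div 2) + (\<Sum>t<N. U t) - b * (int j - int (N div 2)) =
          int i + (\<Sum>t<N. U t + int h) - b * int j"
        unfolding sum.distrib assms(2) M by (simp add: algebra_simps)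
      show ?thesis unfolding ok_def next_carry_eq_iff[OF assms(2) of_nat_0_le_iff] eq ..
    qed
    define T where "T D = (\<Sum>t<N. int (D t))" for D :: "nat \<Rightarrow> nat"
    \<comment> \<open>Coordinate \<open>N\<close> holds the slack variable, which the other digits
      determine; \<open>from'\<close> forgets it.\<close>
    define to where "to U = (\<lambda>t\<in>{..<Suc N}. if t < N then nat (U t + int h)
      else nat (b * int j + int h - int i - (\<Sum>t<N. U t + int h)))" for U :: "nat \<Rightarrow> int"
    define from' where "from' D = (\<lambda>t. if t < N then int (D t) - int h else 0)" for D :: "nat \<Rightarrow> nat"
    have "bij_betw to {U \<in> ?S. ok U} ?X"
    proof (rule bij_betwI[where g = from'])
      show "to \<in> {U \<in> ?S. ok U} \<rightarrow> ?X"
      proof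
        fix U assume "U \<in> {U \<in> ?S. ok U}"
        then have U: "\<And>t. t < N \<Longrightarrow> - int h \<le> U t \<and> U t \<le> int h" and "ok U"
          by (auto simp: PiE_dflt_def dig)
        define R where "R = b * int j + int h - int i - (\<Sum>t<N. U t + int h)"
        have R: "0 \<le> R" "R < int ?B" using \<open>ok U\<close> unfolding ok_iff R_def by auto
        have val: "int (to U t) = U t + int h" "to U t < ?B" if "t < N" for t
          using that U[OF that] by (auto simp: to_def)
        have last: "int (to U N) = R" "to U N < ?B" using R unfolding to_def R_def by auto
        have "(\<Sum>t<N. int (to U t)) = (\<Sum>t<N. U t + int h)" using val by (intro sum.cong) auto
        then have "int i + (\<Sum>t<Suc N. int (to U t)) = b * int j + int h"
          using last by (simp add: R_def)
        moreover have "to U \<in> {..<Suc N} \<rightarrow>\<^sub>E {..<?B}"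
        proof
          fix t assume "t \<in> {..<Suc N}"
          then show "to U t \<in> {..<?B}" using val(2)[of t] last(2) by (cases "t = N") auto
        qed (simp add: to_def)
        ultimately show "to U \<in> ?X" by blast
      qed
      show "from' \<in> ?X \<rightarrow> {U \<in> ?S. ok U}"
      proof
        fix D assume "D \<in> ?X"
        then have D: "\<And>t. t < Suc N \<Longrightarrow> D t < ?B" and eq: "int i + (\<Sum>t<Suc N. int (D t)) = b * int j + int h"
          by (auto simp: PiE_def Pi_def)
        have "int (D t) \<le> 2 * int h" if "t < N" for t using D[of t] that by simp
        then have "from' D \<in> ?S" unfolding PiE_dflt_def dig from'_def by auto
        moreover have "(\<Sum>t<N. from' D t + int h) = T D"
          unfolding T_def by (intro sum.cong) (auto simp: from'_def)
        moreover have "int i + T D + int (D N) = b * int j + int h" using eq by (simp add: T_def)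
        moreover have "int (D N) \<le> 2 * int h" using D[of N] by simp
        ultimately show "from' D \<in> {U \<in> ?S. ok U}" unfolding ok_iff by auto
      qed
      show "from' (to U) = U" if "U \<in> {U \<in> ?S. ok U}" for U
      proof
        fix t
        show "from' (to U) t = U t"
          using that by (cases "t < N") (auto simp: from'_def to_def PiE_dflt_def dig)
      qed
      show "to (from' D) = D" if "D \<in> ?X" for D
      proof
        fix t
        have eq: "int i + (\<Sum>t<N. int (D t)) + int (D N) = b * int j + int h" using that by simp
        have s: "(\<Sum>t<N. from' D t + int h) = (\<Sum>t<N. int (D t))" by (intro sum.cong) (auto simp: from'_def)
        have ext: "D \<in> extensional {..<Suc N}" using that by (auto simp: PiE_def)
        consider "t < N" | "t = N" | "t > N" by linarith
        then show "to (from' D) t = D t"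
        proof cases
          case 2
          have "b * int j + int h - int i - (\<Sum>t<N. int (D t)) = int (D N)" using eq by simp
          then show ?thesis using 2 unfolding to_def s by simp
        qed (use ext in \<open>auto simp: to_def from'_def extensional_def\<close>)
      qed
    qed
    then show ?thesis by (rule bij_betw_same_card)
  qed
  finally show ?thesis .
qed

text \<open>Inclusion and exclusion over the digits exceeding \<open>2h\<close>, of which
  \<open>k = j - s\<close> are chosen. Indexed by \<open>s\<close>, the binomials contain
  \<open>(2h + 1) s + h\<close>, the index that the twist by \<open>b\<close> produces from
  \<open>s\<close>.\<close>

lemma card_carry_digits:
  assumes "i \<le> N" "j \<le> N"
  shows "real (card {D \<in> {..<Suc N} \<rightarrow>\<^sub>E {..<2 * h + 1}.
      int i + (\<Sum>t<Suc N. int (D t)) = (2 * int h + 1) * int j + int h}) =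
    (\<Sum>s=0..j. (-1) ^ (j - s) * of_nat ((N + 1) choose (j - s)) * of_nat (((2 * h + 1) * s + h + N - i) choose N))"
proof -
  let ?B = "2 * h + 1"
  let ?t = "\<lambda>k. (-1) ^ k * of_nat ((N + 1) choose k) * of_nat ((?B * (j - k) + h + N - i) choose N) :: real"
  have rev: "(\<Sum>s=0..j. (-1) ^ (j - s) * of_nat ((N + 1) choose (j - s)) * of_nat ((?B * s + h + N - i) choose N)) =
      (\<Sum>k=0..j. ?t k)"
    by (rule sum.reindex_bij_witness[of _ "\<lambda>k. j - k" "\<lambda>s. j - s"]) auto
  \<comment> \<open>Covers the summands that have no counterpart in the count: the upper entry of
    the binomial is below \<open>N\<close>.\<close>
  have vanish: "?t k = 0" if "?B * (j - k) + h < i" for k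
    using that assms(1) by (simp add: binomial_eq_0)
  have set_eq: "{D \<in> {..<Suc N} \<rightarrow>\<^sub>E {..<?B}. int i + (\<Sum>t<Suc N. int (D t)) = (2 * int h + 1) * int j + int h} =
      {D \<in> {..<Suc N} \<rightarrow>\<^sub>E {..<?B}. i + (\<Sum>t<Suc N. D t) = ?B * j + h}"
  proof -
    have "int i + (\<Sum>t<Suc N. int (D t)) = (2 * int h + 1) * int j + int h \<longleftrightarrow> i + (\<Sum>t<Suc N. D t) = ?B * j + h"
      for D :: "nat \<Rightarrow> nat"
    proof -
      have "int (i + (\<Sum>t<Suc N. D t)) = int i + (\<Sum>t<Suc N. int (D t))"
        "int (?B * j + h) = (2 * int h + 1) * int j + int h" by (simp_all add: algebra_simps)
      then show ?thesis by (metis of_nat_eq_iff)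
    qed
    then show ?thesis by simp
  qed
  show ?thesis
  proof (cases "?B * j + h < i")
    case True
    then have "i + S \<noteq> ?B * j + h" for S by linarith
    then have empty: "{D \<in> {..<Suc N} \<rightarrow>\<^sub>E {..<?B}. i + (\<Sum>t<Suc N. D t) = ?B * j + h} = {}" by blast
    have below: "?B * (j - k) + h < i" for k
    proof -
      have "?B * (j - k) \<le> ?B * j" by (rule mult_le_mono2) simp
      with True show ?thesis by linarith
    qed
    have "(\<Sum>k=0..j. ?t k) = 0" by (rule sum.neutral, rule ballI, rule vanish[OF below])
    then show ?thesis unfolding set_eq empty rev by (simp only: card.empty of_nat_0)
  next
    case False
    define r where "r = ?B * j + h - i"
    \<comment> \<open>As \<open>r < ?B * (j + 1)\<close>, at most \<open>j\<close> digits can exceed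
      the bound, so the summation over \<open>k\<close> fits into \<open>0, ..., j\<close>.\<close>
    have below: "?B * k < ?B * (j + 1)" if "?B * k \<le> r" for k
    proof -
      have "r < ?B * j + ?B" unfolding r_def by simp
      moreover have "?B * (j + 1) = ?B * j + ?B" by simp
      ultimately show ?thesis using that by (metis le_less_trans)
    qed
    have "i + S = ?B * j + h \<longleftrightarrow> S = r" for S
      using False unfolding r_def by linarith
    then have "{D \<in> {..<Suc N} \<rightarrow>\<^sub>E {..<?B}. i + (\<Sum>t<Suc N. D t) = ?B * j + h} =
        {D \<in> {..<Suc N} \<rightarrow>\<^sub>E {..<?B}. (\<Sum>t<Suc N. D t) = r}" by (simp only:)
    then have "real (card {D \<in> {..<Suc N} \<rightarrow>\<^sub>E {..<?B}. i + (\<Sum>t<Suc N. D t) = ?B * j + h}) =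
        (\<Sum>k | k \<le> Suc N \<and> ?B * k \<le> r. (-1) ^ k * of_nat (Suc N choose k) * of_nat ((r - ?B * k + N) choose N))"
      using card_bounded_sum[of "Suc N" ?B r] geometric_sum_power_nth[of ?B N r] by (simp only:)
    also have "\<dots> = (\<Sum>k\<in>{k. k \<le> Suc N \<and> ?B * k \<le> r}. ?t k)"
    proof (rule sum.cong[OF refl])
      fix k assume "k \<in> {k. k \<le> Suc N \<and> ?B * k \<le> r}"
      then have k: "?B * k \<le> r" by simp
      then have "?B * k < ?B * (j + 1)" by (rule below)
      then have "k < j + 1" by (simp only: mult_less_cancel1)
      then have "?B * (j - k) + ?B * k = ?B * j" by (simp flip: distrib_left)
      then have "r - ?B * k + N = ?B * (j - k) + h + N - i" using k False unfolding r_def by linarith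
      then show "(-1) ^ k * of_nat (Suc N choose k) * of_nat ((r - ?B * k + N) choose N) = ?t k"
        by (simp only: Suc_eq_plus1)
    qed
    also have "\<dots> = (\<Sum>k=0..j. ?t k)"
    proof (rule sum.mono_neutral_left)
      show "{k. k \<le> Suc N \<and> ?B * k \<le> r} \<subseteq> {0..j}"
      proof
        fix k assume "k \<in> {k. k \<le> Suc N \<and> ?B * k \<le> r}"
        then have "?B * k \<le> r" by simp
        then have "?B * k < ?B * (j + 1)" by (rule below)
        then have "k < j + 1" by (simp only: mult_less_cancel1)
        then show "k \<in> {0..j}" by simp
      qed
      show "\<forall>k\<in>{0..j} - {k. k \<le> Suc N \<and> ?B * k \<le> r}. ?t k = 0"
      proof
        fix k assume k: "k \<in> {0..j} - {k. k \<le> Suc N \<and> ?B * k \<le> r}"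
        then have "k \<le> j" "r < ?B * k" using assms(2) by auto
        then have "?B * (j - k) + ?B * k = ?B * j" by (simp flip: distrib_left)
        then have "?B * (j - k) + h < i" using \<open>r < ?B * k\<close> False unfolding r_def by linarith
        then show "?t k = 0" by (rule vanish)
      qed
    qed simp
    finally show ?thesis unfolding set_eq rev .
  qed
qed

section \<open>Foulkes characters as real functions of \<open>ell\<close>\<close>

definition foulkes_value :: "nat \<Rightarrow> nat \<Rightarrow> nat \<Rightarrow> real" where
  "foulkes_value N i a = (\<Sum>r=0..i. (-1) ^ (i - r) * of_nat ((N + 1) choose (i - r)) * (2 * real r + 1) ^ a)"

lemma foulkes_char_eq:
  assumes "i \<le> N"
  shows "foulkes_char N i x = complex_of_real (foulkes_value N i (ell N x))"
proof -
  have "foulkes_char N i x = (\<Sum>r=0..i. (-1) powi (int i - int r) * of_nat ((N + 1) choose (i - r)) * (2 * of_nat r + 1) ^ ell N x)"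
    unfolding foulkes_char_def using assms by (intro sum.mono_neutral_cong_right) auto
  also have "\<dots> = (\<Sum>r=0..i. complex_of_real ((-1) ^ (i - r) * of_nat ((N + 1) choose (i - r)) * (2 * real r + 1) ^ ell N x))"
  proof (rule sum.cong[OF refl])
    fix r assume "r \<in> {0..i}"
    then have "int i - int r = int (i - r)" by simp
    then have "(-1 :: complex) powi (int i - int r) = (-1) ^ (i - r)" by (simp only: power_int_of_nat)
    then show "(-1) powi (int i - int r) * of_nat ((N + 1) choose (i - r)) * (2 * of_nat r + 1) ^ ell N x =
        complex_of_real ((-1) ^ (i - r) * of_nat ((N + 1) choose (i - r)) * (2 * real r + 1) ^ ell N x)" by simp
  qed
  finally show ?thesis by (simp add: foulkes_value_def)
qed

text \<open>Solving \<open>2t + 1 = b (2s + 1)\<close> for \<open>b = 2h + 1\<close> gives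
  \<open>t = (2h + 1) s + h\<close>, a natural number because \<open>b\<close> is odd.\<close>

lemma twisted_foulkes_char_eq:
  fixes h :: nat
  assumes "j \<le> N" "b = 2 * int h + 1"
  shows "of_int b powi (int (ell N x) - int N) * foulkes_char N j x =
    complex_of_real ((\<Sum>s=0..j. (-1) ^ (j - s) * of_nat ((N + 1) choose (j - s))
      * (2 * real ((2 * h + 1) * s + h) + 1) ^ ell N x) / real_of_int b ^ N)"
proof -
  have b0: "real_of_int b \<noteq> 0" using assms(2) by simp
  have "(of_int b :: complex) powi (int (ell N x) - int N) = complex_of_real (real_of_int b ^ ell N x / real_of_int b ^ N)"
    using b0 by (simp add: power_int_diff)
  moreover have "real_of_int b ^ ell N x * foulkes_value N j (ell N x) =
      (\<Sum>s=0..j. (-1) ^ (j - s) * of_nat ((N + 1) choose (j - s)) * (2 * real ((2 * h + 1) * s + h) + 1) ^ ell N x)"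
    unfolding foulkes_value_def sum_distrib_left
  proof (rule sum.cong[OF refl])
    fix s
    have "2 * real ((2 * h + 1) * s + h) + 1 = real_of_int b * (2 * real s + 1)"
      unfolding assms(2) by (simp add: algebra_simps)
    then show "real_of_int b ^ ell N x * ((-1) ^ (j - s) * of_nat ((N + 1) choose (j - s)) * (2 * real s + 1) ^ ell N x) =
        (-1) ^ (j - s) * of_nat ((N + 1) choose (j - s)) * (2 * real ((2 * h + 1) * s + h) + 1) ^ ell N x"
      by (simp only: power_mult_distrib ac_simps)
  qed
  ultimately show ?thesis
    unfolding foulkes_char_eq[OF assms(1)]
    by (simp only: of_real_mult[symmetric] times_divide_eq_left)
qed

text \<open>\<open>class_value\<close> is unspecified on an empty class, but \<open>mu\<close>
  vanishes there, so the formula holds without knowing which classes are inhabited. Real values make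
  the conjugation trivial.\<close>

lemma CF_inner_real:
  assumes \<theta>: "\<And>x. \<theta> x = complex_of_real (f (ell N x))" and \<psi>: "\<And>x. \<psi> x = complex_of_real (g (ell N x))"
  shows "CF_inner N \<theta> \<psi> = complex_of_real ((\<Sum>a=0..N. \<Sum>c=0..N. f a * g c * mu N (ell_class N a) (ell_class N c))
    / (2 ^ N * fact N))"
proof -
  have val: "class_value N \<phi> a = complex_of_real (k a)"
    if "\<And>x. \<phi> x = complex_of_real (k (ell N x))" "ell_class N a \<noteq> {}" for \<phi> k a
  proof -
    have "\<phi> ` ell_class N a = {complex_of_real (k a)}"
      using that by (auto simp: ell_class_def)
    then show ?thesis by (simp add: class_value_def)
  qed
  have empty: "mu N {} T = 0" "mu N S {} = 0" for S T
    by (simp_all add: mu_def class_walk_def Let_def)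
  have eq: "class_value N \<theta> a * cnj (class_value N \<psi> c) * complex_of_real (mu N (ell_class N a) (ell_class N c)) =
      complex_of_real (f a * g c * mu N (ell_class N a) (ell_class N c))" for a c
  proof (cases "ell_class N a = {} \<or> ell_class N c = {}")
    case True
    then show ?thesis using empty by auto
  next
    case False
    have "class_value N \<theta> a = complex_of_real (f a)" "class_value N \<psi> c = complex_of_real (g c)"
      by (rule val; use \<theta> \<psi> False in blast)+
    then show ?thesis by simp
  qed
  show ?thesis
    unfolding CF_inner_def card_hyperoctahedral eq by simp
qed

theorem theorem3p19:
  fixes N :: nat and b :: int and i j :: nat
  assumes "N \<ge> 2" and "even N"
    and "b \<ge> 3" and "odd b"
    and "i \<le> N" and "j \<le> N"
  shows "complex_of_real (carries_matrix b N i j) =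
    CF_inner N (foulkes_char N i)
      (\<lambda>x. of_int b powi (int (ell N x) - int N) * foulkes_char N j x)"
proof -
  define h where "h = nat ((b - 1) div 2)"
  have b: "b = 2 * int h + 1" using assms(3,4) unfolding h_def by (auto elim!: oddE)
  let ?\<alpha> = "\<lambda>i r. (-1) ^ (i - r) * of_nat ((N + 1) choose (i - r)) :: real"
  let ?q = "\<lambda>s. (2 * h + 1) * s + h"
  let ?g = "\<lambda>c. (\<Sum>s=0..j. ?\<alpha> j s * (2 * real (?q s) + 1) ^ c) / real_of_int b ^ N"
  let ?M = "2 ^ N * fact N :: real"
  have "(\<Sum>a=0..N. \<Sum>c=0..N. foulkes_value N i a * ?g c * mu N (ell_class N a) (ell_class N c)) =
      (\<Sum>r=0..i. \<Sum>s=0..j. ?\<alpha> i r * ?\<alpha> j s *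
        (\<Sum>a=0..N. \<Sum>c=0..N. (2 * real r + 1) ^ a * (2 * real (?q s) + 1) ^ c * mu N (ell_class N a) (ell_class N c)))
      / real_of_int b ^ N"
  proof -
    define m where "m a c = mu N (ell_class N a) (ell_class N c)" for a c
    define P where "P r a = ?\<alpha> i r * (2 * real r + 1) ^ a" for r a
    define Q where "Q s c = ?\<alpha> j s * (2 * real (?q s) + 1) ^ c" for s c
    have "(\<Sum>a=0..N. \<Sum>c=0..N. (\<Sum>r=0..i. P r a) * ((\<Sum>s=0..j. Q s c) / real_of_int b ^ N) * m a c) =
        (\<Sum>a=0..N. \<Sum>c=0..N. \<Sum>r=0..i. \<Sum>s=0..j. P r a * Q s c * m a c) / real_of_int b ^ N"
    proof -
      have "(\<Sum>r=0..i. P r a) * ((\<Sum>s=0..j. Q s c) / real_of_int b ^ N) * m a c =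
          (\<Sum>r=0..i. \<Sum>s=0..j. P r a * Q s c * m a c) / real_of_int b ^ N" for a c
      proof -
        have "(\<Sum>r=0..i. P r a) * ((\<Sum>s=0..j. Q s c) / real_of_int b ^ N) * m a c =
            ((\<Sum>r=0..i. P r a) * (\<Sum>s=0..j. Q s c) * m a c) / real_of_int b ^ N" by simp
        moreover have "(\<Sum>r=0..i. P r a) * (\<Sum>s=0..j. Q s c) * m a c = (\<Sum>r=0..i. \<Sum>s=0..j. P r a * Q s c * m a c)"
          unfolding sum_product unfolding sum_distrib_right ..
        ultimately show ?thesis by (simp only:)
      qed
      then show ?thesis by (simp only: sum_divide_distrib)
    qed
    also have "(\<Sum>a=0..N. \<Sum>c=0..N. \<Sum>r=0..i. \<Sum>s=0..j. P r a * Q s c * m a c) =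
        (\<Sum>a=0..N. \<Sum>r=0..i. \<Sum>c=0..N. \<Sum>s=0..j. P r a * Q s c * m a c)"
      by (rule sum.cong[OF refl], rule sum.swap)
    also have "\<dots> = (\<Sum>r=0..i. \<Sum>a=0..N. \<Sum>c=0..N. \<Sum>s=0..j. P r a * Q s c * m a c)"
      by (rule sum.swap)
    also have "\<dots> = (\<Sum>r=0..i. \<Sum>a=0..N. \<Sum>s=0..j. \<Sum>c=0..N. P r a * Q s c * m a c)"
      by (rule sum.cong[OF refl], rule sum.cong[OF refl], rule sum.swap)
    also have "\<dots> = (\<Sum>r=0..i. \<Sum>s=0..j. \<Sum>a=0..N. \<Sum>c=0..N. P r a * Q s c * m a c)"
      by (rule sum.cong[OF refl], rule sum.swap)
    also have "\<dots> = (\<Sum>r=0..i. \<Sum>s=0..j. ?\<alpha> i r * ?\<alpha> j s *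
        (\<Sum>a=0..N. \<Sum>c=0..N. (2 * real r + 1) ^ a * (2 * real (?q s) + 1) ^ c * m a c))"
      unfolding P_def Q_def sum_distrib_left by (intro sum.cong refl) (simp only: ac_simps)
    finally show ?thesis unfolding P_def Q_def m_def foulkes_value_def .
  qed
  \<comment> \<open>\<open>?M\<close> is the order of the group; the normalisation of the inner
    product removes it at the end.\<close>
  also have "\<dots> = ?M * ((\<Sum>r=0..i. \<Sum>s=0..j. \<Sum>k=0..N. ?\<alpha> j s * of_nat ((?q s + N - k) choose N) *
      (?\<alpha> i r * of_nat ((r + N - k) choose N))) / real_of_int b ^ N)"
    unfolding sum_power_ell_mu[OF assms(1)] times_divide_eq_right sum_distrib_left
    by (intro arg_cong2[of _ _ _ _ "(/)"] sum.cong refl) (simp only: ac_simps)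
  also have "(\<Sum>r=0..i. \<Sum>s=0..j. \<Sum>k=0..N. ?\<alpha> j s * of_nat ((?q s + N - k) choose N) *
      (?\<alpha> i r * of_nat ((r + N - k) choose N))) = (\<Sum>s=0..j. ?\<alpha> j s * of_nat ((?q s + N - i) choose N))"
  proof -
    have "(\<Sum>r=0..i. \<Sum>s=0..j. \<Sum>k=0..N. ?\<alpha> j s * of_nat ((?q s + N - k) choose N) *
        (?\<alpha> i r * of_nat ((r + N - k) choose N))) =
        (\<Sum>s=0..j. \<Sum>r=0..i. \<Sum>k=0..N. ?\<alpha> j s * of_nat ((?q s + N - k) choose N) *
        (?\<alpha> i r * of_nat ((r + N - k) choose N)))" by (rule sum.swap)
    \<comment> \<open>With the sum over \<open>r\<close> innermost, the inversion formula leaves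
      only \<open>k = i\<close>.\<close>
    also have "\<dots> = (\<Sum>s=0..j. \<Sum>k=0..N. ?\<alpha> j s * of_nat ((?q s + N - k) choose N) *
        (\<Sum>r=0..i. ?\<alpha> i r * of_nat ((r + N - k) choose N)))"
      unfolding sum_distrib_left by (rule sum.cong[OF refl], rule sum.swap)
    also have "\<dots> = (\<Sum>s=0..j. \<Sum>k=0..N. if k = i then ?\<alpha> j s * of_nat ((?q s + N - k) choose N) else 0)"
    proof (rule sum.cong[OF refl], rule sum.cong[OF refl])
      fix s k assume "k \<in> {0..N}"
      then have "k \<le> N" by simp
      show "?\<alpha> j s * of_nat ((?q s + N - k) choose N) * (\<Sum>r=0..i. ?\<alpha> i r * of_nat ((r + N - k) choose N)) =
          (if k = i then ?\<alpha> j s * of_nat ((?q s + N - k) choose N) else 0)"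
        unfolding sum_alternating_binomial[OF assms(5) \<open>k \<le> N\<close>] by auto
    qed
    also have "\<dots> = (\<Sum>s=0..j. ?\<alpha> j s * of_nat ((?q s + N - i) choose N))"
      using assms(5) by (simp add: sum.delta)
    finally show ?thesis .
  qed
  also have "(\<Sum>s=0..j. ?\<alpha> j s * of_nat ((?q s + N - i) choose N)) / real_of_int b ^ N = carries_matrix b N i j"
    unfolding carries_matrix_eq[OF assms(2) b] unfolding b card_carry_digits[OF assms(5,6)] ..
  finally have total: "(\<Sum>a=0..N. \<Sum>c=0..N. foulkes_value N i a * ?g c * mu N (ell_class N a) (ell_class N c)) =
      ?M * carries_matrix b N i j" .
  have "CF_inner N (foulkes_char N i) (\<lambda>x. of_int b powi (int (ell N x) - int N) * foulkes_char N j x) =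
      complex_of_real ((\<Sum>a=0..N. \<Sum>c=0..N. foulkes_value N i a * ?g c * mu N (ell_class N a) (ell_class N c)) / ?M)"
    by (rule CF_inner_real) (rule foulkes_char_eq[OF assms(5)], rule twisted_foulkes_char_eq[OF assms(6) b])
  then show ?thesis unfolding total by simp
qed

end
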